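(* Let $\mu$ be an admissible even Borel probability measure on $\mathbb{R}$ that satisfies the $\Lambda^{\ast}$-condition. Then, for any $\delta\in\left(0,\tfrac{1}{2}\right)$, $$\lim_{n\to\infty}\varrho(\mu_n,\delta)=0,\qquad\text{where } \varrho(\mu_n,\delta):=\varrho_2(\mu_n,\delta)-\varrho_1(\mu_n,\delta).$$
   Context: Let $X$ be a random variable with distribution $\mu$. Write $x^{\ast}=\sup\{x\in\mathbb{R}:\mu([x,\infty))>0\}$ (possibly $+\infty$), $I=(-x^{\ast},x^{\ast})$, $\Lambda_\mu(t)=\ln\int_{\mathbb{R}} e^{tx}\,d\mu(x)$, and $\Lambda_\mu^{\ast}(x)=\sup_{t\in\mathbb{R}}\{tx-\Lambda_\mu(t)\}$ (Legendre transform). The measure $\mu$ is called admissible if: $\mathrm{Var}(X)>0$; there is $r>0$ with $\mathbb{E}e^{tX}<\infty$ for all $t\in(-r,r)$; if $x^{\ast}<\infty$ then $\mu(\{x^{\ast}\})=0$; and one of the following holds: (1) $x^{\ast}<\infty$, or (2) $x^{\ast}=+\infty$ and $\{\Lambda_\mu<\infty\}=\mathbb{R}$, or (3) $x^{\ast}=+\infty$, $\{\Lambda_\mu<\infty\}$ is bounded and $\mu$ is log-concave. The measure $\mu$ satisfies the $\Lambda^{\ast}$-condition if $\lim_{x\uparrow x^{\ast}}\frac{-\ln\mu([x,\infty))}{\Lambda_\mu^{\ast}(x)}=1$. Let $\mu_n=\mu^{\otimes n}$ on $\mathbb{R}^n$. For $N>n$ let $\vec X_1,\dots,\vec X_N$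 be independent random vectors in $\mathbb{R}^n$ each with distribution $\mu_n$ (joint law $\mu_n^N$), and $K_N=\mathrm{conv}\{\vec X_1,\dots,\vec X_N\}$. For $\delta\in(0,\tfrac12)$ define $\varrho_1(\mu_n,\delta)=\sup\{\varrho_1:\sup\{\mathbb{E}_{\mu_n^N}[\mu_n(K_N)]:N\le \exp(\varrho_1 n)\}\le\delta\}$ and $\varrho_2(\mu_n,\delta)=\inf\{\varrho_2:\inf\{\mathbb{E}_{\mu_n^N}[\mu_n(K_N)]:N\ge\exp(\varrho_2 n)\}\ge 1-\delta\}$. *)

theory Defs
  imports "HOL-Probability.Probability"
begin

definition borel_prob :: "real measure \<Rightarrow> bool" where
  "borel_prob \<mu> \<longleftrightarrow> prob_space \<mu> \<and> sets \<mu> = sets borel"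

definition even_measure :: "real measure \<Rightarrow> bool" where
  "even_measure \<mu> \<longleftrightarrow> (\<forall>A\<in>sets borel. emeasure \<mu> (uminus ` A) = emeasure \<mu> A)"

definition x_star :: "real measure \<Rightarrow> ereal" where
  "x_star \<mu> = Sup (ereal ` {x. measure \<mu> {x..} > 0})"

definition mgf :: "real measure \<Rightarrow> real \<Rightarrow> ennreal" where
  "mgf \<mu> t = (\<integral>\<^sup>+ x. ennreal (exp (t * x)) \<partial>\<mu>)"

definition Lambda :: "real measure \<Rightarrow> real \<Rightarrow> ereal" where
  "Lambda \<mu> t = (if mgf \<mu> t = \<infinity> then \<infinity> else ereal (ln (enn2real (mgf \<mu> t))))"

definition Lambda_star :: "real measure \<Rightarrow> real \<Rightarrow> ereal" where
  "Lambda_star \<mu> x = (SUP t. ereal (t * x) - Lambda \<mu> t)"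

definition log_concave_measure :: "real measure \<Rightarrow> bool" where
  "log_concave_measure \<mu> \<longleftrightarrow>
     (\<forall>A B l. compact A \<and> compact B \<and> 0 < l \<and> l < 1 \<longrightarrow>
        measure \<mu> {l * a + (1 - l) * b | a b. a \<in> A \<and> b \<in> B}
          \<ge> measure \<mu> A powr l * measure \<mu> B powr (1 - l))"

definition admissible :: "real measure \<Rightarrow> bool" where
  "admissible \<mu> \<longleftrightarrow>
     (\<integral>x. (x - (\<integral>y. y \<partial>\<mu>))\<^sup>2 \<partial>\<mu>) > 0
   \<and> (\<exists>r>0. \<forall>t. -r < t \<and> t < r \<longrightarrow> mgf \<mu> t < \<infinity>)
   \<and> (x_star \<mu> < \<infinity> \<longrightarrow> measure \<mu> {real_of_ereal (x_star \<mu>)} = 0)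
   \<and> (x_star \<mu> < \<infinity>
      \<or> (x_star \<mu> = \<infinity> \<and> (\<forall>t. mgf \<mu> t < \<infinity>))
      \<or> (x_star \<mu> = \<infinity> \<and> bounded {t. mgf \<mu> t < \<infinity>} \<and> log_concave_measure \<mu>))"

definition Lambda_star_condition :: "real measure \<Rightarrow> bool" where
  "Lambda_star_condition \<mu> \<longleftrightarrow>
     ((\<lambda>x. ereal (- ln (measure \<mu> {x..})) / Lambda_star \<mu> x) \<longlongrightarrow> 1)
       (if x_star \<mu> = \<infinity> then at_top else at_left (real_of_ereal (x_star \<mu>)))"

text \<open>mu_n = mu^{(x)n} on R^n, R^n modelled as extensional functions on {..<n}.\<close>
definition mu_n :: "real measure \<Rightarrow> nat \<Rightarrow> (nat \<Rightarrow> real) measure" where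
  "mu_n \<mu> n = PiM {..<n} (\<lambda>_. \<mu>)"

definition conv_points :: "nat \<Rightarrow> nat \<Rightarrow> (nat \<Rightarrow> nat \<Rightarrow> real) \<Rightarrow> (nat \<Rightarrow> real) set" where
  "conv_points n N X = {restrict (\<lambda>i. \<Sum>j<N. c j * X j i) {..<n} | c.
        (\<forall>j<N. 0 \<le> c j) \<and> (\<Sum>j<N. c j) = 1}"

definition exp_cover :: "real measure \<Rightarrow> nat \<Rightarrow> nat \<Rightarrow> real" where
  "exp_cover \<mu> n N = (\<integral>X. measure (mu_n \<mu> n) (conv_points n N X) \<partial>(PiM {..<N} (\<lambda>_. mu_n \<mu> n)))"

definition varrho1 :: "real measure \<Rightarrow> nat \<Rightarrow> real \<Rightarrow> ereal" where
  "varrho1 \<mu> n \<delta> = Sup {ereal r | r.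
      (SUP N \<in> {N. n < N \<and> real N \<le> exp (r * real n)}. ereal (exp_cover \<mu> n N)) \<le> ereal \<delta>}"

definition varrho2 :: "real measure \<Rightarrow> nat \<Rightarrow> real \<Rightarrow> ereal" where
  "varrho2 \<mu> n \<delta> = Inf {ereal r | r.
      (INF N \<in> {N. n < N \<and> exp (r * real n) \<le> real N}. ereal (exp_cover \<mu> n N)) \<ge> ereal (1 - \<delta>)}"

end

theory Submission
  imports Defs
begin

text \<open>
  Let \<open>\<kappa>\<close> be the mean of \<open>\<Lambda>\<^sup>*(X)\<close>; both thresholds converge to \<open>\<kappa>\<close>. Since the expected measure of the hull
  is the average over \<open>x\<close> of the probability that \<open>x\<close> is covered, only points \<open>x\<close> that are typical
  for \<open>\<mu>\<^sub>n\<close> matter, and for these \<open>\<Sum>i. \<Lambda>\<^sup>*(x\<^sub>i)\<close> is close to \<open>n * \<kappa>\<close> by the weak law of large numbers.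

  If \<open>x\<close> is covered, some sample lies in every half-space through \<open>x\<close>, so Chernoff's bound makes coverage
  unlikely for \<open>N \<le> exp (n * (\<kappa> - \<epsilon>))\<close>. Conversely, if every half-space through \<open>x\<close> has probability at
  least \<open>q\<close>, then \<open>x\<close> is missed with probability at most \<open>(n + 1) / (q * N)\<close>. Such a \<open>q\<close> of order
  \<open>exp (- n * (\<kappa> + \<epsilon>))\<close> comes from a product change of measure: a coordinate with \<open>\<bar>x\<^sub>i\<bar> \<le> R\<close> is tilted
  exponentially to have mean \<open>x\<^sub>i\<close>, and the few remaining coordinates are conditioned on a half-line. Under
  the new measure a half-space through \<open>x\<close> has probability bounded below, by comparing second and fourth
  moments, and the density concentrates at the exponential scale.
\<close>

section \<open>Distance to the hull of finitely many points\<close>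

text \<open>The half-space that a fresh sample has to hit is chosen by the other samples, so the
  depth bound must be uniform in the normal \<open>\<theta>\<close>, without the loss of a net of
  directions. This is why fourth moments are compared with second ones:
  \<open>E Z^4 <= K * (E Z^2)^2\<close> for centred variables is invariant under scaling and passes
  to independent sums with the same \<open>K\<close>, so it does not see the weights
  \<open>\<theta> i\<close>. The other obstacle is that the tilting parameter that produces the mean
  \<open>x\<close> may run to the end of its range as \<open>x\<close> approaches the edge of the
  support, which would destroy all uniform constants. Hence the cut at \<open>R\<close>: below it
  the parameters stay in \<open>[-T, T]\<close> and all moments are controlled uniformly; above it
  conditioning costs \<open>- ln (tail |x|)\<close>, which is at least \<open>rate x\<close> but is
  square integrable under every even law, so it adds little to the mean cost when the mass beyond
  \<open>R\<close> is small. What admissibility must supply for this is collected in the locale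
  \<open>steep_symmetric_law\<close>.\<close>

lemma homogeneous_system_nontrivial:
  fixes a :: "nat \<Rightarrow> 'j \<Rightarrow> real"
  assumes "finite J" "n < card J"
  shows "\<exists>d. (\<exists>j\<in>J. d j \<noteq> 0) \<and> (\<forall>i<n. (\<Sum>j\<in>J. d j * a i j) = 0)"
  using assms
proof (induction n arbitrary: J a)
  case 0
  then obtain j where "j \<in> J" by fastforce
  then show ?case by (intro exI[of _ "\<lambda>_. 1"]) auto
next
  case (Suc n)
  show ?case
  proof (cases "\<forall>j\<in>J. a n j = 0")
    case True
    obtain d where "\<exists>j\<in>J. d j \<noteq> 0" "\<forall>i<n. (\<Sum>j\<in>J. d j * a i j) = 0"
      using Suc.IH[of J a] Suc.prems by auto
    then show ?thesis
      using True by (intro exI[of _ d]) (auto simp: less_Suc_eq)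
  next
    case False
    then obtain k where k: "k \<in> J" "a n k \<noteq> 0" by blast
    \<comment> \<open>Gaussian elimination: equation \<open>n\<close> is solved for the unknown
      \<open>k\<close>, and \<open>b\<close> holds the coefficients of the other equations after
      substitution.\<close>
    define b where "b i j = a i j - a i k * a n j / a n k" for i j
    have "n < card (J - {k})"
      using Suc.prems k by simp
    then obtain d where d: "\<exists>j\<in>J-{k}. d j \<noteq> 0" "\<forall>i<n. (\<Sum>j\<in>J-{k}. d j * b i j) = 0"
      using Suc.IH[of "J - {k}" b] Suc.prems by auto
    define s where "s = - (\<Sum>j\<in>J-{k}. d j * a n j) / a n k"
    define e where "e = d(k := s)"
    have e: "(\<Sum>j\<in>J. e j * a i j) = s * a i k + (\<Sum>j\<in>J-{k}. d j * a i j)" for i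
      using Suc.prems(1) k(1) by (simp add: e_def sum.remove)
    have s: "s * a i k = - (\<Sum>j\<in>J-{k}. d j * (a i k * a n j / a n k))" for i
      by (simp add: s_def sum_distrib_left sum_divide_distrib sum_negf mult_ac)
    have "(\<Sum>j\<in>J. e j * a i j) = 0" if "i < Suc n" for i
    proof (cases "i = n")
      case True
      then show ?thesis using k(2) by (simp add: e s_def)
    next
      case False
      with that have "(\<Sum>j\<in>J-{k}. d j * b i j) = 0" using d(2) by auto
      then show ?thesis
        unfolding e s b_def by (simp add: right_diff_distrib sum_subtractf)
    qed
    moreover have "\<exists>j\<in>J. e j \<noteq> 0"
      using d(1) by (auto simp: e_def)
    ultimately show ?thesis by blast
  qed
qed

text \<open>Weights are functions on all of \<open>nat\<close> that vanish off \<open>J\<close>.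
  Weights for a subset are thus literally weights for the larger index set, and compactness can be
  taken in the product topology.\<close>

definition wsimplex :: "nat set \<Rightarrow> (nat \<Rightarrow> real) set" where
  "wsimplex J = {c. (\<forall>j\<in>J. 0 \<le> c j) \<and> (\<forall>j. j \<notin> J \<longrightarrow> c j = 0) \<and> sum c J = 1}"

lemma wsimplex_mono:
  assumes "I \<subseteq> J" "finite J"
  shows "wsimplex I \<subseteq> wsimplex J"
proof
  fix c assume c: "c \<in> wsimplex I"
  have "sum c J = sum c I"
    by (rule sum.mono_neutral_right) (use assms c in \<open>auto simp: wsimplex_def\<close>)
  moreover have "0 \<le> c j" for j
    using c by (cases "j \<in> I") (auto simp: wsimplex_def)
  ultimately show "c \<in> wsimplex J"
    using c assms by (auto simp: wsimplex_def)
qed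

text \<open>The reduction step of Caratheodory's theorem: more than \<open>n + 1\<close> points are
  affinely dependent, and the weights can be moved along the dependence, without moving the
  combination, until one of them reaches 0.\<close>

lemma wsimplex_drop_vertex:
  fixes X :: "nat \<Rightarrow> nat \<Rightarrow> real"
  assumes "finite J" "n + 1 < card J" "c \<in> wsimplex J"
  shows "\<exists>k\<in>J. \<exists>b\<in>wsimplex (J - {k}). \<forall>i<n. (\<Sum>j\<in>J-{k}. b j * X j i) = (\<Sum>j\<in>J. c j * X j i)"
proof -
  \<comment> \<open>The extra row \<open>n\<close> of ones makes the coefficients \<open>d\<close>
    sum to 0, turning a linear dependence into an affine one.\<close>
  define a where "a i j = (if i = n then 1 else X j i)" for i j
  obtain d where d: "\<exists>j\<in>J. d j \<noteq> 0" "\<forall>i<Suc n. (\<Sum>j\<in>J. d j * a i j) = 0"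
    using homogeneous_system_nontrivial[of J "Suc n" a] assms by auto
  have d0: "sum d J = 0"
    using d(2)[rule_format, of n] by (simp add: a_def)
  have dX: "(\<Sum>j\<in>J. d j * X j i) = 0" if "i < n" for i
    using d(2)[rule_format, of i] that by (simp add: a_def)
  define P where "P = {j\<in>J. 0 < d j}"
  have fP: "finite P" using assms by (simp add: P_def)
  have "P \<noteq> {}"
  proof
    assume "P = {}"
    then have "\<forall>j\<in>J. d j \<le> 0" unfolding P_def by auto
    then have "\<forall>j\<in>J. - d j \<ge> 0" "(\<Sum>j\<in>J. - d j) = 0" using d0 by (auto simp: sum_negf)
    then have "\<forall>j\<in>J. - d j = 0"
      using sum_nonneg_eq_0_iff[of J "\<lambda>j. - d j"] assms by auto
    then show False using d(1) by auto
  qed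
  \<comment> \<open>The largest step that keeps all weights nonnegative; the index \<open>k\<close>
    where the minimum is attained is the vertex that drops out.\<close>
  define s where "s = Min ((\<lambda>j. c j / d j) ` P)"
  have "s \<in> (\<lambda>j. c j / d j) ` P"
    unfolding s_def using fP \<open>P \<noteq> {}\<close> by (intro Min_in) auto
  then obtain k where k: "k \<in> P" "s = c k / d k" by auto
  have kJ: "k \<in> J" "0 < d k" using k by (auto simp: P_def)
  have c: "\<And>j. j \<in> J \<Longrightarrow> 0 \<le> c j" "\<And>j. j \<notin> J \<Longrightarrow> c j = 0" "sum c J = 1"
    using assms(3) by (auto simp: wsimplex_def)
  have s0: "0 \<le> s" using k kJ c by auto
  define b where "b j = (if j \<in> J then c j - s * d j else 0)" for j
  have bk: "b k = 0" using k kJ by (simp add: b_def)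
  have bn: "0 \<le> b j" if "j \<in> J" for j
  proof (cases "0 < d j")
    case True
    then have "s \<le> c j / d j"
      unfolding s_def using fP that by (intro Min_le) (auto simp: P_def)
    then show ?thesis using True that by (simp add: b_def field_simps)
  next
    case False
    then have "s * d j \<le> 0" using s0 by (simp add: mult_nonneg_nonpos)
    then show ?thesis using c(1)[OF that] that by (simp add: b_def)
  qed
  have "sum b J = sum c J - s * sum d J"
    by (simp add: b_def sum_subtractf sum_distrib_left)
  then have bs: "sum b J = 1" using d0 c by simp
  have drop: "(\<Sum>j\<in>J-{k}. b j * f j) = (\<Sum>j\<in>J. b j * f j)" for f :: "nat \<Rightarrow> real"
    using kJ bk assms(1) by (simp add: sum.remove)
  have "b \<in> wsimplex (J - {k})"
    using bn bs drop[of "\<lambda>_. 1"] bk by (auto simp: wsimplex_def b_def)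
  moreover have "(\<Sum>j\<in>J-{k}. b j * X j i) = (\<Sum>j\<in>J. c j * X j i)" if "i < n" for i
  proof -
    have "(\<Sum>j\<in>J. b j * X j i) = (\<Sum>j\<in>J. c j * X j i) - s * (\<Sum>j\<in>J. d j * X j i)"
      by (simp add: b_def left_diff_distrib sum_subtractf sum_distrib_left mult.assoc)
    then show ?thesis using dX[OF that] drop by simp
  qed
  ultimately show ?thesis using kJ by blast
qed

lemma caratheodory_wsimplex:
  fixes X :: "nat \<Rightarrow> nat \<Rightarrow> real"
  assumes "finite J" "c \<in> wsimplex J"
  shows "\<exists>I\<subseteq>J. card I \<le> n + 1 \<and>
    (\<exists>b\<in>wsimplex I. \<forall>i<n. (\<Sum>j\<in>I. b j * X j i) = (\<Sum>j\<in>J. c j * X j i))"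
  using assms
proof (induction "card J" arbitrary: J c rule: less_induct)
  case less
  show ?case
  proof (cases "card J \<le> n + 1")
    case True
    then show ?thesis using less.prems by blast
  next
    case False
    then obtain k b where k: "k \<in> J" and b: "b \<in> wsimplex (J - {k})"
      and eq: "\<forall>i<n. (\<Sum>j\<in>J-{k}. b j * X j i) = (\<Sum>j\<in>J. c j * X j i)"
      using wsimplex_drop_vertex[of J n c X] less.prems by force
    have "card (J - {k}) < card J"
      using k less.prems by (meson card_Diff1_less)
    from less.hyps[OF this _ b] less.prems(1) obtain I b'
      where "I \<subseteq> J - {k}" "card I \<le> n + 1" "b' \<in> wsimplex I"
        "\<forall>i<n. (\<Sum>j\<in>I. b' j * X j i) = (\<Sum>j\<in>J-{k}. b j * X j i)"
      by blast
    then show ?thesis using eq by (intro exI[of _ I]) auto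
  qed
qed

definition comb_sqdist :: "nat \<Rightarrow> nat set \<Rightarrow> (nat \<Rightarrow> real) \<Rightarrow> (nat \<Rightarrow> nat \<Rightarrow> real) \<Rightarrow> (nat \<Rightarrow> real) \<Rightarrow> real" where
  "comb_sqdist n J x X c = (\<Sum>i<n. ((\<Sum>j\<in>J. c j * X j i) - x i)\<^sup>2)"

text \<open>Coverage is the vanishing of this number, which makes it measurable, and the effect of a
  single sample can be read off from whether it strictly lowers it. For \<open>J = {}\<close> the
  simplex is empty and the infimum carries no information, hence the recurring assumption that
  \<open>J\<close> is nonempty.\<close>

definition hull_sqdist :: "nat \<Rightarrow> nat set \<Rightarrow> (nat \<Rightarrow> real) \<Rightarrow> (nat \<Rightarrow> nat \<Rightarrow> real) \<Rightarrow> real" where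
  "hull_sqdist n J x X = (INF c\<in>wsimplex J. comb_sqdist n J x X c)"

lemma comb_sqdist_nonneg: "0 \<le> comb_sqdist n J x X c"
  by (simp add: comb_sqdist_def sum_nonneg)

lemma hull_sqdist_le: "c \<in> wsimplex J \<Longrightarrow> hull_sqdist n J x X \<le> comb_sqdist n J x X c"
  unfolding hull_sqdist_def by (rule cINF_lower) (auto intro!: bdd_belowI[of _ 0] simp: comb_sqdist_nonneg)

text \<open>The coordinates off \<open>J\<close> are pinned to 0, so this is a closed subset of the
  cube \<open>[0,1]^nat\<close>, which is compact by Tychonoff.\<close>

lemma compact_wsimplex:
  assumes "finite J"
  shows "compact (wsimplex J)"
proof -
  have "compact (PiE UNIV (\<lambda>_::nat. {0..1::real}))"
    using compactin_PiE[of "\<lambda>_::nat. euclidean::real topology" UNIV "\<lambda>_. {0..1}"]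
    by (simp add: euclidean_product_topology)
  moreover have "wsimplex J = PiE UNIV (\<lambda>_. {0..1}) \<inter>
      ((\<Inter>j\<in>-J. {c. c j = 0}) \<inter> {c. (\<Sum>j\<in>J. c j) = 1})"
  proof (intro subset_antisym subsetI)
    fix c assume c: "c \<in> wsimplex J"
    have "c j \<le> 1 \<and> 0 \<le> c j" for j
    proof (cases "j \<in> J")
      case True
      then have "c j \<le> sum c J"
        using c assms by (intro member_le_sum) (auto simp: wsimplex_def)
      then show ?thesis using c True by (simp add: wsimplex_def)
    qed (use c in \<open>simp add: wsimplex_def\<close>)
    then show "c \<in> PiE UNIV (\<lambda>_. {0..1}) \<inter> ((\<Inter>j\<in>-J. {c. c j = 0}) \<inter> {c. (\<Sum>j\<in>J. c j) = 1})"
      using c by (simp add: wsimplex_def PiE_UNIV_domain)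
  next
    fix c :: "nat \<Rightarrow> real"
    assume c: "c \<in> PiE UNIV (\<lambda>_. {0..1}) \<inter> ((\<Inter>j\<in>-J. {c. c j = 0}) \<inter> {c. (\<Sum>j\<in>J. c j) = 1})"
    then have "\<forall>j. c j \<in> {0..1}" unfolding PiE_UNIV_domain by blast
    with c show "c \<in> wsimplex J"
      by (simp add: wsimplex_def)
  qed
  moreover have "closed ((\<Inter>j\<in>-J. {c::nat\<Rightarrow>real. c j = 0}) \<inter> {c. (\<Sum>j\<in>J. c j) = 1})"
    by (intro closed_Int closed_INT ballI closed_Collect_eq continuous_intros
        continuous_on_product_coordinates)
  ultimately show ?thesis by (metis compact_Int_closed)
qed

lemma hull_sqdist_attained:
  assumes "finite J" "J \<noteq> {}"
  shows "\<exists>c\<in>wsimplex J. hull_sqdist n J x X = comb_sqdist n J x X c"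
proof -
  obtain j where j: "j \<in> J" using assms by auto
  then have "(\<lambda>k. if k = j then 1 else 0) \<in> wsimplex J"
    using assms by (auto simp: wsimplex_def)
  moreover have "continuous_on (wsimplex J) (comb_sqdist n J x X)"
    unfolding comb_sqdist_def by (intro continuous_intros continuous_on_subset[OF continuous_on_product_coordinates]) auto
  ultimately obtain c where c: "c \<in> wsimplex J" "\<forall>b\<in>wsimplex J. comb_sqdist n J x X c \<le> comb_sqdist n J x X b"
    using continuous_attains_inf[OF compact_wsimplex[OF assms(1)]] by blast
  have "hull_sqdist n J x X = comb_sqdist n J x X c"
    using c hull_sqdist_le[OF c(1)] unfolding hull_sqdist_def
    by (intro antisym cINF_greatest) auto
  then show ?thesis using c by blast
qed

lemma hull_sqdist_nonneg: "finite J \<Longrightarrow> J \<noteq> {} \<Longrightarrow> 0 \<le> hull_sqdist n J x X"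
  by (metis hull_sqdist_attained comb_sqdist_nonneg)

lemma comb_sqdist_superset:
  assumes "I \<subseteq> J" "finite J" "c \<in> wsimplex I"
  shows "comb_sqdist n J x X c = comb_sqdist n I x X c"
proof -
  have "(\<Sum>j\<in>J. c j * X j i) = (\<Sum>j\<in>I. c j * X j i)" for i
    by (rule sum.mono_neutral_right) (use assms in \<open>auto simp: wsimplex_def\<close>)
  then show ?thesis by (simp add: comb_sqdist_def)
qed

lemma hull_sqdist_antimono:
  assumes "I \<subseteq> J" "finite J" "I \<noteq> {}"
  shows "hull_sqdist n J x X \<le> hull_sqdist n I x X"
proof -
  obtain c where c: "c \<in> wsimplex I" "hull_sqdist n I x X = comb_sqdist n I x X c"
    using hull_sqdist_attained[of I] assms finite_subset by metis
  have "hull_sqdist n J x X \<le> comb_sqdist n J x X c"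
    using wsimplex_mono[OF assms(1,2)] c by (intro hull_sqdist_le) auto
  then show ?thesis using comb_sqdist_superset[OF assms(1,2) c(1)] c by simp
qed

text \<open>By Caratheodory the nearest point is a combination of at most \<open>n + 1\<close>
  samples. Removing any other sample leaves that point in the hull, so the distance does not
  grow.\<close>

lemma card_hull_sqdist_essential:
  assumes "finite J" "2 \<le> card J"
  shows "card {j\<in>J. hull_sqdist n J x X < hull_sqdist n (J - {j}) x X} \<le> n + 1"
proof -
  obtain c where c: "c \<in> wsimplex J" "hull_sqdist n J x X = comb_sqdist n J x X c"
    using hull_sqdist_attained[of J] assms by fastforce
  obtain I b where I: "I \<subseteq> J" "card I \<le> n + 1" and b: "b \<in> wsimplex I"
    and eq: "\<forall>i<n. (\<Sum>j\<in>I. b j * X j i) = (\<Sum>j\<in>J. c j * X j i)"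
    using caratheodory_wsimplex[OF assms(1) c(1)] by metis
  have sq: "comb_sqdist n I x X b = hull_sqdist n J x X"
    using eq unfolding c(2) comb_sqdist_def by simp
  have "j \<in> I" if j: "j \<in> J" "hull_sqdist n J x X < hull_sqdist n (J - {j}) x X" for j
  proof (rule ccontr)
    assume "j \<notin> I"
    then have sub: "I \<subseteq> J - {j}" using I by auto
    then have "b \<in> wsimplex (J - {j})" using wsimplex_mono[OF sub] assms b by auto
    then have "hull_sqdist n (J - {j}) x X \<le> comb_sqdist n (J - {j}) x X b" by (rule hull_sqdist_le)
    also have "\<dots> = hull_sqdist n J x X"
      using comb_sqdist_superset[OF sub _ b] assms sq by simp
    finally show False using j by simp
  qed
  then have "{j\<in>J. hull_sqdist n J x X < hull_sqdist n (J - {j}) x X} \<subseteq> I" by auto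
  then show ?thesis
    using I assms by (meson card_mono finite_subset le_trans)
qed

text \<open>Let \<open>\<theta>\<close> point from \<open>x\<close> to the nearest point
  \<open>p\<close> of the hull. A new point \<open>y\<close> in the half-space through
  \<open>x\<close> facing away from \<open>p\<close> makes an acute angle at \<open>p\<close> with
  \<open>x\<close>, so moving from \<open>p\<close> towards \<open>y\<close> brings one closer to
  \<open>x\<close>. The quantifier over \<open>Y\<close> matters: \<open>\<theta>\<close> depends on
  the old samples only, hence is independent of the fresh one.\<close>

lemma hull_sqdist_decrease:
  assumes J: "finite J" "J \<noteq> {}" and pos: "0 < hull_sqdist n J x X"
  shows "\<exists>\<theta>. (\<exists>i<n. \<theta> i \<noteq> 0) \<and> (\<forall>k Y. k \<notin> J \<and> (\<forall>j\<in>J. \<forall>i<n. Y j i = X j i) \<and>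
     (\<Sum>i<n. \<theta> i * (Y k i - x i)) \<le> 0 \<longrightarrow> hull_sqdist n (insert k J) x Y < hull_sqdist n J x X)"
proof -
  obtain c where c: "c \<in> wsimplex J" "hull_sqdist n J x X = comb_sqdist n J x X c"
    using hull_sqdist_attained[OF J] by metis
  define \<theta> where "\<theta> i = (\<Sum>j\<in>J. c j * X j i) - x i" for i
  define A where "A = (\<Sum>i<n. (\<theta> i)\<^sup>2)"
  have A: "hull_sqdist n J x X = A" "0 < A"
    using c pos by (simp_all add: comb_sqdist_def A_def \<theta>_def)
  have ex: "\<exists>i<n. \<theta> i \<noteq> 0"
    using A unfolding A_def by (metis (no_types, lifting) lessThan_iff less_irrefl power_zero_numeral sum.neutral)
  have "hull_sqdist n (insert k J) x Y < hull_sqdist n J x X"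
    if k: "k \<notin> J" and Y: "\<forall>j\<in>J. \<forall>i<n. Y j i = X j i" and le: "(\<Sum>i<n. \<theta> i * (Y k i - x i)) \<le> 0" for k Y
  proof -
    define v where "v i = Y k i - x i - \<theta> i" for i
    define B where "B = (\<Sum>i<n. (v i)\<^sup>2)"
    have B: "0 \<le> B" unfolding B_def by (simp add: sum_nonneg)
    have cross: "(\<Sum>i<n. \<theta> i * v i) \<le> - A"
      using le by (simp add: v_def A_def right_diff_distrib sum_subtractf power2_eq_square)
    \<comment> \<open>With \<open>v = y - p\<close> and \<open>B\<close> its squared length, the new
      squared distance is at most \<open>A - 2*s*A + s*s*B\<close>. This \<open>s\<close> lies in
      \<open>(0,1]\<close> and satisfies \<open>s * B \<le> A\<close>, which also covers
      \<open>B = 0\<close>.\<close>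
    define s where "s = A / (A + B)"
    have s: "0 < s" "s \<le> 1" "s * B \<le> A"
      using A B by (auto simp: s_def field_simps)
    define b where "b j = (if j = k then s else (1 - s) * c j)" for j
    have "sum b (insert k J) = s + (\<Sum>j\<in>J. (1 - s) * c j)"
      using J k by (simp add: b_def) (rule sum.cong, auto)
    also have "\<dots> = 1"
      using c by (simp add: wsimplex_def sum_distrib_left[symmetric])
    finally have b: "b \<in> wsimplex (insert k J)"
      using c s k by (auto simp: wsimplex_def b_def)
    have lin: "(\<Sum>j\<in>insert k J. b j * Y j i) - x i = \<theta> i + s * v i" if "i < n" for i
    proof -
      have "(\<Sum>j\<in>J. b j * Y j i) = (\<Sum>j\<in>J. (1 - s) * (c j * X j i))"
        using k Y that by (intro sum.cong) (auto simp: b_def)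
      also have "\<dots> = (1 - s) * (\<theta> i + x i)"
        by (simp add: \<theta>_def sum_distrib_left)
      finally have "(\<Sum>j\<in>insert k J. b j * Y j i) = s * Y k i + (1 - s) * (\<theta> i + x i)"
        using J k by (simp add: b_def)
      then show ?thesis by (simp add: v_def algebra_simps)
    qed
    have "comb_sqdist n (insert k J) x Y b = (\<Sum>i<n. (\<theta> i + s * v i)\<^sup>2)"
      unfolding comb_sqdist_def using lin by (intro sum.cong) auto
    also have "\<dots> = A + 2 * s * (\<Sum>i<n. \<theta> i * v i) + s * (s * B)"
      by (simp add: A_def B_def power2_eq_square algebra_simps sum.distrib sum_distrib_left)
    also have "\<dots> \<le> A + 2 * s * (- A) + s * A"
      using s cross by (intro add_mono mult_left_mono) auto
    also have "\<dots> < A" using s A by simp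
    finally show ?thesis using hull_sqdist_le[OF b] A by (meson order_le_less_trans)
  qed
  then show ?thesis using ex by (intro exI[of _ \<theta>]) blast
qed

lemma conv_points_iff_hull_sqdist:
  assumes "x \<in> extensional {..<n}" "0 < N"
  shows "x \<in> conv_points n N X \<longleftrightarrow> hull_sqdist n {..<N} x X = 0"
proof
  assume "x \<in> conv_points n N X"
  then obtain c where x: "x = restrict (\<lambda>i. \<Sum>j<N. c j * X j i) {..<n}"
    and c: "\<forall>j<N. 0 \<le> c j" "(\<Sum>j<N. c j) = 1"
    unfolding conv_points_def by blast
  define b where "b j = (if j < N then c j else 0)" for j
  have b: "b \<in> wsimplex {..<N}" using c by (auto simp: wsimplex_def b_def)
  have "comb_sqdist n {..<N} x X b = 0"
    by (auto simp: comb_sqdist_def x b_def intro!: sum.neutral)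
  then show "hull_sqdist n {..<N} x X = 0"
    using hull_sqdist_le[OF b, of n x X] hull_sqdist_nonneg[of "{..<N}" n x X] assms(2)
    by (simp add: lessThan_empty_iff)
next
  assume 0: "hull_sqdist n {..<N} x X = 0"
  obtain c where c: "c \<in> wsimplex {..<N}" "comb_sqdist n {..<N} x X c = 0"
    using hull_sqdist_attained[of "{..<N}" n x X] 0 assms(2) by (force simp: lessThan_empty_iff)
  then have "\<forall>i<n. (\<Sum>j<N. c j * X j i) = x i"
    by (auto simp: comb_sqdist_def sum_nonneg_eq_0_iff)
  then have "x = restrict (\<lambda>i. \<Sum>j<N. c j * X j i) {..<n}"
    using assms(1) by (auto simp: extensional_def fun_eq_iff)
  then show "x \<in> conv_points n N X"
    using c(1) unfolding conv_points_def wsimplex_def by blast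
qed

text \<open>Integer weights suffice for the infimum; this makes the distance a countable infimum.\<close>

definition nat_weights :: "nat set \<Rightarrow> (nat \<Rightarrow> real) set" where
  "nat_weights J = (\<lambda>a j. if j \<in> J then real (a j) / real (sum a J) else 0) ` {a \<in> PiE J (\<lambda>_. UNIV). 0 < sum a J}"

lemma countable_nat_weights: "finite J \<Longrightarrow> countable (nat_weights J)"
  unfolding nat_weights_def
  by (intro countable_image countable_subset[OF _ countable_PiE[of J "\<lambda>_. UNIV :: nat set"]]) auto

lemma nat_weights_subset: "nat_weights J \<subseteq> wsimplex J"
  by (auto simp: nat_weights_def wsimplex_def sum_divide_distrib[symmetric] simp flip: of_nat_sum)

lemma nat_weights_dense:
  assumes "finite J" "c \<in> wsimplex J"
  shows "\<exists>b. (\<forall>m. b m \<in> nat_weights J) \<and> (\<forall>j. (\<lambda>m. b m j) \<longlonglongrightarrow> c j)"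
proof -
  have c: "\<And>j. j \<in> J \<Longrightarrow> 0 \<le> c j" "\<And>j. j \<notin> J \<Longrightarrow> c j = 0" "sum c J = 1"
    using assms(2) by (auto simp: wsimplex_def)
  \<comment> \<open>Rounding up rather than to the nearest integer keeps the total at least
    \<open>m + 1\<close>, so normalising by it is legitimate; the total divided by
    \<open>m + 1\<close> tends to 1.\<close>
  define a where "a m = (\<lambda>j\<in>J. nat \<lceil>c j * real (Suc m)\<rceil>)" for m
  have a_ge: "c j * real (Suc m) \<le> real (a m j)" if "j \<in> J" for m j
    using that by (simp add: a_def, linarith)
  have a_le: "real (a m j) \<le> c j * real (Suc m) + 1" if "j \<in> J" for m j
    using that c(1)[OF that] by (simp add: a_def)
  have lim: "(\<lambda>m. real (a m j) / real (Suc m)) \<longlonglongrightarrow> c j" if "j \<in> J" for j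
  proof (rule tendsto_sandwich[of "\<lambda>_. c j" _ _ "\<lambda>m. c j + 1 / real (Suc m)"])
    show "\<forall>\<^sub>F m in sequentially. c j \<le> real (a m j) / real (Suc m)"
      using a_ge[OF that] by (simp add: field_simps)
    show "\<forall>\<^sub>F m in sequentially. real (a m j) / real (Suc m) \<le> c j + 1 / real (Suc m)"
    proof (intro always_eventually allI)
      fix m
      have "real (a m j) / real (Suc m) \<le> (c j * real (Suc m) + 1) / real (Suc m)"
        using a_le[OF that] by (intro divide_right_mono) auto
      then show "real (a m j) / real (Suc m) \<le> c j + 1 / real (Suc m)"
        by (simp add: add_divide_distrib)
    qed
    show "(\<lambda>m. c j + 1 / real (Suc m)) \<longlonglongrightarrow> c j"
      using tendsto_add[OF tendsto_const LIMSEQ_Suc[OF lim_1_over_n]] by simp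
  qed simp
  have "real (Suc m) \<le> real (sum (a m) J)" for m
  proof -
    have "real (Suc m) = (\<Sum>j\<in>J. c j * real (Suc m))"
      using c(3) by (simp add: sum_distrib_right[symmetric])
    also have "\<dots> \<le> (\<Sum>j\<in>J. real (a m j))" by (intro sum_mono a_ge)
    finally show ?thesis by simp
  qed
  then have pos: "0 < sum (a m) J" for m
    by (metis of_nat_le_iff less_le_trans zero_less_Suc)
  define b where "b m j = (if j \<in> J then real (a m j) / real (sum (a m) J) else 0)" for m j
  have "b m \<in> nat_weights J" for m
    unfolding nat_weights_def b_def using pos[of m]
    by (intro image_eqI[of _ _ "a m"]) (auto simp: a_def)
  moreover have "(\<lambda>m. b m j) \<longlonglongrightarrow> c j" for j
  proof (cases "j \<in> J")
    case True
    have "(\<lambda>m. (real (a m j) / real (Suc m)) / (\<Sum>j\<in>J. real (a m j) / real (Suc m))) \<longlonglongrightarrow> c j / sum c J"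
      using c(3) True by (intro tendsto_divide tendsto_sum lim) auto
    moreover have "(real (a m j) / real (Suc m)) / (\<Sum>j\<in>J. real (a m j) / real (Suc m)) = b m j" for m
      using True by (simp add: b_def sum_divide_distrib[symmetric])
    ultimately show ?thesis using c(3) by simp
  next
    case False
    then show ?thesis using c(2) by (simp add: b_def)
  qed
  ultimately show ?thesis by blast
qed

lemma hull_sqdist_countable:
  assumes "finite J" "J \<noteq> {}"
  shows "hull_sqdist n J x X = (INF c\<in>nat_weights J. comb_sqdist n J x X c)"
proof (rule antisym)
  obtain c where c: "c \<in> wsimplex J" "hull_sqdist n J x X = comb_sqdist n J x X c"
    using hull_sqdist_attained[OF assms] by metis
  obtain b where b: "\<And>m. b m \<in> nat_weights J" "\<And>j. (\<lambda>m. b m j) \<longlonglongrightarrow> c j"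
    using nat_weights_dense[OF assms(1) c(1)] by blast
  show "hull_sqdist n J x X \<le> (INF c\<in>nat_weights J. comb_sqdist n J x X c)"
    using b(1)[of 0] nat_weights_subset by (intro cINF_greatest hull_sqdist_le) auto
  have "(\<lambda>m. comb_sqdist n J x X (b m)) \<longlonglongrightarrow> comb_sqdist n J x X c"
    unfolding comb_sqdist_def by (intro tendsto_intros b(2))
  moreover have "(INF c\<in>nat_weights J. comb_sqdist n J x X c) \<le> comb_sqdist n J x X (b m)" for m
    using b(1) by (intro cINF_lower) (auto intro!: bdd_belowI[of _ 0] simp: comb_sqdist_nonneg)
  ultimately show "(INF c\<in>nat_weights J. comb_sqdist n J x X c) \<le> hull_sqdist n J x X"
    unfolding c(2) by (meson LIMSEQ_le_const)
qed

lemma hull_sqdist_measurable: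
  assumes J: "finite J" "J \<noteq> {}"
    and x: "\<And>i. i < n \<Longrightarrow> (\<lambda>\<omega>. x \<omega> i) \<in> borel_measurable M"
    and X: "\<And>i j. i < n \<Longrightarrow> j \<in> J \<Longrightarrow> (\<lambda>\<omega>. X \<omega> j i) \<in> borel_measurable M"
  shows "(\<lambda>\<omega>. hull_sqdist n J (x \<omega>) (X \<omega>)) \<in> borel_measurable M"
proof -
  have "(\<lambda>\<omega>. INF c\<in>nat_weights J. comb_sqdist n J (x \<omega>) (X \<omega>) c) \<in> borel_measurable M"
  proof (rule borel_measurable_cINF)
    show "countable (nat_weights J)" using J by (simp add: countable_nat_weights)
    show "(\<lambda>\<omega>. comb_sqdist n J (x \<omega>) (X \<omega>) c) \<in> borel_measurable M" for c
      unfolding comb_sqdist_def using x X by (intro borel_measurable_sum borel_measurable_power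
          borel_measurable_diff borel_measurable_times borel_measurable_const) auto
    show "bdd_below ((\<lambda>c. comb_sqdist n J (x \<omega>) (X \<omega>) c) ` nat_weights J)" for \<omega>
      by (auto intro!: bdd_belowI[of _ 0] simp: comb_sqdist_nonneg)
  qed
  then show ?thesis by (simp add: hull_sqdist_countable[OF J])
qed

section \<open>Coverage of a point by the random hull\<close>

lemma hull_sqdist_cong:
  assumes "\<And>j i. j \<in> J \<Longrightarrow> i < n \<Longrightarrow> X j i = Y j i"
  shows "hull_sqdist n J x X = hull_sqdist n J x Y"
proof -
  have "comb_sqdist n J x X c = comb_sqdist n J x Y c" for c
    unfolding comb_sqdist_def using assms by (intro sum.cong refl arg_cong[where f="\<lambda>u. (u - _)\<^sup>2"]) auto
  then show ?thesis by (simp add: hull_sqdist_def)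
qed

text \<open>Adding a fresh sample to a configuration whose hull misses \<open>x\<close> strictly decreases the distance
  with probability at least \<open>q\<close>, while only \<open>n + 1\<close> of the \<open>N\<close> points can be responsible
  for the distance (Caratheodory); averaging over the points gives the bound.\<close>

lemma prob_hull_misses_le:
  fixes P :: "(nat \<Rightarrow> real) measure"
  assumes "prob_space P" and [measurable]: "\<And>i. i < n \<Longrightarrow> (\<lambda>y. y i) \<in> borel_measurable P"
    and q: "0 < q" and N: "2 \<le> N"
    and depth: "\<And>\<theta>. \<exists>i<n. \<theta> i \<noteq> 0 \<Longrightarrow> q \<le> measure P {y\<in>space P. (\<Sum>i<n. \<theta> i * (y i - x i)) \<le> 0}"
  shows "measure (PiM {..<N} (\<lambda>_. P)) {X\<in>space (PiM {..<N} (\<lambda>_. P)). 0 < hull_sqdist n {..<N} x X}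
    \<le> (real n + 1) / (q * real N)"
proof -
  interpret P: prob_space P by fact
  interpret PP: product_sigma_finite "\<lambda>_::nat. P" by standard
  let ?Q = "PiM {..<N} (\<lambda>_. P)"
  interpret Q: prob_space ?Q by (intro prob_space_PiM assms(1))
  have meas: "(\<lambda>X. hull_sqdist n K x X) \<in> borel_measurable (PiM J (\<lambda>_. P))"
    if "finite K" "K \<noteq> {}" "K \<subseteq> J" for J K
  proof (rule hull_sqdist_measurable[OF that(1,2)])
    fix i j assume "i < n" "j \<in> K"
    then show "(\<lambda>\<omega>. \<omega> j i) \<in> borel_measurable (PiM J (\<lambda>_. P))"
      using that by (intro measurable_compose[OF measurable_component_singleton[of j J] assms(2)]) auto
  qed simp
  define A where "A = {X\<in>space ?Q. 0 < hull_sqdist n {..<N} x X}"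
  define B where "B j = {X\<in>space ?Q. hull_sqdist n {..<N} x X < hull_sqdist n ({..<N} - {j}) x X}" for j
  have card1: "{..<N} - {j} \<noteq> {}" for j
  proof
    assume "{..<N} - {j} = {}"
    then have "{..<N} \<subseteq> {j}" by auto
    then show False using card_mono[of "{j}" "{..<N}"] N by simp
  qed
  have ne: "{..<N} \<noteq> {}" using N by (auto simp: lessThan_empty_iff)
  note [measurable] = meas[of "{..<N}" "{..<N}", OF _ ne subset_refl, simplified]
  have [measurable]: "(\<lambda>X. hull_sqdist n ({..<N} - {j}) x X) \<in> borel_measurable ?Q" for j
    by (rule meas) (use card1 in auto)
  have A[measurable]: "A \<in> sets ?Q" unfolding A_def by measurable
  have B[measurable]: "B j \<in> sets ?Q" for j unfolding B_def by measurable
  \<comment> \<open>If the full hull misses \<open>x\<close>, so does the hull of the samples other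
    than \<open>j\<close>, which is the event \<open>S\<close>. Sample \<open>j\<close> is
    independent of \<open>S\<close>, and with probability at least \<open>q\<close> it falls into
    the half-space of \<open>hull_sqdist_decrease\<close>, which puts the configuration into
    \<open>B j\<close>.\<close>
  have step: "q * measure ?Q A \<le> measure ?Q (B j)" if j: "j < N" for j
  proof -
    define I where "I = {..<N} - {j}"
    have I: "finite I" "j \<notin> I" "insert j I = {..<N}" "I \<noteq> {}"
      using j card1 by (auto simp: I_def)
    have mI[measurable]: "(\<lambda>X. hull_sqdist n I x X) \<in> borel_measurable (PiM I (\<lambda>_. P))"
      by (rule meas) (use I in auto)
    define S where "S = {X\<in>space (PiM I (\<lambda>_. P)). 0 < hull_sqdist n I x X}"
    have S[measurable]: "S \<in> sets (PiM I (\<lambda>_. P))" unfolding S_def by measurable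
    have split: "integral\<^sup>N ?Q f = (\<integral>\<^sup>+X. (\<integral>\<^sup>+y. f (X(j := y)) \<partial>P) \<partial>PiM I (\<lambda>_. P))"
      if "f \<in> borel_measurable ?Q" for f
      using PP.product_nn_integral_insert[of I j f] I that by simp
    have upd: "hull_sqdist n I x (X(j := y)) = hull_sqdist n I x X" for X y
      using I by (intro hull_sqdist_cong) auto
    have updsp: "X(j := y) \<in> space ?Q" if "X \<in> space (PiM I (\<lambda>_. P))" "y \<in> space P" for X y
      using that I(3) unfolding space_PiM by (metis PiE_fun_upd)
    have "emeasure ?Q A = (\<integral>\<^sup>+X. (\<integral>\<^sup>+y. indicator A (X(j := y)) \<partial>P) \<partial>PiM I (\<lambda>_. P))"
      by (subst split[symmetric]) auto
    also have "\<dots> \<le> (\<integral>\<^sup>+X. (\<integral>\<^sup>+y. indicator S X \<partial>P) \<partial>PiM I (\<lambda>_. P))"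
    proof (intro nn_integral_mono)
      fix X y assume X: "X \<in> space (PiM I (\<lambda>_. P))"
      have "hull_sqdist n {..<N} x (X(j := y)) \<le> hull_sqdist n I x X"
        unfolding upd[of X y, symmetric] using I by (intro hull_sqdist_antimono) auto
      then show "indicator A (X(j := y)) \<le> (indicator S X :: ennreal)"
        using X by (auto simp: A_def S_def indicator_def)
    qed
    also have "\<dots> = emeasure (PiM I (\<lambda>_. P)) S"
      by (simp add: P.emeasure_space_1)
    finally have AS: "emeasure ?Q A \<le> emeasure (PiM I (\<lambda>_. P)) S" .
    have "ennreal q * emeasure (PiM I (\<lambda>_. P)) S = (\<integral>\<^sup>+X. ennreal q * indicator S X \<partial>PiM I (\<lambda>_. P))"
      by (simp add: nn_integral_cmult)
    also have "\<dots> \<le> (\<integral>\<^sup>+X. (\<integral>\<^sup>+y. indicator (B j) (X(j := y)) \<partial>P) \<partial>PiM I (\<lambda>_. P))"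
    proof (intro nn_integral_mono)
      fix X assume X: "X \<in> space (PiM I (\<lambda>_. P))"
      show "ennreal q * indicator S X \<le> (\<integral>\<^sup>+y. indicator (B j) (X(j := y)) \<partial>P)"
      proof (cases "X \<in> S")
        case True
        then have "0 < hull_sqdist n I x X" by (simp add: S_def)
        from hull_sqdist_decrease[OF I(1,4) this] obtain \<theta> where
          th: "\<exists>i<n. \<theta> i \<noteq> 0" and dec: "\<And>k Y. k \<notin> I \<Longrightarrow> (\<forall>j\<in>I. \<forall>i<n. Y j i = X j i) \<Longrightarrow>
            (\<Sum>i<n. \<theta> i * (Y k i - x i)) \<le> 0 \<Longrightarrow> hull_sqdist n (insert k I) x Y < hull_sqdist n I x X"
          by blast
        define H where "H = {y\<in>space P. (\<Sum>i<n. \<theta> i * (y i - x i)) \<le> 0}"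
        have [measurable]: "H \<in> sets P" unfolding H_def by measurable
        have "ennreal q \<le> ennreal (measure P H)"
          using depth[OF th] by (intro ennreal_leI) (simp add: H_def)
        also have "\<dots> = (\<integral>\<^sup>+y. indicator H y \<partial>P)"
          by (simp add: P.emeasure_eq_measure)
        also have "\<dots> \<le> (\<integral>\<^sup>+y. indicator (B j) (X(j := y)) \<partial>P)"
        proof (intro nn_integral_mono)
          fix y assume y: "y \<in> space P"
          have "X(j := y) \<in> B j" if "y \<in> H"
          proof -
            have "hull_sqdist n (insert j I) x (X(j := y)) < hull_sqdist n I x X"
              using that I(2) by (intro dec) (auto simp: H_def)
            then show ?thesis
              using updsp[OF X y] I(3) upd unfolding B_def I_def[symmetric] by simp
          qed
          then show "indicator H y \<le> (indicator (B j) (X(j := y)) :: ennreal)"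
            by (auto simp: indicator_def)
        qed
        finally show ?thesis using True by simp
      qed simp
    qed
    also have "\<dots> = emeasure ?Q (B j)"
      by (subst split[symmetric]) auto
    finally have "ennreal q * emeasure ?Q A \<le> emeasure ?Q (B j)"
      using AS by (meson mult_left_mono order_trans zero_le)
    then show ?thesis
      using q by (simp add: Q.emeasure_eq_measure ennreal_mult'[symmetric])
  qed
  \<comment> \<open>Double counting: the sum of the indicators of the \<open>B j\<close> counts the
    samples whose removal increases the distance, and there are at most \<open>n + 1\<close> of them
    in every configuration.\<close>
  have "real N * (q * measure ?Q A) = (\<Sum>j<N. q * measure ?Q A)" by simp
  also have "\<dots> \<le> (\<Sum>j<N. measure ?Q (B j))" using step by (intro sum_mono) auto
  also have "\<dots> = (\<Sum>j<N. \<integral>X. indicator (B j) X \<partial>?Q)" by simp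
  also have "\<dots> = (\<integral>X. (\<Sum>j<N. indicator (B j) X) \<partial>?Q)"
    by (subst Bochner_Integration.integral_sum) (auto intro!: Q.integrable_const_bound[where B=1] simp: indicator_def)
  also have "\<dots> \<le> (\<integral>X. real n + 1 \<partial>?Q)"
  proof (intro integral_mono)
    show "integrable ?Q (\<lambda>X. \<Sum>j<N. indicator (B j) X :: real)"
      by (intro Bochner_Integration.integrable_sum Q.integrable_const_bound[where B=1]) (auto simp: indicator_def)
    fix X assume X: "X \<in> space ?Q"
    have "(\<Sum>j<N. indicator (B j) X :: real) =
        (\<Sum>j<N. if hull_sqdist n {..<N} x X < hull_sqdist n ({..<N} - {j}) x X then 1 else 0)"
      using X by (intro sum.cong) (auto simp: B_def indicator_def)
    also have "\<dots> = real (card {j\<in>{..<N}. hull_sqdist n {..<N} x X < hull_sqdist n ({..<N} - {j}) x X})"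
      by (subst sum.inter_filter[symmetric]) auto
    also have "\<dots> \<le> real (n + 1)"
      using card_hull_sqdist_essential[of "{..<N}" n x X] N by (intro of_nat_mono) auto
    finally show "(\<Sum>j<N. indicator (B j) X) \<le> real n + 1" by simp
  qed simp
  also have "\<dots> = real n + 1" by (simp add: Q.prob_space)
  finally show ?thesis
    using q N unfolding A_def by (simp add: field_simps)
qed

text \<open>Tonelli for the set \<open>C\<close> of pairs of a configuration and a point covered by
  it; its measurability is where the description by \<open>hull_sqdist\<close> pays off.\<close>

lemma exp_cover_swap:
  fixes n N :: nat
  assumes "prob_space \<mu>" "sets \<mu> = sets borel" "0 < N"
  defines "Q \<equiv> PiM {..<N} (\<lambda>_. mu_n \<mu> n)"
  shows "exp_cover \<mu> n N = (\<integral>x. measure Q {X\<in>space Q. hull_sqdist n {..<N} x X = 0} \<partial>mu_n \<mu> n)"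
    and "(\<lambda>x. measure Q {X\<in>space Q. hull_sqdist n {..<N} x X = 0}) \<in> borel_measurable (mu_n \<mu> n)"
proof -
  interpret mu: prob_space \<mu> by fact
  let ?P = "mu_n \<mu> n"
  interpret P: prob_space ?P unfolding mu_n_def by (intro prob_space_PiM assms(1))
  interpret Q: prob_space Q unfolding Q_def by (intro prob_space_PiM P.prob_space_axioms)
  interpret QP: pair_sigma_finite Q ?P by standard
  have sp: "space ?P = extensional {..<n}"
    using sets_eq_imp_space_eq[OF assms(2)] by (simp add: mu_n_def space_PiM PiE_def)
  have coord: "(\<lambda>y. y i) \<in> borel_measurable ?P" if "i < n" for i
    using that measurable_component_singleton[of i "{..<n}" "\<lambda>_. \<mu>"]
    unfolding mu_n_def measurable_cong_sets[OF refl assms(2)] by simp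
  define C where "C = {z\<in>space (Q \<Otimes>\<^sub>M ?P). hull_sqdist n {..<N} (snd z) (fst z) = 0}"
  have "(\<lambda>z. hull_sqdist n {..<N} (snd z) (fst z)) \<in> borel_measurable (Q \<Otimes>\<^sub>M ?P)"
  proof (rule hull_sqdist_measurable)
    show "{..<N} \<noteq> {}" using assms by (simp add: lessThan_empty_iff)
    fix i assume i: "i < n"
    show "(\<lambda>z. snd z i) \<in> borel_measurable (Q \<Otimes>\<^sub>M ?P)"
      by (rule measurable_compose[OF measurable_snd coord[OF i]])
    fix j assume j: "j \<in> {..<N}"
    show "(\<lambda>z. fst z j i) \<in> borel_measurable (Q \<Otimes>\<^sub>M ?P)"
      unfolding Q_def
      by (rule measurable_compose[OF measurable_compose[OF measurable_fst
            measurable_component_singleton[OF j]] coord[OF i]])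
  qed simp
  then have C[measurable]: "C \<in> sets (Q \<Otimes>\<^sub>M ?P)" unfolding C_def by measurable
  have slice1: "Pair X -` C = conv_points n N X" if "X \<in> space Q" for X
  proof -
    have "conv_points n N X \<subseteq> extensional {..<n}" by (auto simp: conv_points_def)
    then show ?thesis
      using that conv_points_iff_hull_sqdist[OF _ assms(3)] unfolding C_def space_pair_measure sp by auto
  qed
  have slice2: "(\<lambda>X. (X, x)) -` C = {X\<in>space Q. hull_sqdist n {..<N} x X = 0}" if "x \<in> space ?P" for x
    using that by (auto simp: C_def space_pair_measure)
  have m1: "(\<lambda>X. emeasure ?P (Pair X -` C)) \<in> borel_measurable Q"
    by (rule P.measurable_emeasure_Pair) (rule C)
  have m2: "(\<lambda>x. emeasure Q ((\<lambda>X. (X, x)) -` C)) \<in> borel_measurable ?P"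
    by (rule QP.measurable_emeasure_Pair2) (rule C)
  show m: "(\<lambda>x. measure Q {X\<in>space Q. hull_sqdist n {..<N} x X = 0}) \<in> borel_measurable ?P"
    using borel_measurable_enn2real[OF m2]
    by (rule measurable_cong[THEN iffD1, rotated]) (simp add: slice2 measure_def)
  have m': "(\<lambda>X. measure ?P (conv_points n N X)) \<in> borel_measurable Q"
    using borel_measurable_enn2real[OF m1]
    by (rule measurable_cong[THEN iffD1, rotated]) (simp add: slice1 measure_def)
  have "exp_cover \<mu> n N = enn2real (\<integral>\<^sup>+X. emeasure ?P (conv_points n N X) \<partial>Q)"
    unfolding exp_cover_def Q_def[symmetric] using m'
    by (subst integral_eq_nn_integral) (auto simp: P.emeasure_eq_measure)
  also have "(\<integral>\<^sup>+X. emeasure ?P (conv_points n N X) \<partial>Q) = (\<integral>\<^sup>+X. emeasure ?P (Pair X -` C) \<partial>Q)"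
    by (intro nn_integral_cong) (simp add: slice1)
  also have "\<dots> = (\<integral>\<^sup>+x. emeasure Q ((\<lambda>X. (X, x)) -` C) \<partial>?P)"
    by (metis C P.emeasure_pair_measure_alt QP.emeasure_pair_measure_alt2)
  also have "\<dots> = (\<integral>\<^sup>+x. emeasure Q {X\<in>space Q. hull_sqdist n {..<N} x X = 0} \<partial>?P)"
    by (intro nn_integral_cong) (simp add: slice2)
  also have "enn2real \<dots> = (\<integral>x. measure Q {X\<in>space Q. hull_sqdist n {..<N} x X = 0} \<partial>?P)"
    using m by (subst integral_eq_nn_integral) (auto simp: Q.emeasure_eq_measure)
  finally show "exp_cover \<mu> n N = \<dots>" .
qed

section \<open>Sums of independent variables and product densities\<close>

text \<open>A quartic minorant of the indicator of the positive half-line, whose expectation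
  involves only the first, second and fourth moments. For negative \<open>z\<close>, the linear term
  beats \<open>z^2\<close> down to \<open>- K\<close> and the quartic one beats it beyond. For
  \<open>0 \<le> z \<le> 3 * K\<close> the numerator is at most \<open>3 * K^2 + 9 * K^2\<close>,
  whence the 12.\<close>

lemma nonneg_indicator_ge_quartic:
  fixes z K :: real
  assumes K: "3 \<le> K"
  shows "(K * z + z\<^sup>2 - z ^ 4 / (2 * K)) / (12 * K\<^sup>2) \<le> (if 0 \<le> z then 1 else 0)"
proof -
  have z4: "z ^ 4 = z\<^sup>2 * z\<^sup>2" by (simp add: power2_eq_square power4_eq_xxxx)
  have "K * z + z\<^sup>2 - z ^ 4 / (2 * K) \<le> 0" if "z < 0"
  proof (cases "- z \<le> K")
    case True
    have "z\<^sup>2 = (- z) * (- z)" by (simp add: power2_eq_square)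
    also have "\<dots> \<le> K * (- z)" using True that by (intro mult_right_mono) auto
    finally have "K * z + z\<^sup>2 \<le> 0" by simp
    moreover have "0 \<le> z ^ 4 / (2 * K)" using K by simp
    ultimately show ?thesis by linarith
  next
    case False
    then have "K * K \<le> (- z) * (- z)" using K by (intro mult_mono) auto
    moreover have "K * 2 \<le> K * K" using K by (intro mult_left_mono) auto
    ultimately have "K * 2 \<le> z\<^sup>2" by (simp add: power2_eq_square)
    then have "z\<^sup>2 * (2 * K) \<le> z ^ 4" unfolding z4 by (intro mult_left_mono) auto
    then have "z\<^sup>2 \<le> z ^ 4 / (2 * K)" using K by (simp add: field_simps)
    moreover have "K * z \<le> 0" using that K by (simp add: mult_nonneg_nonpos)
    ultimately show ?thesis by linarith
  qed
  moreover have "K * z + z\<^sup>2 - z ^ 4 / (2 * K) \<le> 12 * K\<^sup>2" if "0 \<le> z"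
  proof (cases "z \<le> 3 * K")
    case True
    then have "K * z \<le> K * (3 * K)" using K by (intro mult_left_mono) auto
    moreover have "z\<^sup>2 \<le> (3 * K)\<^sup>2" using True that by (rule power_mono)
    moreover have "0 \<le> z ^ 4 / (2 * K)" using K by simp
    ultimately show ?thesis by (simp add: power2_eq_square)
  next
    case False
    then have "K * z \<le> z * z" using K that by (intro mult_right_mono) auto
    moreover have "(3 * K) * (3 * K) \<le> z * z" using False K by (intro mult_mono) auto
    moreover have "3 * (3 * K) \<le> (3 * K) * (3 * K)" using K by (intro mult_right_mono) auto
    ultimately have "K * z \<le> z * z" "4 * K \<le> z\<^sup>2" using K by (linarith, unfold power2_eq_square, linarith)
    then have "z\<^sup>2 * (4 * K) \<le> z ^ 4" unfolding z4 by (intro mult_left_mono) auto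
    then have "2 * z\<^sup>2 \<le> z ^ 4 / (2 * K)" using K by (simp add: field_simps)
    then have "K * z + z\<^sup>2 - z ^ 4 / (2 * K) \<le> 0"
      using \<open>K * z \<le> z * z\<close> by (simp add: power2_eq_square)
    moreover have "0 \<le> 12 * K\<^sup>2" by simp
    ultimately show ?thesis by linarith
  qed
  ultimately show ?thesis
    using K by (auto simp: divide_le_0_iff)
qed

section \<open>Moments of sums of independent centred variables\<close>

context prob_space begin

lemma integrable_power_le4:
  fixes Z :: "'a \<Rightarrow> real"
  assumes [measurable]: "Z \<in> borel_measurable M" and "integrable M (\<lambda>\<omega>. Z \<omega> ^ 4)" and "k \<le> 4"
  shows "integrable M (\<lambda>\<omega>. Z \<omega> ^ k)"
proof (rule Bochner_Integration.integrable_bound[of _ "\<lambda>\<omega>. 1 + Z \<omega> ^ 4"])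
  show "integrable M (\<lambda>\<omega>. 1 + Z \<omega> ^ 4)" using assms by simp
  have "\<bar>z\<bar> ^ k \<le> 1 + z ^ 4" for z :: real
  proof (cases "\<bar>z\<bar> \<le> 1")
    case True
    then have "\<bar>z\<bar> ^ k \<le> 1" by (simp add: power_le_one)
    moreover have "0 \<le> z ^ 4" by simp
    ultimately show ?thesis by linarith
  next
    case False
    then have "\<bar>z\<bar> ^ k \<le> \<bar>z\<bar> ^ 4" using assms by (intro power_increasing) auto
    then show ?thesis by (simp add: power_even_abs)
  qed
  then show "AE \<omega> in M. norm (Z \<omega> ^ k) \<le> norm (1 + Z \<omega> ^ 4)"
    by (intro always_eventually allI) (simp add: power_abs)
qed measurable

text \<open>Integrate the quartic minorant at \<open>Z\<close> normalised to variance 1: the linear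
  term vanishes, and \<open>1 - K / (2 * K) = 1/2\<close> remains in the numerator. If the variance
  is 0, then \<open>Z = 0\<close> almost surely.\<close>

lemma prob_nonneg_ge_of_moments:
  fixes Z :: "'a \<Rightarrow> real"
  assumes [measurable]: "Z \<in> borel_measurable M" and Z4: "integrable M (\<lambda>\<omega>. Z \<omega> ^ 4)"
    and "expectation Z = 0" and m4: "expectation (\<lambda>\<omega>. Z \<omega> ^ 4) \<le> K * (expectation (\<lambda>\<omega>. (Z \<omega>)\<^sup>2))\<^sup>2"
    and K: "3 \<le> K"
  shows "1 / (24 * K\<^sup>2) \<le> prob {\<omega>\<in>space M. 0 \<le> Z \<omega>}"
proof -
  define S where "S = expectation (\<lambda>\<omega>. (Z \<omega>)\<^sup>2)"
  have int: "integrable M Z" "integrable M (\<lambda>\<omega>. (Z \<omega>)\<^sup>2)"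
    using integrable_power_le4[OF assms(1,2), of 1] integrable_power_le4[OF assms(1,2), of 2] by simp_all
  have S: "0 \<le> S" by (simp add: S_def)
  show ?thesis
  proof (cases "S = 0")
    case True
    then have "AE \<omega> in M. (Z \<omega>)\<^sup>2 = 0"
      using integral_nonneg_eq_0_iff_AE[OF int(2)] by (simp add: S_def)
    then have "AE \<omega> in M. 0 \<le> Z \<omega>" by eventually_elim simp
    then have "prob {\<omega>\<in>space M. 0 \<le> Z \<omega>} = 1" by (subst prob_Collect_eq_1) auto
    moreover have "1 \<le> K\<^sup>2" using K by (simp add: one_le_power)
    then have "1 / (24 * K\<^sup>2) \<le> 1" by (subst divide_le_eq_1_pos) auto
    ultimately show ?thesis by simp
  next
    case False
    with S have S: "0 < S" by simp
    define z where "z \<omega> = Z \<omega> / sqrt S" for \<omega>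
    have z2: "(z \<omega>)\<^sup>2 = (Z \<omega>)\<^sup>2 / S" for \<omega> using S by (simp add: z_def power_divide)
    have z4: "z \<omega> ^ 4 = Z \<omega> ^ 4 / S\<^sup>2" for \<omega>
    proof -
      have "z \<omega> ^ 4 = ((z \<omega>)\<^sup>2)\<^sup>2" by simp
      then show ?thesis unfolding z2 by (simp add: power_divide)
    qed
    have iz: "integrable M (\<lambda>\<omega>. z \<omega>)" "integrable M (\<lambda>\<omega>. (z \<omega>)\<^sup>2)" "integrable M (\<lambda>\<omega>. (z \<omega>) ^ 4)"
      unfolding z2 z4 using int Z4 by (simp_all add: z_def)
    have E: "expectation z = 0" "expectation (\<lambda>\<omega>. (z \<omega>)\<^sup>2) = 1" "expectation (\<lambda>\<omega>. (z \<omega>) ^ 4) \<le> K"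
    proof -
      show "expectation z = 0" using assms(3) by (simp add: z_def[abs_def])
      show "expectation (\<lambda>\<omega>. (z \<omega>)\<^sup>2) = 1" unfolding z2 using S by (simp add: S_def)
      show "expectation (\<lambda>\<omega>. (z \<omega>) ^ 4) \<le> K"
        unfolding z4 using S m4 by (simp add: S_def[symmetric] divide_le_eq)
    qed
    have "1 / (24 * K\<^sup>2) = (1 - K / (2 * K)) / (12 * K\<^sup>2)" using K by (simp add: field_simps)
    also have "\<dots> \<le> (1 - expectation (\<lambda>\<omega>. (z \<omega>) ^ 4) / (2 * K)) / (12 * K\<^sup>2)"
      using E K by (intro divide_right_mono diff_left_mono) auto
    also have "\<dots> = expectation (\<lambda>\<omega>. (K * z \<omega> + (z \<omega>)\<^sup>2 - z \<omega> ^ 4 / (2 * K)) / (12 * K\<^sup>2))"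
      using E iz by simp
    also have "\<dots> \<le> expectation (indicator {\<omega>\<in>space M. 0 \<le> Z \<omega>})"
    proof (intro integral_mono)
      show "integrable M (\<lambda>\<omega>. (K * z \<omega> + (z \<omega>)\<^sup>2 - z \<omega> ^ 4 / (2 * K)) / (12 * K\<^sup>2))"
        using iz by simp
      show "integrable M (indicator {\<omega> \<in> space M. 0 \<le> Z \<omega>} :: _ \<Rightarrow> real)"
        by (intro integrable_const_bound[where B=1]) (auto simp: indicator_def)
      fix \<omega> assume "\<omega> \<in> space M"
      then show "(K * z \<omega> + (z \<omega>)\<^sup>2 - z \<omega> ^ 4 / (2 * K)) / (12 * K\<^sup>2) \<le> indicator {\<omega>\<in>space M. 0 \<le> Z \<omega>} \<omega>"
        using nonneg_indicator_ge_quartic[OF K, of "z \<omega>"] S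
        by (auto simp: indicator_def z_def zero_le_divide_iff split: if_splits)
    qed
    finally show ?thesis by simp
  qed
qed

lemma indep_vars_sum_second_moment:
  fixes X :: "'i \<Rightarrow> 'a \<Rightarrow> real"
  assumes "finite I" and "indep_vars (\<lambda>_. borel) X I"
    and "\<And>i. i \<in> I \<Longrightarrow> integrable M (\<lambda>\<omega>. (X i \<omega>)\<^sup>2)"
    and "\<And>i. i \<in> I \<Longrightarrow> expectation (X i) = 0"
  shows "integrable M (\<lambda>\<omega>. (\<Sum>i\<in>I. X i \<omega>)\<^sup>2) \<and> expectation (\<lambda>\<omega>. \<Sum>i\<in>I. X i \<omega>) = 0
    \<and> expectation (\<lambda>\<omega>. (\<Sum>i\<in>I. X i \<omega>)\<^sup>2) = (\<Sum>i\<in>I. expectation (\<lambda>\<omega>. (X i \<omega>)\<^sup>2))"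
  using assms
proof (induction I rule: finite_induct)
  case (insert j I)
  define Z where "Z \<omega> = (\<Sum>i\<in>I. X i \<omega>)" for \<omega>
  have ind: "indep_var borel (X j) borel Z"
    unfolding Z_def using insert by (intro indep_vars_sum) auto
  have [measurable]: "random_variable borel (X j)" "random_variable borel Z"
    using indep_var_rv1[OF ind] indep_var_rv2[OF ind] by auto
  have IH: "integrable M (\<lambda>\<omega>. (Z \<omega>)\<^sup>2)" "expectation Z = 0"
    "expectation (\<lambda>\<omega>. (Z \<omega>)\<^sup>2) = (\<Sum>i\<in>I. expectation (\<lambda>\<omega>. (X i \<omega>)\<^sup>2))"
    using insert.IH insert.prems indep_vars_subset[OF insert.prems(1), of I] by (auto simp: Z_def[abs_def])
  have X: "integrable M (\<lambda>\<omega>. (X j \<omega>)\<^sup>2)" "expectation (X j) = 0" using insert.prems by auto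
  have i1: "integrable M (X j)" "integrable M Z"
    using square_integrable_imp_integrable[OF _ X(1)] square_integrable_imp_integrable[OF _ IH(1)] by auto
  have i2: "integrable M (\<lambda>\<omega>. X j \<omega> * Z \<omega>)" "expectation (\<lambda>\<omega>. X j \<omega> * Z \<omega>) = 0"
    using indep_var_integrable[OF ind i1] indep_var_lebesgue_integral[OF ind i1] X by auto
  have sq: "(\<Sum>i\<in>insert j I. X i \<omega>)\<^sup>2 = (X j \<omega>)\<^sup>2 + 2 * (X j \<omega> * Z \<omega>) + (Z \<omega>)\<^sup>2" for \<omega>
    using insert.hyps by (simp add: Z_def power2_sum)
  have s: "(\<Sum>i\<in>insert j I. X i \<omega>) = X j \<omega> + Z \<omega>" for \<omega>
    using insert.hyps by (simp add: Z_def)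
  show ?case
    unfolding sq unfolding s using X IH i1 i2 insert.hyps by simp
qed simp

text \<open>For independent centred summands with second moments \<open>s\<close> and
  \<open>S\<close>, the only surviving cross term of the fourth power is \<open>6 * s * S\<close>.
  It is absorbed by the \<open>2 * K * s * S\<close> in \<open>K * (s + S)^2\<close> exactly when
  \<open>3 \<le> K\<close>, so the constant does not deteriorate along the induction.\<close>

lemma indep_vars_sum_fourth_moment:
  fixes X :: "'i \<Rightarrow> 'a \<Rightarrow> real"
  assumes "finite I" and "indep_vars (\<lambda>_. borel) X I"
    and "\<And>i. i \<in> I \<Longrightarrow> integrable M (\<lambda>\<omega>. X i \<omega> ^ 4)"
    and "\<And>i. i \<in> I \<Longrightarrow> expectation (X i) = 0"
    and "\<And>i. i \<in> I \<Longrightarrow> expectation (\<lambda>\<omega>. X i \<omega> ^ 4) \<le> K * (expectation (\<lambda>\<omega>. (X i \<omega>)\<^sup>2))\<^sup>2"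
    and K: "3 \<le> K"
  shows "integrable M (\<lambda>\<omega>. (\<Sum>i\<in>I. X i \<omega>) ^ 4) \<and> expectation (\<lambda>\<omega>. \<Sum>i\<in>I. X i \<omega>) = 0
    \<and> expectation (\<lambda>\<omega>. (\<Sum>i\<in>I. X i \<omega>) ^ 4) \<le> K * (expectation (\<lambda>\<omega>. (\<Sum>i\<in>I. X i \<omega>)\<^sup>2))\<^sup>2"
  using assms(1-5)
proof (induction I rule: finite_induct)
  case (insert j I)
  define Z where "Z \<omega> = (\<Sum>i\<in>I. X i \<omega>)" for \<omega>
  have ind: "indep_var borel (X j) borel Z"
    unfolding Z_def using insert by (intro indep_vars_sum) auto
  have [measurable]: "random_variable borel (X j)" "random_variable borel Z"
    using indep_var_rv1[OF ind] indep_var_rv2[OF ind] by auto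
  have IH: "integrable M (\<lambda>\<omega>. Z \<omega> ^ 4)" "expectation Z = 0"
    "expectation (\<lambda>\<omega>. Z \<omega> ^ 4) \<le> K * (expectation (\<lambda>\<omega>. (Z \<omega>)\<^sup>2))\<^sup>2"
    using insert.IH insert.prems indep_vars_subset[OF insert.prems(1), of I] by (auto simp: Z_def[abs_def])
  have X: "integrable M (\<lambda>\<omega>. X j \<omega> ^ 4)" "expectation (X j) = 0"
    "expectation (\<lambda>\<omega>. X j \<omega> ^ 4) \<le> K * (expectation (\<lambda>\<omega>. (X j \<omega>)\<^sup>2))\<^sup>2"
    using insert.prems by auto
  have iX: "integrable M (\<lambda>\<omega>. X j \<omega> ^ k)" and iZ: "integrable M (\<lambda>\<omega>. Z \<omega> ^ k)" if "k \<le> 4" for k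
    using integrable_power_le4[OF _ X(1) that] integrable_power_le4[OF _ IH(1) that] by auto
  have ind': "indep_var borel (\<lambda>\<omega>. X j \<omega> ^ k) borel (\<lambda>\<omega>. Z \<omega> ^ l)" for k l
    using indep_var_compose[OF ind, of "\<lambda>x. x ^ k" borel "\<lambda>x. x ^ l" borel] by (simp add: comp_def)
  have i2: "integrable M (\<lambda>\<omega>. X j \<omega> ^ k * Z \<omega> ^ l)"
    "expectation (\<lambda>\<omega>. X j \<omega> ^ k * Z \<omega> ^ l) = expectation (\<lambda>\<omega>. X j \<omega> ^ k) * expectation (\<lambda>\<omega>. Z \<omega> ^ l)"
    if "k \<le> 4" "l \<le> 4" for k l
    using indep_var_integrable[OF ind' iX iZ] indep_var_lebesgue_integral[OF ind' iX iZ] that by auto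
  define s where "s = expectation (\<lambda>\<omega>. (X j \<omega>)\<^sup>2)"
  define S where "S = expectation (\<lambda>\<omega>. (Z \<omega>)\<^sup>2)"
  have sS: "0 \<le> s" "0 \<le> S" by (simp_all add: s_def S_def)
  have sm: "(\<Sum>i\<in>insert j I. X i \<omega>) = X j \<omega> + Z \<omega>" for \<omega>
    using insert.hyps by (simp add: Z_def)
  have e4: "(X j \<omega> + Z \<omega>) ^ 4 = X j \<omega> ^ 4 + 4 * (X j \<omega> ^ 3 * Z \<omega> ^ 1) + 6 * (X j \<omega> ^ 2 * Z \<omega> ^ 2)
      + 4 * (X j \<omega> ^ 1 * Z \<omega> ^ 3) + Z \<omega> ^ 4" for \<omega>
    by (simp add: power4_eq_xxxx power3_eq_cube power2_eq_square algebra_simps)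
  have e2: "(X j \<omega> + Z \<omega>) ^ 2 = X j \<omega> ^ 2 + 2 * (X j \<omega> ^ 1 * Z \<omega> ^ 1) + Z \<omega> ^ 2" for \<omega>
    by (simp add: power2_sum)
  have E4: "expectation (\<lambda>\<omega>. (X j \<omega> + Z \<omega>) ^ 4) = expectation (\<lambda>\<omega>. X j \<omega> ^ 4) + 6 * (s * S) + expectation (\<lambda>\<omega>. Z \<omega> ^ 4)"
    unfolding e4 using i2(1)[of 3 1] i2(1)[of 2 2] i2(1)[of 1 3] i2(2)[of 3 1] i2(2)[of 2 2] i2(2)[of 1 3] X IH
    by (simp add: s_def S_def)
  have E2: "expectation (\<lambda>\<omega>. (X j \<omega> + Z \<omega>) ^ 2) = s + S"
    unfolding e2 using i2(1)[of 1 1] i2(2)[of 1 1] X IH iX[of 2] iZ[of 2] by (simp add: s_def S_def)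
  have "6 * (s * S) \<le> 2 * K * (s * S)" using K sS by (intro mult_right_mono) auto
  then have "expectation (\<lambda>\<omega>. (X j \<omega> + Z \<omega>) ^ 4) \<le> K * (s + S)\<^sup>2"
    unfolding E4 using X(3) IH(3) by (simp add: s_def[symmetric] S_def[symmetric] power2_sum algebra_simps)
  moreover have "integrable M (\<lambda>\<omega>. (X j \<omega> + Z \<omega>) ^ 4)"
    unfolding e4 using i2(1)[of 3 1] i2(1)[of 2 2] i2(1)[of 1 3] X IH by simp
  ultimately show ?case
    unfolding sm E2 using X(2) IH(2) iX[of 1] iZ[of 1] by simp
qed simp

end

section \<open>Product measures: independence of coordinates, deviation of sums, densities\<close>

lemma indep_vars_PiM_coordinates:
  assumes I: "finite I" and M: "\<And>i. i \<in> I \<Longrightarrow> prob_space (M i)"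
    and f: "\<And>i. i \<in> I \<Longrightarrow> f i \<in> borel_measurable (M i)"
  shows "prob_space.indep_vars (PiM I M) (\<lambda>_. borel) (\<lambda>i y. f i (y i) :: real) I"
proof -
  interpret prob_space "PiM I M" by (intro prob_space_PiM M)
  have "indep_vars M (\<lambda>i y. y i) I"
  proof (cases "I = {}")
    case True
    then show ?thesis unfolding indep_vars_def indep_sets_def by blast
  next
    case False
    have "distr (PiM I M) (PiM I M) (\<lambda>x. \<lambda>i\<in>I. x i) = distr (PiM I M) (PiM I M) (\<lambda>x. x)"
      by (intro distr_cong) (auto simp: space_PiM)
    moreover have "PiM I (\<lambda>i. distr (PiM I M) (M i) (\<lambda>x. x i)) = PiM I M"
      using I M by (intro PiM_cong refl distr_PiM_component) auto
    ultimately show ?thesis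
      using False I by (subst indep_vars_iff_distr_eq_PiM') (auto simp: distr_id2)
  qed
  then show ?thesis
    using f by (rule indep_vars_compose2) 
qed

lemma PiM_component_integral:
  fixes f :: "_ \<Rightarrow> real"
  assumes "finite I" "\<And>i. i \<in> I \<Longrightarrow> prob_space (M i)" "i \<in> I" and f: "f \<in> borel_measurable (M i)"
  shows "(\<integral>y. f (y i) \<partial>PiM I M) = (\<integral>t. f t \<partial>M i)"
    and "integrable (PiM I M) (\<lambda>y. f (y i)) \<longleftrightarrow> integrable (M i) f"
  using f distr_PiM_component[of I M i, OF assms(2,3)]
    integral_distr[of "\<lambda>y. y i" "PiM I M" "M i" f] integrable_distr_eq[of "\<lambda>y. y i" "PiM I M" "M i" f]
    measurable_component_singleton[OF assms(3), of M]
  by simp_all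

text \<open>Chebyshev; the uncentred second moments bounded by \<open>V\<close> dominate the
  variances. The factors may differ, because this serves for the tilted product as well as for the
  powers of \<open>\<mu>\<close>.\<close>

lemma PiM_sum_deviation_le:
  fixes f :: "'i \<Rightarrow> 'a \<Rightarrow> real"
  assumes I: "finite I" and M: "\<And>i. i \<in> I \<Longrightarrow> prob_space (M i)"
    and f: "\<And>i. i \<in> I \<Longrightarrow> f i \<in> borel_measurable (M i)"
    and f2: "\<And>i. i \<in> I \<Longrightarrow> integrable (M i) (\<lambda>t. (f i t)\<^sup>2)"
    and V: "\<And>i. i \<in> I \<Longrightarrow> (\<integral>t. (f i t)\<^sup>2 \<partial>M i) \<le> V"
    and a: "0 < a"
  shows "measure (PiM I M) {y\<in>space (PiM I M). a \<le> \<bar>\<Sum>i\<in>I. f i (y i) - (\<integral>t. f i t \<partial>M i)\<bar>} \<le> real (card I) * V / a\<^sup>2"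
proof -
  interpret P: prob_space "PiM I M" by (intro prob_space_PiM M)
  define g where "g i t = f i t - (\<integral>t. f i t \<partial>M i)" for i t
  have [measurable]: "g i \<in> borel_measurable (M i)" if "i \<in> I" for i
    unfolding g_def using f[OF that] by measurable
  have f1: "integrable (M i) (f i)" if "i \<in> I" for i
    using finite_measure.square_integrable_imp_integrable[OF _ f f2] that M
    by (meson prob_space.finite_measure)
  have g2i: "integrable (M i) (\<lambda>t. (g i t)\<^sup>2)" and g1: "(\<integral>t. g i t \<partial>M i) = 0"
    and g2: "(\<integral>t. (g i t)\<^sup>2 \<partial>M i) \<le> V" if "i \<in> I" for i
  proof -
    interpret prob_space "M i" using M that .
    show "integrable (M i) (\<lambda>t. (g i t)\<^sup>2)"
      using f1[OF that] f2[OF that] by (simp add: g_def power2_diff)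
    show "(\<integral>t. g i t \<partial>M i) = 0"
      using f1[OF that] by (simp add: g_def prob_space)
    have "(\<integral>t. (g i t)\<^sup>2 \<partial>M i) = (\<integral>t. (f i t)\<^sup>2 \<partial>M i) - (\<integral>t. f i t \<partial>M i)\<^sup>2"
      unfolding g_def using variance_eq[OF f1[OF that] f2[OF that]] by simp
    then show "(\<integral>t. (g i t)\<^sup>2 \<partial>M i) \<le> V" using V[OF that] by (smt (verit) zero_le_power2)
  qed
  define Z where "Z y = (\<Sum>i\<in>I. g i (y i))" for y
  have comp: "(\<lambda>y. g i (y i)) \<in> borel_measurable (PiM I M)" if "i \<in> I" for i
    using that by (intro measurable_compose[OF measurable_component_singleton]) auto
  have [measurable]: "Z \<in> borel_measurable (PiM I M)"
    unfolding Z_def using comp by (intro borel_measurable_sum)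
  have mom: "integrable (PiM I M) (\<lambda>y. (Z y)\<^sup>2) \<and> P.expectation Z = 0
    \<and> P.expectation (\<lambda>y. (Z y)\<^sup>2) = (\<Sum>i\<in>I. P.expectation (\<lambda>y. (g i (y i))\<^sup>2))"
    unfolding Z_def
  proof (rule P.indep_vars_sum_second_moment)
    show "P.indep_vars (\<lambda>_. borel) (\<lambda>i y. g i (y i)) I"
      using I M by (intro indep_vars_PiM_coordinates) auto
    fix i assume i: "i \<in> I"
    show "integrable (PiM I M) (\<lambda>y. (g i (y i))\<^sup>2)"
      using PiM_component_integral(2)[OF I M i, where f="\<lambda>t. (g i t)\<^sup>2"] g2i[OF i] i by simp
    show "P.expectation (\<lambda>y. g i (y i)) = 0"
      using PiM_component_integral(1)[OF I M i, where f="g i"] g1[OF i] i by simp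
  qed fact
  have "P.expectation (\<lambda>y. (g i (y i))\<^sup>2) \<le> V" if "i \<in> I" for i
    using PiM_component_integral(1)[OF I M that, where f="\<lambda>t. (g i t)\<^sup>2"] g2[OF that] that by simp
  then have "P.expectation (\<lambda>y. (Z y)\<^sup>2) \<le> (\<Sum>i\<in>I. V)"
    using mom by (simp only: mom) (intro sum_mono, auto)
  moreover have "P.prob {y\<in>space (PiM I M). a \<le> \<bar>Z y - P.expectation Z\<bar>} \<le> P.variance Z / a\<^sup>2"
    using mom a by (intro P.Chebyshev_inequality) auto
  ultimately have "P.prob {y\<in>space (PiM I M). a \<le> \<bar>Z y\<bar>} \<le> real (card I) * V / a\<^sup>2"
    using mom by (simp add: divide_right_mono order_trans[OF _ divide_right_mono])
  then show ?thesis by (simp only: Z_def g_def)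
qed

lemma PiM_density:
  fixes w :: "'i \<Rightarrow> 'a \<Rightarrow> ennreal"
  assumes I: "finite I" and \<mu>: "prob_space \<mu>" and w[measurable]: "\<And>i. w i \<in> borel_measurable \<mu>"
    and p: "\<And>i. prob_space (density \<mu> (w i))"
  shows "PiM I (\<lambda>i. density \<mu> (w i)) = density (PiM I (\<lambda>_. \<mu>)) (\<lambda>y. \<Prod>i\<in>I. w i (y i))"
proof -
  interpret \<mu>: prob_space \<mu> by fact
  interpret w: product_sigma_finite "\<lambda>i. density \<mu> (w i)"
    using p by (simp add: product_sigma_finite_def prob_space_imp_sigma_finite)
  interpret m: product_sigma_finite "\<lambda>_::'i. \<mu>" by standard
  have comp: "(\<lambda>y. w i (y i)) \<in> borel_measurable (PiM I (\<lambda>_. \<mu>))" if "i \<in> I" for i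
    using that by (intro measurable_compose[OF measurable_component_singleton]) auto
  have wm: "(\<lambda>y. \<Prod>i\<in>I. w i (y i)) \<in> borel_measurable (PiM I (\<lambda>_. \<mu>))"
    using comp by (intro borel_measurable_prod_ennreal) auto
  have "density (PiM I (\<lambda>_. \<mu>)) (\<lambda>y. \<Prod>i\<in>I. w i (y i)) = PiM I (\<lambda>i. density \<mu> (w i))"
  proof (rule w.PiM_eqI[OF I])
    show "sets (density (PiM I (\<lambda>_. \<mu>)) (\<lambda>y. \<Prod>i\<in>I. w i (y i))) = sets (PiM I (\<lambda>i. density \<mu> (w i)))"
      by (simp cong: sets_PiM_cong)
    fix A assume A: "\<And>i. i \<in> I \<Longrightarrow> A i \<in> sets (density \<mu> (w i))"
    then have A': "PiE I A \<in> sets (PiM I (\<lambda>_. \<mu>))" by (intro sets_PiM_I_finite I) auto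
    have "emeasure (density (PiM I (\<lambda>_. \<mu>)) (\<lambda>y. \<Prod>i\<in>I. w i (y i))) (PiE I A) =
        (\<integral>\<^sup>+y. (\<Prod>i\<in>I. w i (y i)) * indicator (PiE I A) y \<partial>PiM I (\<lambda>_. \<mu>))"
      using wm A' by (rule emeasure_density)
    also have "\<dots> = (\<integral>\<^sup>+y. (\<Prod>i\<in>I. w i (y i) * indicator (A i) (y i)) \<partial>PiM I (\<lambda>_. \<mu>))"
    proof (intro nn_integral_cong)
      fix y assume "y \<in> space (PiM I (\<lambda>_. \<mu>))"
      then have "indicator (PiE I A) y = (\<Prod>i\<in>I. indicator (A i) (y i) :: ennreal)"
        using I by (auto simp: indicator_def space_PiM PiE_iff prod_zero_iff)
      then show "(\<Prod>i\<in>I. w i (y i)) * indicator (PiE I A) y = (\<Prod>i\<in>I. w i (y i) * indicator (A i) (y i))"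
        by (simp add: prod.distrib)
    qed
    also have "\<dots> = (\<Prod>i\<in>I. \<integral>\<^sup>+t. w i t * indicator (A i) t \<partial>\<mu>)"
      using A by (intro m.product_nn_integral_prod I borel_measurable_times_ennreal w borel_measurable_indicator) auto
    also have "\<dots> = (\<Prod>i\<in>I. emeasure (density \<mu> (w i)) (A i))"
      using A by (intro prod.cong refl) (subst emeasure_density, auto)
    finally show "emeasure (density (PiM I (\<lambda>_. \<mu>)) (\<lambda>y. \<Prod>i\<in>I. w i (y i))) (PiE I A) = \<dots>" .
  qed
  then show ?thesis ..
qed

section \<open>Symmetric laws on the line\<close>

lemma power4_le_exp:
  fixes y a :: real
  assumes "0 < a"
  shows "y ^ 4 \<le> (4 / a) ^ 4 * exp (a * \<bar>y\<bar>)"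
proof -
  have "a * \<bar>y\<bar> / 4 \<le> exp (a * \<bar>y\<bar> / 4)"
    using exp_ge_add_one_self[of "a * \<bar>y\<bar> / 4"] by linarith
  then have "(a * \<bar>y\<bar> / 4) ^ 4 \<le> exp (a * \<bar>y\<bar> / 4) ^ 4"
    using assms by (intro power_mono) auto
  also have "\<dots> = exp (a * \<bar>y\<bar>)"
    by (simp add: exp_of_nat_mult[symmetric])
  finally have "(4 / a) ^ 4 * (a * \<bar>y\<bar> / 4) ^ 4 \<le> (4 / a) ^ 4 * exp (a * \<bar>y\<bar>)"
    by (intro mult_left_mono) auto
  moreover have "(4 / a) ^ 4 * (a * \<bar>y\<bar> / 4) ^ 4 = y ^ 4"
    using assms by (simp add: power_mult_distrib[symmetric])
  ultimately show ?thesis by simp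
qed

text \<open>At each point the single layer \<open>k = floor (f x)\<close> already dominates, since
  \<open>g\<close> is monotone and \<open>f x\<close> is at most \<open>k + 1\<close>. No
  differentiability of \<open>g\<close> is involved.\<close>

lemma nn_integral_le_layer_sum:
  fixes f :: "'a \<Rightarrow> real" and g :: "real \<Rightarrow> real"
  assumes [measurable]: "f \<in> borel_measurable M" and f: "\<And>x. 0 \<le> f x"
    and g: "\<And>u v. 0 \<le> u \<Longrightarrow> u \<le> v \<Longrightarrow> g u \<le> g v"
  shows "(\<integral>\<^sup>+x. ennreal (g (f x)) \<partial>M) \<le> (\<Sum>k. ennreal (g (real k + 1)) * emeasure M {x\<in>space M. real k \<le> f x})"
proof -
  have "(\<integral>\<^sup>+x. ennreal (g (f x)) \<partial>M) \<le> (\<integral>\<^sup>+x. (\<Sum>k. ennreal (g (real k + 1)) * indicator {x\<in>space M. real k \<le> f x} x) \<partial>M)"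
  proof (intro nn_integral_mono)
    fix x assume x: "x \<in> space M"
    define k where "k = nat \<lfloor>f x\<rfloor>"
    have k: "real k \<le> f x" "f x \<le> real k + 1"
      using f[of x] by (simp_all add: k_def)
    have "ennreal (g (f x)) \<le> ennreal (g (real k + 1)) * indicator {x\<in>space M. real k \<le> f x} x"
      using k x f g by (auto intro!: ennreal_leI)
    also have "\<dots> \<le> (\<Sum>k. ennreal (g (real k + 1)) * indicator {x\<in>space M. real k \<le> f x} x)"
      using sum_le_suminf[of h "{k}" for h :: "nat \<Rightarrow> ennreal"] by (simp add: summableI)
    finally show "ennreal (g (f x)) \<le> \<dots>" .
  qed
  also have "\<dots> = (\<Sum>k. ennreal (g (real k + 1)) * emeasure M {x\<in>space M. real k \<le> f x})"
    by (subst nn_integral_suminf) (auto simp: nn_integral_cmult)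
  finally show ?thesis .
qed

locale symmetric_law = prob_space \<mu> for \<mu> :: "real measure" +
  assumes sets_mu[measurable_cong]: "sets \<mu> = sets borel"
    and even_mu: "even_measure \<mu>"
begin

lemma space_mu[simp]: "space \<mu> = UNIV"
  using sets_eq_imp_space_eq[OF sets_mu] by simp

lemma prob_UNIV[simp]: "prob UNIV = 1"
  using prob_space by simp

lemma distr_uminus: "distr \<mu> borel uminus = \<mu>"
proof (rule measure_eqI)
  fix A assume "A \<in> sets (distr \<mu> borel uminus)"
  then have A: "A \<in> sets borel" by simp
  have "uminus -` A = uminus ` A" by (auto simp: image_iff) (metis minus_minus)
  then show "emeasure (distr \<mu> borel uminus) A = emeasure \<mu> A"
    using A even_mu by (subst emeasure_distr) (auto simp: even_measure_def)
qed (simp add: sets_mu)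

lemma integral_reflect:
  fixes f :: "real \<Rightarrow> real"
  assumes [measurable]: "f \<in> borel_measurable borel"
  shows "(\<integral>y. f (- y) \<partial>\<mu>) = (\<integral>y. f y \<partial>\<mu>)" and "integrable \<mu> (\<lambda>y. f (- y)) \<longleftrightarrow> integrable \<mu> f"
proof -
  have "(\<integral>y. f y \<partial>distr \<mu> borel uminus) = (\<integral>y. f (- y) \<partial>\<mu>)"
    by (subst integral_distr) auto
  then show "(\<integral>y. f (- y) \<partial>\<mu>) = (\<integral>y. f y \<partial>\<mu>)" by (simp add: distr_uminus)
  have "integrable (distr \<mu> borel uminus) f = integrable \<mu> (\<lambda>y. f (- y))"
    by (subst integrable_distr_eq) auto
  then show "integrable \<mu> (\<lambda>y. f (- y)) \<longleftrightarrow> integrable \<mu> f" by (simp add: distr_uminus)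
qed

lemma integral_odd_eq_0:
  fixes f :: "real \<Rightarrow> real"
  assumes "f \<in> borel_measurable borel" "\<And>y. f (- y) = - f y"
  shows "(\<integral>y. f y \<partial>\<mu>) = 0"
  using integral_reflect(1)[OF assms(1)] by (simp add: assms(2))

lemma measure_reflect:
  assumes "A \<in> sets borel"
  shows "measure \<mu> {y. - y \<in> A} = measure \<mu> A"
proof -
  have "{y. - y \<in> A} = uminus ` A" by (auto simp: image_iff) (metis minus_minus)
  then show ?thesis using even_mu assms by (simp add: even_measure_def measure_def)
qed

section \<open>Tail, moment generating function and rate function\<close>

definition tail :: "real \<Rightarrow> real" where "tail x = measure \<mu> {x..}"

definition mg :: "real \<Rightarrow> real" where "mg t = (\<integral>y. exp (t * y) \<partial>\<mu>)"

text \<open>Where the exponential is not integrable, \<open>mg\<close> takes the default value 0 of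
  the Bochner integral, so every statement about \<open>ln (mg t)\<close> has to be confined to this
  set.\<close>

definition mg_dom :: "real set" where "mg_dom = {t. integrable \<mu> (\<lambda>y. exp (t * y))}"

text \<open>Because \<open>ln 0 = 0\<close>, the value is 0 where the tail vanishes. The default
  value of \<open>rate\<close> agrees with this, so that \<open>rate\<close> stays below it
  everywhere.\<close>

definition neg_log_tail :: "real \<Rightarrow> real" where "neg_log_tail x = - ln (tail \<bar>x\<bar>)"

text \<open>By evenness the supremum may be restricted to \<open>t \<ge> 0\<close>, so this is \<open>\<Lambda>\<^sup>*\<close> as long as the
  tail is positive; the points where it vanishes will form a null set.\<close>

definition rate :: "real \<Rightarrow> real" where
  "rate x = (if 0 < tail \<bar>x\<bar> then SUP t\<in>{t\<in>mg_dom. 0 \<le> t}. t * \<bar>x\<bar> - ln (mg t) else 0)"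

lemma tail_antimono: "x \<le> y \<Longrightarrow> tail y \<le> tail x"
  unfolding tail_def by (intro finite_measure_mono) (auto simp: sets_mu)

lemma tail_nonneg: "0 \<le> tail x" and tail_le_1: "tail x \<le> 1"
  by (simp_all add: tail_def)

lemma tail_measurable[measurable]: "tail \<in> borel_measurable borel"
proof -
  have "(\<lambda>x. - tail x) \<in> borel_measurable borel"
    by (intro borel_measurable_mono monoI) (simp add: tail_antimono)
  then have "(\<lambda>x. - (- tail x)) \<in> borel_measurable borel" by (rule borel_measurable_uminus)
  then show ?thesis by simp
qed

lemma measure_le_neg: "measure \<mu> {..- x} = tail x"
proof -
  have "{..- x} = {y. - y \<in> {x..}}" by auto
  then show ?thesis using measure_reflect[of "{x..}"] by (simp add: tail_def)
qed

lemma mg_dom_minus: "t \<in> mg_dom \<Longrightarrow> - t \<in> mg_dom"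
  and mg_minus: "mg (- t) = mg t"
  using integral_reflect[of "\<lambda>y. exp (t * y)"] by (auto simp: mg_dom_def mg_def)

lemma integrable_exp_abs:
  assumes "t \<in> mg_dom" "s \<le> t"
  shows "integrable \<mu> (\<lambda>y. exp (s * \<bar>y\<bar>))"
proof (rule Bochner_Integration.integrable_bound[of _ "\<lambda>y. exp (t * y) + exp (- t * y)"])
  show "integrable \<mu> (\<lambda>y. exp (t * y) + exp (- t * y))"
    using assms mg_dom_minus[OF assms(1)] by (simp add: mg_dom_def)
  have "exp (s * \<bar>y\<bar>) \<le> exp (t * y) + exp (- t * y)" for y
  proof -
    have "exp (s * \<bar>y\<bar>) \<le> exp (t * \<bar>y\<bar>)" using assms by (simp add: mult_right_mono)
    also have "\<dots> \<le> exp (t * y) + exp (- t * y)" by (cases "0 \<le> y") auto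
    finally show ?thesis .
  qed
  then show "AE y in \<mu>. norm (exp (s * \<bar>y\<bar>)) \<le> norm (exp (t * y) + exp (- t * y))"
    by (intro always_eventually allI) (smt (verit) exp_gt_zero real_norm_def)
qed measurable

text \<open>The gap \<open>t - s\<close> absorbs a polynomial factor of degree four. This is why
  steepness asks for a parameter \<open>T'\<close> strictly beyond the tilt \<open>T\<close>: the
  tilted law then has fourth moments.\<close>

lemma integrable_quartic_exp:
  assumes t: "t \<in> mg_dom" "s < t" and [measurable]: "f \<in> borel_measurable borel"
    and le: "\<And>y. \<bar>f y\<bar> \<le> c * (1 + y ^ 4) * exp (s * \<bar>y\<bar>)"
  shows "integrable \<mu> f"
proof (rule Bochner_Integration.integrable_bound)
  define C where "C = 1 + (4 / (t - s)) ^ 4"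
  show "integrable \<mu> (\<lambda>y. \<bar>c\<bar> * C * exp (t * \<bar>y\<bar>))"
    using integrable_exp_abs[OF t(1) order_refl] by simp
  have "\<bar>f y\<bar> \<le> \<bar>c\<bar> * C * exp (t * \<bar>y\<bar>)" for y
  proof -
    have "1 + y ^ 4 \<le> exp ((t - s) * \<bar>y\<bar>) + (4 / (t - s)) ^ 4 * exp ((t - s) * \<bar>y\<bar>)"
      using t power4_le_exp[of "t - s" y] by (intro add_mono) auto
    then have "(1 + y ^ 4) * exp (s * \<bar>y\<bar>) \<le> (C * exp ((t - s) * \<bar>y\<bar>)) * exp (s * \<bar>y\<bar>)"
      by (intro mult_right_mono) (auto simp: C_def algebra_simps)
    also have "\<dots> = C * exp (t * \<bar>y\<bar>)"
      by (simp add: mult_exp_exp algebra_simps)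
    finally have *: "(1 + y ^ 4) * exp (s * \<bar>y\<bar>) \<le> C * exp (t * \<bar>y\<bar>)" .
    have "\<bar>f y\<bar> \<le> c * ((1 + y ^ 4) * exp (s * \<bar>y\<bar>))" using le[of y] by (simp add: mult_ac)
    also have "\<dots> \<le> \<bar>c\<bar> * ((1 + y ^ 4) * exp (s * \<bar>y\<bar>))" by (intro mult_right_mono) auto
    also have "\<dots> \<le> \<bar>c\<bar> * (C * exp (t * \<bar>y\<bar>))" using * by (intro mult_left_mono) auto
    finally show ?thesis by (simp add: mult_ac)
  qed
  then show "AE y in \<mu>. norm (f y) \<le> norm (\<bar>c\<bar> * C * exp (t * \<bar>y\<bar>))"
    by (intro always_eventually allI) (smt (verit) real_norm_def)
qed measurable

lemma mg_pos:
  assumes "t \<in> mg_dom"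
  shows "0 < mg t"
proof -
  have "mg t \<noteq> 0"
  proof
    assume "mg t = 0"
    then have "AE y in \<mu>. exp (t * y) = 0"
      using assms integral_nonneg_eq_0_iff_AE[of \<mu> "\<lambda>y. exp (t * y)"] by (simp add: mg_def mg_dom_def)
    then show False by (simp add: AE_False)
  qed
  moreover have "0 \<le> mg t" by (simp add: mg_def)
  ultimately show ?thesis by simp
qed

lemma exp_mult_tail_le_mg:
  assumes "t \<in> mg_dom" "0 \<le> t"
  shows "exp (t * u) * tail u \<le> mg t"
proof -
  have "exp (t * u) * tail u = (\<integral>y. exp (t * u) * indicator {u..} y \<partial>\<mu>)"
    by (simp add: tail_def)
  also have "\<dots> \<le> (\<integral>y. exp (t * y) \<partial>\<mu>)"
  proof (intro integral_mono)
    show "integrable \<mu> (\<lambda>y. exp (t * u) * indicator {u..} y)"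
      by (intro integrable_mult_right integrable_const_bound[where B=1]) (auto simp: indicator_def)
    show "integrable \<mu> (\<lambda>y. exp (t * y))" using assms by (simp add: mg_dom_def)
  qed (use assms in \<open>auto simp: indicator_def mult_left_mono\<close>)
  finally show ?thesis by (simp add: mg_def)
qed

lemma chernoff:
  assumes "t \<in> mg_dom" "0 \<le> t" "0 < tail u"
  shows "t * u - ln (mg t) \<le> - ln (tail u)"
proof -
  have "ln (exp (t * u) * tail u) \<le> ln (mg t)"
    using exp_mult_tail_le_mg[OF assms(1,2), of u] assms(3) by (subst ln_le_cancel_iff) (auto simp: mg_pos assms)
  then show ?thesis using assms(3) by (simp add: ln_mult)
qed

lemma zero_in_mg_dom: "0 \<in> mg_dom" by (simp add: mg_dom_def)

lemma mg_0: "mg 0 = 1" by (simp add: mg_def)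

lemma rate_bdd:
  "0 < tail \<bar>x\<bar> \<Longrightarrow> bdd_above ((\<lambda>t. t * \<bar>x\<bar> - ln (mg t)) ` {t\<in>mg_dom. 0 \<le> t})"
  using chernoff by (intro bdd_aboveI[of _ "- ln (tail \<bar>x\<bar>)"]) auto

lemma rate_le_neg_log_tail: "rate x \<le> neg_log_tail x"
proof (cases "0 < tail \<bar>x\<bar>")
  case True
  then show ?thesis
    unfolding rate_def neg_log_tail_def
    using zero_in_mg_dom chernoff by (auto intro!: cSUP_least)
next
  case False
  then have "tail \<bar>x\<bar> = 0" using tail_nonneg[of "\<bar>x\<bar>"] by simp
  then show ?thesis by (simp add: rate_def neg_log_tail_def)
qed

lemma rate_ge:
  assumes "0 < tail \<bar>x\<bar>" "t \<in> mg_dom"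
  shows "t * x - ln (mg t) \<le> rate x"
proof -
  have "t * x \<le> \<bar>t\<bar> * \<bar>x\<bar>" by (metis abs_ge_self abs_mult)
  moreover have "\<bar>t\<bar> \<in> mg_dom" "mg \<bar>t\<bar> = mg t"
    using assms mg_dom_minus mg_minus[of t] by (auto simp: abs_if)
  moreover have "\<bar>t\<bar> * \<bar>x\<bar> - ln (mg \<bar>t\<bar>) \<le> rate x"
    using assms(1) \<open>\<bar>t\<bar> \<in> mg_dom\<close> unfolding rate_def
    by (simp, intro cSUP_upper rate_bdd) auto
  ultimately show ?thesis by simp
qed

lemma rate_approx:
  assumes "0 < tail \<bar>x\<bar>" "0 < e"
  shows "\<exists>t\<in>mg_dom. rate x - e \<le> t * x - ln (mg t)"
proof -
  have "rate x - e < (SUP t\<in>{t\<in>mg_dom. 0 \<le> t}. t * \<bar>x\<bar> - ln (mg t))"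
    using assms by (simp add: rate_def)
  then obtain t where t: "t \<in> mg_dom" "0 \<le> t" "rate x - e < t * \<bar>x\<bar> - ln (mg t)"
    using less_cSUP_iff[OF _ rate_bdd[OF assms(1)]] zero_in_mg_dom by auto
  show ?thesis
  proof (cases "0 \<le> x")
    case True
    then show ?thesis using t by (intro bexI[of _ t]) auto
  next
    case False
    then show ?thesis using t mg_dom_minus by (intro bexI[of _ "- t"]) (auto simp: mg_minus)
  qed
qed

lemma rate_nonneg: "0 \<le> rate x"
  using rate_ge[of x 0] zero_in_mg_dom by (cases "0 < tail \<bar>x\<bar>") (auto simp: mg_0 rate_def)

lemma neg_log_tail_nonneg: "0 \<le> neg_log_tail x"
  using tail_le_1[of "\<bar>x\<bar>"] tail_nonneg[of "\<bar>x\<bar>"]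
  by (cases "tail \<bar>x\<bar> = 0") (auto simp: neg_log_tail_def)

lemma neg_log_tail_measurable[measurable]: "neg_log_tail \<in> borel_measurable borel"
  unfolding neg_log_tail_def[abs_def] by measurable

text \<open>The supremum runs over uncountably many parameters, so measurability is drawn from
  monotonicity in \<open>\<bar>x\<bar>\<close> on the set where the tail is positive.\<close>

lemma rate_measurable[measurable]: "rate \<in> borel_measurable borel"
proof -
  define A where "A = {u. 0 \<le> u \<and> 0 < tail u}"
  define h where "h u = (SUP t\<in>{t\<in>mg_dom. 0 \<le> t}. t * u - ln (mg t))" for u
  have [measurable]: "A \<in> sets borel" unfolding A_def by measurable
  have "mono_on A h"
  proof (rule mono_onI)
    fix u v assume uv: "u \<in> A" "v \<in> A" "u \<le> v"
    show "h u \<le> h v"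
      unfolding h_def
    proof (rule cSUP_mono)
      show "{t\<in>mg_dom. 0 \<le> t} \<noteq> {}" using zero_in_mg_dom by auto
      show "bdd_above ((\<lambda>t. t * v - ln (mg t)) ` {t\<in>mg_dom. 0 \<le> t})"
        using rate_bdd[of v] uv by (simp add: A_def)
      fix t assume "t \<in> {t\<in>mg_dom. 0 \<le> t}"
      then show "\<exists>s\<in>{t\<in>mg_dom. 0 \<le> t}. t * u - ln (mg t) \<le> s * v - ln (mg s)"
        using uv by (intro bexI[of _ t]) (auto simp: mult_left_mono)
    qed
  qed
  then have "h \<in> borel_measurable (restrict_space borel A)" by (rule borel_measurable_mono_on_fnc)
  then have "(\<lambda>u. indicator A u *\<^sub>R h u) \<in> borel_measurable borel"
    by (subst (asm) borel_measurable_restrict_space_iff) auto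
  then have "(\<lambda>x. indicator A \<bar>x\<bar> *\<^sub>R h \<bar>x\<bar>) \<in> borel_measurable borel"
    by (rule measurable_compose[rotated]) measurable
  also have "(\<lambda>x. indicator A \<bar>x\<bar> *\<^sub>R h \<bar>x\<bar>) = rate"
    by (auto simp: fun_eq_iff rate_def h_def A_def)
  finally show ?thesis .
qed

text \<open>Inner regularity reduces to compact sets, which have a least element.\<close>

lemma measure_tail_le:
  assumes "0 \<le> u"
  shows "measure \<mu> {y. tail y \<le> u} \<le> u"
proof -
  have B: "{y. tail y \<le> u} \<in> sets borel" by measurable
  have "emeasure \<mu> {y. tail y \<le> u} = (SUP K\<in>{K. K \<subseteq> {y. tail y \<le> u} \<and> compact K}. emeasure \<mu> K)"
    using B by (intro inner_regular sets_mu) auto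
  also have "\<dots> \<le> ennreal u"
  proof (rule SUP_least)
    fix K assume K: "K \<in> {K. K \<subseteq> {y. tail y \<le> u} \<and> compact K}"
    show "emeasure \<mu> K \<le> ennreal u"
    proof (cases "K = {}")
      case False
      then obtain m where m: "m \<in> K" "\<forall>y\<in>K. m \<le> y"
        using K compact_attains_inf[of K] by auto
      have "emeasure \<mu> K \<le> emeasure \<mu> {m..}"
        using m by (intro emeasure_mono) (auto simp: sets_mu)
      also have "\<dots> = ennreal (tail m)" by (simp add: tail_def emeasure_eq_measure)
      also have "\<dots> \<le> ennreal u" using m K by (intro ennreal_leI) auto
      finally show ?thesis .
    qed simp
  qed
  finally show ?thesis using assms by (simp add: emeasure_eq_measure)
qed

lemma measure_tail_abs_le:
  assumes "0 \<le> u"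
  shows "measure \<mu> {y. tail \<bar>y\<bar> \<le> u} \<le> 2 * u"
proof -
  have [measurable]: "{y. tail y \<le> u} \<in> sets borel" by measurable
  have m: "{y. - y \<in> {y. tail y \<le> u}} \<in> sets borel" by measurable
  have "measure \<mu> {y. tail \<bar>y\<bar> \<le> u} \<le> measure \<mu> ({y. tail y \<le> u} \<union> {y. - y \<in> {y. tail y \<le> u}})"
    using m by (intro finite_measure_mono) (auto simp: abs_if sets_mu)
  also have "\<dots> \<le> measure \<mu> {y. tail y \<le> u} + measure \<mu> {y. - y \<in> {y. tail y \<le> u}}"
    using m by (intro measure_subadditive) (auto simp: sets_mu emeasure_eq_measure)
  also have "\<dots> \<le> u + u"
    using measure_tail_le[OF assms] measure_reflect[of "{y. tail y \<le> u}"] by simp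
  finally show ?thesis by simp
qed

text \<open>By \<open>measure_tail_abs_le\<close> the layer \<open>{neg_log_tail >= k}\<close> has
  mass at most \<open>2 * exp (- k)\<close>, whatever the law is. Half of this decay is spent on the
  factor \<open>(k + 1)^2\<close>. As \<open>rate\<close> and \<open>trunc_rate\<close> lie between
  0 and \<open>neg_log_tail\<close>, this provides the second moments for the weak law.\<close>

lemma integrable_neg_log_tail_sq: "integrable \<mu> (\<lambda>y. (neg_log_tail y)\<^sup>2)"
proof (rule integrableI_nonneg)
  have lay: "emeasure \<mu> {y\<in>space \<mu>. real k \<le> neg_log_tail y} \<le> ennreal (2 * exp (- real k))" for k
  proof (cases "k = 0")
    case True
    have "emeasure \<mu> {y\<in>space \<mu>. real k \<le> neg_log_tail y} \<le> 1" by (rule emeasure_le_1)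
    also have "\<dots> \<le> ennreal 2" by simp
    finally show ?thesis using True by simp
  next
    case False
    have "tail \<bar>y\<bar> \<le> exp (- real k)" if "real k \<le> neg_log_tail y" for y
    proof (cases "tail \<bar>y\<bar> = 0")
      case False
      then have "tail \<bar>y\<bar> = exp (ln (tail \<bar>y\<bar>))" using tail_nonneg[of "\<bar>y\<bar>"] by simp
      also have "\<dots> \<le> exp (- real k)" using that by (simp add: neg_log_tail_def)
      finally show ?thesis .
    qed simp
    then have "measure \<mu> {y\<in>space \<mu>. real k \<le> neg_log_tail y} \<le> measure \<mu> {y. tail \<bar>y\<bar> \<le> exp (- real k)}"
      by (intro finite_measure_mono) (auto simp: sets_mu)
    also have "\<dots> \<le> 2 * exp (- real k)" by (rule measure_tail_abs_le) simp
    finally show ?thesis by (simp add: emeasure_eq_measure)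
  qed
  have "(\<integral>\<^sup>+y. ennreal ((neg_log_tail y)\<^sup>2) \<partial>\<mu>)
      \<le> (\<Sum>k. ennreal ((real k + 1)\<^sup>2) * emeasure \<mu> {y\<in>space \<mu>. real k \<le> neg_log_tail y})"
    by (intro nn_integral_le_layer_sum power_mono) (auto simp: neg_log_tail_nonneg)
  also have "\<dots> \<le> (\<Sum>k. ennreal ((real k + 1)\<^sup>2) * ennreal (2 * exp (- real k)))"
    by (intro suminf_le mult_left_mono lay) auto
  also have "\<dots> = (\<Sum>k. ennreal ((real k + 1)\<^sup>2 * (2 * exp (- real k))))"
    by (simp add: ennreal_mult)
  also have "\<dots> < \<infinity>"
  proof -
    have "summable (\<lambda>k. (real k + 1)\<^sup>2 * (2 * exp (- real k)))"
    proof (rule summable_comparison_test'[where N=0])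
      show "summable (\<lambda>k. (32 * exp (1/2)) * exp (- (1/2)) ^ k :: real)"
        by (intro summable_mult summable_geometric) simp
      fix k :: nat
      have "(real k + 1) / 4 \<le> exp ((real k + 1) / 4)"
        using exp_ge_add_one_self[of "(real k + 1) / 4"] by linarith
      then have "((real k + 1) / 4)\<^sup>2 \<le> (exp ((real k + 1) / 4))\<^sup>2" by (intro power_mono) auto
      also have "\<dots> = exp ((real k + 1) / 2)" by (simp add: power2_eq_square mult_exp_exp)
      finally have "(real k + 1)\<^sup>2 \<le> 16 * exp ((real k + 1) / 2)" by (simp add: power_divide)
      then have "(real k + 1)\<^sup>2 * (2 * exp (- real k)) \<le> (16 * exp ((real k + 1) / 2)) * (2 * exp (- real k))"
        by (intro mult_right_mono) auto
      also have "\<dots> = 32 * (exp ((real k + 1) / 2) * exp (- real k))" by simp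
      also have "exp ((real k + 1) / 2) * exp (- real k) = exp (1/2) * exp (- (1/2)) ^ k"
        by (simp add: exp_of_nat_mult[symmetric] mult_exp_exp field_simps)
      finally show "norm ((real k + 1)\<^sup>2 * (2 * exp (- real k))) \<le> (32 * exp (1/2)) * exp (- (1/2)) ^ k"
        by (simp add: mult.assoc)
    qed
    then show ?thesis
      by (subst suminf_ennreal2) (auto simp: top_unique)
  qed
  finally show "(\<integral>\<^sup>+y. ennreal ((neg_log_tail y)\<^sup>2) \<partial>\<mu>) < \<infinity>" .
qed auto



lemma integrable_rate_sq: "integrable \<mu> (\<lambda>y. (rate y)\<^sup>2)"
  by (rule Bochner_Integration.integrable_bound[OF integrable_neg_log_tail_sq])
    (auto intro!: power_mono simp: rate_nonneg rate_le_neg_log_tail)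

lemma integrable_rate: "integrable \<mu> rate"
  by (rule square_integrable_imp_integrable[OF _ integrable_rate_sq]) simp

end

section \<open>Steep laws: positivity of the mean rate, truncation, tilted means\<close>

lemma exp_le_quadratic:
  fixes u :: real
  shows "exp u \<le> 1 + u + u\<^sup>2 * exp \<bar>u\<bar>"
proof -
  have "exp u * (1 - u) \<le> exp u * exp (- u)"
    using exp_ge_add_one_self[of "- u"] by (intro mult_left_mono) auto
  then have 1: "exp u \<le> 1 + u * exp u" by (simp add: mult_exp_exp algebra_simps)
  have "u * (exp u - 1) \<le> u\<^sup>2 * exp \<bar>u\<bar>"
  proof (cases "0 \<le> u")
    case True
    have "exp u - 1 \<le> u * exp u" using 1 by simp
    then have "u * (exp u - 1) \<le> u * (u * exp u)" using True by (intro mult_left_mono) auto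
    then show ?thesis using True by (simp add: power2_eq_square)
  next
    case False
    have "1 - exp u \<le> - u" using exp_ge_add_one_self[of u] by linarith
    then have "(- u) * (1 - exp u) \<le> (- u) * (- u)" using False by (intro mult_left_mono) auto
    also have "\<dots> \<le> u\<^sup>2 * exp \<bar>u\<bar>"
      by (simp add: power2_eq_square[symmetric] mult_le_cancel_left1)
    finally show ?thesis by (simp add: algebra_simps)
  qed
  then show ?thesis using 1 by (simp add: algebra_simps)
qed

text \<open>In \<open>steep\<close>, the inequality at \<open>T\<close> forces the law tilted by
  \<open>T\<close> to have mean at least \<open>R\<close>, because
  \<open>exp u - 1 \<le> u * exp u\<close>; \<open>T'\<close> leaves room for polynomial moments
  under that tilt, and \<open>R'\<close> keeps \<open>R\<close> strictly inside the support. By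
  \<open>exhaust\<close>, such \<open>R\<close> capture all but an arbitrarily small part of the
  mass.\<close>

locale steep_symmetric_law = symmetric_law +
  assumes exp_moment: "\<exists>r>0. integrable \<mu> (\<lambda>y. exp (r * y))"
    and nondegenerate: "measure \<mu> {0} < 1"
    and steep: "\<And>R R'. 0 \<le> R \<Longrightarrow> R < R' \<Longrightarrow> 0 < measure \<mu> {R'..} \<Longrightarrow>
      \<exists>T>0. \<exists>T'>T. integrable \<mu> (\<lambda>y. exp (T' * y)) \<and> 1 \<le> (\<integral>y. exp (T * (y - R)) \<partial>\<mu>)"
    and exhaust: "\<And>e. 0 < e \<Longrightarrow> \<exists>R\<ge>0. \<exists>R'>R. 0 < measure \<mu> {R'..} \<and> measure \<mu> {y. R < \<bar>y\<bar>} < e"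
begin

lemma mean_0: "(\<integral>y. y \<partial>\<mu>) = 0"
  by (rule integral_odd_eq_0) auto

lemma AE_tail_pos: "AE y in \<mu>. 0 < tail \<bar>y\<bar>"
proof -
  have "measure \<mu> {y. \<not> 0 < tail \<bar>y\<bar>} \<le> e" if e: "0 < e" for e
  proof -
    obtain R R' where R: "0 \<le> R" "R < R'" "0 < measure \<mu> {R'..}" "measure \<mu> {y. R < \<bar>y\<bar>} < e"
      using exhaust[OF e] by blast
    have "\<not> 0 < tail \<bar>y\<bar> \<Longrightarrow> R < \<bar>y\<bar>" for y
      using R tail_antimono[of "\<bar>y\<bar>" R'] by (fastforce simp: tail_def)
    then have "measure \<mu> {y. \<not> 0 < tail \<bar>y\<bar>} \<le> measure \<mu> {y. R < \<bar>y\<bar>}"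
      by (intro finite_measure_mono) (auto simp: sets_mu)
    then show ?thesis using R by simp
  qed
  then have "measure \<mu> {y. \<not> 0 < tail \<bar>y\<bar>} = 0"
    by (metis field_le_epsilon add_0 measure_nonneg order_antisym)
  moreover have "{y. \<not> 0 < tail \<bar>y\<bar>} \<in> sets \<mu>" unfolding sets_mu by measurable
  ultimately show ?thesis
    by (intro AE_I[where N="{y. \<not> 0 < tail \<bar>y\<bar>}"]) (auto simp: emeasure_eq_measure)
qed

text \<open>The mean is 0, so \<open>ln (mg t)\<close> is at most \<open>C * t^2\<close> for small
  \<open>t\<close>, and the linear term \<open>t * \<bar>x\<bar>\<close> wins near
  \<open>t = 0\<close>.\<close>

lemma rate_pos:
  assumes x: "x \<noteq> 0" "0 < tail \<bar>x\<bar>"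
  shows "0 < rate x"
proof -
  obtain r where r: "0 < r" "r \<in> mg_dom" using exp_moment by (auto simp: mg_dom_def)
  define s where "s = r / 2"
  have s: "0 < s" "s < r" using r by (auto simp: s_def)
  define C where "C = (\<integral>y. y\<^sup>2 * exp (s * \<bar>y\<bar>) \<partial>\<mu>)"
  have C: "0 \<le> C" by (simp add: C_def)
  have y2: "y\<^sup>2 \<le> 1 + y ^ 4" "\<bar>y\<bar> \<le> 1 + y ^ 4" for y :: real
    by (sos)+
  have i2: "integrable \<mu> (\<lambda>y. y\<^sup>2 * exp (s * \<bar>y\<bar>))"
    by (rule integrable_quartic_exp[OF r(2) s(2), where c=1]) (auto simp: y2 mult_right_mono)
  have i1: "integrable \<mu> (\<lambda>y. y)"
    by (rule integrable_quartic_exp[OF r(2), where c=1 and s=0]) (use r y2 in auto)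
  \<comment> \<open>The second bound gives \<open>t * C \<le> \<bar>x\<bar> / 2\<close>, which makes
    the quadratic term smaller than the linear one; \<open>C + 1\<close> avoids division by
    0.\<close>
  define t where "t = min s (\<bar>x\<bar> / (2 * (C + 1)))"
  have t: "0 < t" "t \<le> s" "t \<le> \<bar>x\<bar> / (2 * (C + 1))" using s C x by (auto simp: t_def)
  have "integrable \<mu> (\<lambda>y. exp (t * y))"
  proof (rule integrable_quartic_exp[OF r(2) s(2), where c=1])
    fix y :: real
    have "t * y \<le> t * \<bar>y\<bar>" using t by (intro mult_left_mono) auto
    also have "\<dots> \<le> s * \<bar>y\<bar>" using t by (intro mult_right_mono) auto
    finally have "1 * exp (t * y) \<le> (1 + y ^ 4) * exp (s * \<bar>y\<bar>)" by (intro mult_mono) auto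
    then show "\<bar>exp (t * y)\<bar> \<le> 1 * (1 + y ^ 4) * exp (s * \<bar>y\<bar>)" by simp
  qed measurable
  then have td: "t \<in> mg_dom" by (simp add: mg_dom_def)
  have "mg t \<le> (\<integral>y. 1 + t * y + t\<^sup>2 * (y\<^sup>2 * exp (s * \<bar>y\<bar>)) \<partial>\<mu>)"
    unfolding mg_def
  proof (intro integral_mono)
    show "integrable \<mu> (\<lambda>y. exp (t * y))" using td by (simp add: mg_dom_def)
    show "integrable \<mu> (\<lambda>y. 1 + t * y + t\<^sup>2 * (y\<^sup>2 * exp (s * \<bar>y\<bar>)))" using i1 i2 by simp
    fix y :: real
    have "exp \<bar>t * y\<bar> \<le> exp (s * \<bar>y\<bar>)" using t by (simp add: abs_mult mult_right_mono)
    then have "(t * y)\<^sup>2 * exp \<bar>t * y\<bar> \<le> (t * y)\<^sup>2 * exp (s * \<bar>y\<bar>)" by (intro mult_left_mono) auto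
    then show "exp (t * y) \<le> 1 + t * y + t\<^sup>2 * (y\<^sup>2 * exp (s * \<bar>y\<bar>))"
      using exp_le_quadratic[of "t * y"] by (simp add: power_mult_distrib)
  qed
  also have "\<dots> = 1 + t\<^sup>2 * C"
    using i1 i2 by (simp add: C_def mean_0)
  finally have "mg t \<le> 1 + t\<^sup>2 * C" .
  then have "ln (mg t) \<le> ln (1 + t\<^sup>2 * C)" using mg_pos[OF td] C by (subst ln_le_cancel_iff) (auto intro!: add_pos_nonneg)
  also have "\<dots> \<le> t\<^sup>2 * C" using C by (intro ln_add_one_self_le_self) auto
  finally have lnm: "ln (mg t) \<le> t * (t * C)" by (simp add: power2_eq_square)
  have "t * C \<le> t * (C + 1)" using t by (simp add: mult_left_mono)
  also have "\<dots> \<le> \<bar>x\<bar> / (2 * (C + 1)) * (C + 1)" using t C by (intro mult_right_mono) auto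
  also have "\<dots> = \<bar>x\<bar> / 2" using C by (simp add: field_simps)
  also have "\<dots> < \<bar>x\<bar>" using x by simp
  finally have "t * (t * C) < t * \<bar>x\<bar>" using t by (intro mult_strict_left_mono) auto
  then have "0 < t * \<bar>x\<bar> - ln (mg t)" using lnm by simp
  also have "\<dots> \<le> rate \<bar>x\<bar>" using rate_ge[of "\<bar>x\<bar>" t] td x by simp
  also have "\<dots> = rate x" by (simp add: rate_def)
  finally show ?thesis .
qed

text \<open>Needed because the thresholds only see \<open>N > n\<close>: below a positive limit
  there is still a positive exponential rate, at which \<open>N\<close> outgrows
  \<open>n\<close>.\<close>

lemma mean_rate_pos: "0 < (\<integral>y. rate y \<partial>\<mu>)"
proof -
  have "(\<integral>y. rate y \<partial>\<mu>) \<noteq> 0"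
  proof
    assume "(\<integral>y. rate y \<partial>\<mu>) = 0"
    then have "AE y in \<mu>. rate y = 0"
      using integral_nonneg_eq_0_iff_AE[OF integrable_rate] rate_nonneg by simp
    then have "AE y in \<mu>. y \<in> {0}"
      using AE_tail_pos by eventually_elim (use rate_pos in force)
    then have "measure \<mu> {0} = 1"
      by (subst prob_eq_1) (auto simp: sets_mu)
    then show False using nondegenerate by simp
  qed
  moreover have "0 \<le> (\<integral>y. rate y \<partial>\<mu>)" by (simp add: rate_nonneg)
  ultimately show ?thesis by simp
qed

text \<open>The exponential cost per coordinate of the change of measure: \<open>rate\<close> where
  the law is tilted, \<open>neg_log_tail\<close> where it is conditioned on a half-line.\<close>

definition trunc_rate :: "real \<Rightarrow> real \<Rightarrow> real" where
  "trunc_rate R x = (if \<bar>x\<bar> \<le> R then rate x else neg_log_tail x)"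

lemma trunc_rate_measurable[measurable]: "trunc_rate R \<in> borel_measurable borel"
  unfolding trunc_rate_def[abs_def] by measurable

lemma trunc_rate_bounds: "0 \<le> trunc_rate R x" "trunc_rate R x \<le> neg_log_tail x"
  by (auto simp: trunc_rate_def rate_nonneg neg_log_tail_nonneg rate_le_neg_log_tail)

lemma integrable_trunc_rate_sq: "integrable \<mu> (\<lambda>y. (trunc_rate R y)\<^sup>2)"
  by (rule Bochner_Integration.integrable_bound[OF integrable_neg_log_tail_sq])
    (auto intro!: power_mono simp: trunc_rate_bounds)

lemma integrable_trunc_rate: "integrable \<mu> (trunc_rate R)"
  by (rule square_integrable_imp_integrable[OF _ integrable_trunc_rate_sq]) simp

text \<open>Beyond \<open>R\<close> the inequality \<open>L \<le> s * L^2 + 1 / s\<close> replaces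
  the Cauchy-Schwarz inequality. With \<open>s = e / (2 * A)\<close> the first term contributes at
  most \<open>e / 2\<close> on average, and \<open>exhaust\<close> makes the mass beyond
  \<open>R\<close> so small that the second does too.\<close>

lemma mean_trunc_rate_le:
  assumes e: "0 < e"
  shows "\<exists>R\<ge>0. \<exists>R'>R. 0 < tail R' \<and> (\<integral>y. trunc_rate R y \<partial>\<mu>) \<le> (\<integral>y. rate y \<partial>\<mu>) + e"
proof -
  define A where "A = (\<integral>y. (neg_log_tail y)\<^sup>2 \<partial>\<mu>) + 1"
  have "0 \<le> (\<integral>y. (neg_log_tail y)\<^sup>2 \<partial>\<mu>)" by simp
  then have A: "0 < A" by (simp only: A_def)
  define s where "s = e / (2 * A)"
  have s: "0 < s" using e A by (simp add: s_def)
  obtain R R' where R: "0 \<le> R" "R < R'" "0 < measure \<mu> {R'..}" "measure \<mu> {y. R < \<bar>y\<bar>} < s * e / 2"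
    using exhaust[of "s * e / 2"] e s by auto
  have [measurable]: "{y. R < \<bar>y\<bar>} \<in> sets borel" by measurable
  have iB: "integrable \<mu> (indicator {y. R < \<bar>y\<bar>} :: _ \<Rightarrow> real)"
    by (intro integrable_const_bound[where B=1]) (auto simp: indicator_def)
  have "(\<integral>y. trunc_rate R y \<partial>\<mu>) \<le> (\<integral>y. rate y + (s * (neg_log_tail y)\<^sup>2 + indicator {y. R < \<bar>y\<bar>} y / s) \<partial>\<mu>)"
  proof (intro integral_mono)
    show "integrable \<mu> (\<lambda>y. rate y + (s * (neg_log_tail y)\<^sup>2 + indicator {y. R < \<bar>y\<bar>} y / s))"
      using integrable_rate integrable_neg_log_tail_sq iB by simp
    fix y
    let ?L = "neg_log_tail y"
    have "0 \<le> s * (?L - 1 / s)\<^sup>2" using s by simp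
    also have "\<dots> = s * ?L\<^sup>2 - 2 * ?L + 1 / s" using s by (simp add: power2_eq_square field_simps)
    finally have "?L \<le> s * ?L\<^sup>2 + 1 / s" using neg_log_tail_nonneg[of y] by linarith
    then show "trunc_rate R y \<le> rate y + (s * ?L\<^sup>2 + indicator {y. R < \<bar>y\<bar>} y / s)"
      using rate_nonneg[of y] s by (auto simp: trunc_rate_def indicator_def)
  qed (rule integrable_trunc_rate)
  also have "\<dots> = (\<integral>y. rate y \<partial>\<mu>) + (s * (\<integral>y. (neg_log_tail y)\<^sup>2 \<partial>\<mu>) + measure \<mu> {y. R < \<bar>y\<bar>} / s)"
    using integrable_rate integrable_neg_log_tail_sq iB by simp
  also have "\<dots> \<le> (\<integral>y. rate y \<partial>\<mu>) + (s * A + e / 2)"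
  proof (intro add_mono order_refl mult_left_mono)
    show "measure \<mu> {y. R < \<bar>y\<bar>} / s \<le> e / 2" using R(4) s by (simp add: field_simps)
  qed (use s in \<open>auto simp: A_def\<close>)
  also have "s * A + e / 2 = e" using A by (simp add: s_def)
  finally show ?thesis using R by (auto simp: tail_def)
qed

text \<open>Intermediate values in \<open>t\<close>. For \<open>0 \<le> x\<close> the integral is
  \<open>- x\<close> at \<open>t = 0\<close>; at \<open>t = T\<close> it is nonnegative, since
  \<open>(y - R) * exp (T * (y - R))\<close> is at least \<open>(exp (T * (y - R)) - 1) / T\<close>,
  whose integral is nonnegative by hypothesis. Negative \<open>x\<close> follow by
  reflection.\<close>

lemma tilted_mean_eq:
  assumes T: "0 < T" "T < T'" "T' \<in> mg_dom" and R: "0 \<le> R" "1 \<le> (\<integral>y. exp (T * (y - R)) \<partial>\<mu>)"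
    and x: "\<bar>x\<bar> \<le> R"
  shows "\<exists>t. \<bar>t\<bar> \<le> T \<and> (\<integral>y. (y - x) * exp (t * y) \<partial>\<mu>) = 0"
proof -
  have y1: "\<bar>y\<bar> \<le> 1 + y ^ 4" for y :: real by sos
  have expT: "exp (t * y) \<le> exp (T * \<bar>y\<bar>)" if "\<bar>t\<bar> \<le> T" for t y
  proof -
    have "t * y \<le> \<bar>t\<bar> * \<bar>y\<bar>" by (metis abs_ge_self abs_mult)
    also have "\<dots> \<le> T * \<bar>y\<bar>" using that by (intro mult_right_mono) auto
    finally show ?thesis by simp
  qed
  have lin: "\<bar>y - z\<bar> \<le> (1 + \<bar>z\<bar>) * (1 + y ^ 4)" for y z :: real
  proof -
    have "\<bar>y - z\<bar> \<le> (1 + y ^ 4) + \<bar>z\<bar> * 1" using y1[of y] by linarith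
    also have "\<dots> \<le> (1 + y ^ 4) + \<bar>z\<bar> * (1 + y ^ 4)" by (intro add_mono mult_left_mono) auto
    finally show ?thesis by (simp add: algebra_simps)
  qed
  have int: "integrable \<mu> (\<lambda>y. (y - z) * exp (t * y))" if "\<bar>t\<bar> \<le> T" for t z
  proof (rule integrable_quartic_exp[OF T(3,2), where c="1 + \<bar>z\<bar>"])
    fix y :: real
    show "\<bar>(y - z) * exp (t * y)\<bar> \<le> (1 + \<bar>z\<bar>) * (1 + y ^ 4) * exp (T * \<bar>y\<bar>)"
      unfolding abs_mult abs_exp_cancel using lin[of y z] expT[OF that, of y] by (intro mult_mono) auto
  qed measurable
  have cont: "continuous_on {0..T} (\<lambda>t. \<integral>y. (y - z) * exp (t * y) \<partial>\<mu>)" for z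
    unfolding continuous_on_sequentially
  proof (intro ballI allI impI)
    fix s t assume t: "t \<in> {0..T}" "(\<forall>n. s n \<in> {0..T}) \<and> s \<longlonglongrightarrow> t"
    show "((\<lambda>t. \<integral>y. (y - z) * exp (t * y) \<partial>\<mu>) \<circ> s) \<longlonglongrightarrow> (\<integral>y. (y - z) * exp (t * y) \<partial>\<mu>)"
      unfolding comp_def
    proof (rule integral_dominated_convergence[where w="\<lambda>y. \<bar>y - z\<bar> * exp (T * \<bar>y\<bar>)"])
      show "integrable \<mu> (\<lambda>y. \<bar>y - z\<bar> * exp (T * \<bar>y\<bar>))"
        by (rule integrable_quartic_exp[OF T(3,2), where c="1 + \<bar>z\<bar>"])
          (use lin in \<open>auto simp: abs_mult intro!: mult_mono\<close>)
      show "AE y in \<mu>. (\<lambda>i. (y - z) * exp (s i * y)) \<longlonglongrightarrow> (y - z) * exp (t * y)"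
        using t by (intro always_eventually allI tendsto_intros) auto
      show "AE y in \<mu>. norm ((y - z) * exp (s i * y)) \<le> \<bar>y - z\<bar> * exp (T * \<bar>y\<bar>)" for i
        using expT[of "s i"] t by (intro always_eventually allI) (auto simp: abs_mult intro!: mult_left_mono)
    qed auto
  qed
  have pos: "\<exists>t\<in>{0..T}. (\<integral>y. (y - z) * exp (t * y) \<partial>\<mu>) = 0" if z: "0 \<le> z" "z \<le> R" for z
  proof -
    have i1: "integrable \<mu> (\<lambda>y. y)" using int[of 0 0] T by simp
    have "(\<integral>y. (y - z) * exp (0 * y) \<partial>\<mu>) \<le> 0"
      using i1 z by (simp add: mean_0)
    moreover have "0 \<le> (\<integral>y. (y - z) * exp (T * y) \<partial>\<mu>)"
    proof -
      have iR: "integrable \<mu> (\<lambda>y. exp (T * (y - R)))"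
      proof -
        have "integrable \<mu> (\<lambda>y. exp (T * y))"
        proof (rule integrable_quartic_exp[OF T(3,2), where c=1])
          fix y :: real
          have "1 * exp (T * y) \<le> (1 + y ^ 4) * exp (T * \<bar>y\<bar>)" using expT[of T y] T by (intro mult_mono) auto
          then show "\<bar>exp (T * y)\<bar> \<le> 1 * (1 + y ^ 4) * exp (T * \<bar>y\<bar>)" by simp
        qed measurable
        then have "integrable \<mu> (\<lambda>y. exp (- T * R) * exp (T * y))" by (rule integrable_mult_right)
        then show ?thesis by (simp add: mult_exp_exp algebra_simps)
      qed
      have "0 \<le> exp (T * R) * (\<integral>y. (exp (T * (y - R)) - 1) / T \<partial>\<mu>)"
        using R(2) T iR by simp
      also have "\<dots> = (\<integral>y. exp (T * R) * ((exp (T * (y - R)) - 1) / T) \<partial>\<mu>)" by simp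
      also have "\<dots> \<le> (\<integral>y. (y - z) * exp (T * y) \<partial>\<mu>)"
      proof (intro integral_mono int)
        show "integrable \<mu> (\<lambda>y. exp (T * R) * ((exp (T * (y - R)) - 1) / T))" using iR by simp
        fix y
        have "exp (T * (y - R)) * (1 - T * (y - R)) \<le> exp (T * (y - R)) * exp (- (T * (y - R)))"
          using exp_ge_add_one_self[of "- (T * (y - R))"] by (intro mult_left_mono) auto
        then have "exp (T * (y - R)) - 1 \<le> T * ((y - R) * exp (T * (y - R)))"
          by (simp add: mult_exp_exp algebra_simps)
        then have "(exp (T * (y - R)) - 1) / T \<le> (y - R) * exp (T * (y - R))"
          using T by (simp add: field_simps)
        also have "\<dots> \<le> (y - z) * exp (T * (y - R))" using z by (intro mult_right_mono) auto
        finally have "exp (T * R) * ((exp (T * (y - R)) - 1) / T) \<le> exp (T * R) * ((y - z) * exp (T * (y - R)))"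
          by (intro mult_left_mono) auto
        also have "\<dots> = (y - z) * (exp (T * R) * exp (T * (y - R)))" by simp
        also have "exp (T * R) * exp (T * (y - R)) = exp (T * y)" by (simp add: mult_exp_exp algebra_simps)
        finally show "exp (T * R) * ((exp (T * (y - R)) - 1) / T) \<le> (y - z) * exp (T * y)" .
      qed (use T in auto)
      finally show ?thesis .
    qed
    ultimately show ?thesis
      using IVT'[of "\<lambda>t. \<integral>y. (y - z) * exp (t * y) \<partial>\<mu>" 0 0 T] cont[of z] T by force
  qed
  show ?thesis
  proof (cases "0 \<le> x")
    case True
    then obtain t where "t \<in> {0..T}" "(\<integral>y. (y - x) * exp (t * y) \<partial>\<mu>) = 0"
      using pos[of x] x by auto
    then show ?thesis by (intro exI[of _ t]) auto
  next
    case False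
    then obtain t where t: "t \<in> {0..T}" "(\<integral>y. (y - (- x)) * exp (t * y) \<partial>\<mu>) = 0"
      using pos[of "- x"] x by auto
    have "(\<integral>y. (- y - (- x)) * exp (t * - y) \<partial>\<mu>) = (\<integral>y. (y - (- x)) * exp (t * y) \<partial>\<mu>)"
      by (rule integral_reflect(1)[where f="\<lambda>y. (y - (- x)) * exp (t * y)"]) measurable
    then have "(\<integral>y. - ((y - x) * exp (- t * y)) \<partial>\<mu>) = 0" using t(2) by (simp add: algebra_simps)
    then have "(\<integral>y. (y - x) * exp (- t * y) \<partial>\<mu>) = 0" by (simp only: integral_minus neg_equal_0_iff_equal)
    then show ?thesis using t(1) by (intro exI[of _ "- t"]) auto
  qed
qed

end

section \<open>Half-space depth of a typical point\<close>

context steep_symmetric_law begin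

text \<open>A change of measure in one coordinate. If \<open>\<bar>x\<bar> \<le> R\<close>, the density \<open>w\<close> is the exponential tilt with
  mean \<open>x\<close> and \<open>\<zeta> y = y - x\<close>; otherwise \<open>\<mu>\<close> is conditioned on the half-line on which
  \<open>\<theta> * (y - x)\<close> is nonnegative, and \<open>\<zeta> = 0\<close>.\<close>

definition tilts where
  "tilts K V T R x \<theta> w \<zeta> a t \<longleftrightarrow>
     w \<in> borel_measurable borel \<and> \<zeta> \<in> borel_measurable borel \<and> (\<forall>y. 0 \<le> w y) \<and>
     prob_space (density \<mu> (\<lambda>y. ennreal (w y))) \<and>
     integrable (density \<mu> (\<lambda>y. ennreal (w y))) (\<lambda>y. \<zeta> y ^ 4) \<and>
     (\<integral>y. \<zeta> y \<partial>density \<mu> (\<lambda>y. ennreal (w y))) = 0 \<and>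
     (\<integral>y. \<zeta> y ^ 4 \<partial>density \<mu> (\<lambda>y. ennreal (w y))) \<le> K * (\<integral>y. (\<zeta> y)\<^sup>2 \<partial>density \<mu> (\<lambda>y. ennreal (w y)))\<^sup>2 \<and>
     (\<integral>y. (\<zeta> y)\<^sup>2 \<partial>density \<mu> (\<lambda>y. ennreal (w y))) \<le> V \<and>
     \<bar>t\<bar> \<le> T \<and> (\<forall>y. w y \<le> exp (a + t * \<zeta> y)) \<and> a \<le> trunc_rate R x \<and>
     (\<forall>y::real. 0 < w y \<longrightarrow> \<theta> * \<zeta> y \<le> \<theta> * (y - x))"

lemma prob_space_density_real:
  assumes [measurable]: "w \<in> borel_measurable borel" and "\<And>y. 0 \<le> w y"
    and "integrable \<mu> w" "(\<integral>y. w y \<partial>\<mu>) = 1"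
  shows "prob_space (density \<mu> (\<lambda>y. ennreal (w y)))"
proof (rule prob_spaceI)
  have "emeasure (density \<mu> (\<lambda>y. ennreal (w y))) (space (density \<mu> (\<lambda>y. ennreal (w y)))) = (\<integral>\<^sup>+y. ennreal (w y) \<partial>\<mu>)"
    by (subst emeasure_density) auto
  also have "\<dots> = ennreal (\<integral>y. w y \<partial>\<mu>)" using assms by (intro nn_integral_eq_integral) auto
  finally show "emeasure (density \<mu> (\<lambda>y. ennreal (w y))) (space (density \<mu> (\<lambda>y. ennreal (w y)))) = 1"
    using assms by simp
qed

text \<open>Whatever the sign of \<open>\<theta>\<close>, the half-line \<open>H\<close> contains
  either \<open>{\<bar>x\<bar>..}\<close> or \<open>{..- \<bar>x\<bar>}\<close>, so its mass is at
  least \<open>tail \<bar>x\<bar>\<close>. The density is bounded by the constant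
  \<open>1 / measure \<mu> H\<close>, which gives \<open>t = 0\<close> and
  \<open>a = - ln (measure \<mu> H)\<close>; with \<open>\<zeta> = 0\<close> the moment conditions
  are trivial.\<close>

lemma halfline_tilts:
  assumes x: "0 < tail \<bar>x\<bar>" "R < \<bar>x\<bar>" and K: "0 \<le> V" "0 \<le> T"
  shows "\<exists>w \<zeta> a t. tilts K V T R x \<theta> w \<zeta> a t"
proof -
  define H where "H = {y. 0 \<le> \<theta> * (y - x)}"
  have H[measurable]: "H \<in> sets borel" unfolding H_def by measurable
  have "tail \<bar>x\<bar> \<le> measure \<mu> H"
  proof (cases "0 \<le> \<theta>")
    case True
    then show ?thesis
      unfolding tail_def by (intro finite_measure_mono) (auto simp: H_def sets_mu)
  next
    case False
    then have "measure \<mu> {..- \<bar>x\<bar>} \<le> measure \<mu> H"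
      by (intro finite_measure_mono) (auto simp: H_def sets_mu zero_le_mult_iff)
    then show ?thesis by (simp add: measure_le_neg)
  qed
  then have p: "0 < measure \<mu> H" "ln (tail \<bar>x\<bar>) \<le> ln (measure \<mu> H)" using x by auto
  define w where "w y = indicator H y / measure \<mu> H" for y
  have [measurable]: "w \<in> borel_measurable borel" unfolding w_def[abs_def] by measurable
  have iH: "integrable \<mu> (indicator H :: _ \<Rightarrow> real)"
    by (intro integrable_const_bound[where B=1]) (auto simp: indicator_def)
  have "integrable \<mu> w" "(\<integral>y. w y \<partial>\<mu>) = 1"
    using iH p by (simp_all add: w_def[abs_def])
  moreover have w0: "0 \<le> w y" for y by (simp add: w_def)
  ultimately have "prob_space (density \<mu> (\<lambda>y. ennreal (w y)))"
    by (intro prob_space_density_real) auto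
  moreover have "w y \<le> exp (- ln (measure \<mu> H))" for y
    using p by (simp add: w_def exp_minus inverse_eq_divide indicator_def)
  moreover have "- ln (measure \<mu> H) \<le> trunc_rate R x"
    using p x by (simp add: trunc_rate_def neg_log_tail_def)
  moreover have "0 \<le> \<theta> * (y - x)" if "0 < w y" for y
    by (rule ccontr) (use that in \<open>simp add: w_def H_def\<close>)
  ultimately have "tilts K V T R x \<theta> w (\<lambda>_. 0) (- ln (measure \<mu> H)) 0"
    unfolding tilts_def using w0 K by auto
  then show ?thesis by blast
qed

text \<open>The point is that \<open>K\<close>, \<open>V\<close>, \<open>T\<close> do not depend on
  \<open>x\<close> or \<open>\<theta>\<close>. For \<open>\<bar>x\<bar> \<le> R\<close> all tilts
  lie in \<open>[-T, T]\<close>, so the densities are squeezed between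
  \<open>exp (- T * \<bar>y\<bar>) / C\<close> and \<open>exp (T * \<bar>y\<bar>)\<close>; this
  bounds the fourth moment above by \<open>m4\<close> and the variance below by
  \<open>v / C\<close>.\<close>

lemma coordinate_tilts:
  assumes R: "0 \<le> R" "R < R'" "0 < tail R'"
  shows "\<exists>K\<ge>3. \<exists>V T. \<forall>x \<theta>. 0 < tail \<bar>x\<bar> \<longrightarrow> (\<exists>w \<zeta> a t. tilts K V T R x \<theta> w \<zeta> a t)"
proof -
  obtain T T' where T: "0 < T" "T < T'" "T' \<in> mg_dom" and T1: "1 \<le> (\<integral>y. exp (T * (y - R)) \<partial>\<mu>)"
    using steep[OF R(1,2)] R(3) by (auto simp: tail_def mg_dom_def)
  have expT: "exp (t * y) \<le> exp (T * \<bar>y\<bar>)" "exp (- T * \<bar>y\<bar>) \<le> exp (t * y)" if "\<bar>t\<bar> \<le> T" for t y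
  proof -
    have "\<bar>t * y\<bar> \<le> T * \<bar>y\<bar>" using that by (simp add: abs_mult mult_right_mono)
    then show "exp (t * y) \<le> exp (T * \<bar>y\<bar>)" "exp (- T * \<bar>y\<bar>) \<le> exp (t * y)" by auto
  qed
  define c where "c = 1 + 8 * (1 + R ^ 4)"
  have sq: "(p + q)\<^sup>2 \<le> 2 * (p\<^sup>2 + q\<^sup>2)" for p q :: real by sos
  have c4: "(\<bar>y\<bar> + R) ^ 4 \<le> (c - 1) * (1 + y ^ 4)" for y
  proof -
    have "(\<bar>y\<bar> + R) ^ 4 = ((\<bar>y\<bar> + R)\<^sup>2)\<^sup>2" by simp
    also have "\<dots> \<le> (2 * (\<bar>y\<bar>\<^sup>2 + R\<^sup>2))\<^sup>2" by (intro power_mono sq) auto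
    also have "\<dots> = 4 * (y\<^sup>2 + R\<^sup>2)\<^sup>2" by (simp only: power_mult_distrib power2_abs) simp
    also have "\<dots> \<le> 4 * (2 * ((y\<^sup>2)\<^sup>2 + (R\<^sup>2)\<^sup>2))" by (intro mult_left_mono sq) auto
    also have "\<dots> = 8 * (y ^ 4 + R ^ 4)" by simp
    also have "\<dots> \<le> (c - 1) * (1 + y ^ 4)" by (simp add: c_def algebra_simps)
    finally show ?thesis .
  qed
  have c2: "(\<bar>y\<bar> + R)\<^sup>2 \<le> c * (1 + y ^ 4)" for y
  proof -
    have "u\<^sup>2 \<le> 1 + u ^ 4" for u :: real by sos
    then have "(\<bar>y\<bar> + R)\<^sup>2 \<le> 1 + (\<bar>y\<bar> + R) ^ 4" .
    also have "\<dots> \<le> (1 + y ^ 4) + (c - 1) * (1 + y ^ 4)" by (intro add_mono c4) auto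
    finally show ?thesis by (simp add: algebra_simps)
  qed
  have c0: "1 \<le> c" using R(1) by (simp add: c_def)
  have c4': "(\<bar>y\<bar> + R) ^ 4 \<le> c * (1 + y ^ 4)" for y
    using c4[of y] by (smt (verit) c0 mult_right_mono zero_le_even_power even_numeral)
  define C where "C = (\<integral>y. exp (T * \<bar>y\<bar>) \<partial>\<mu>)"
  define m4 where "m4 = (\<integral>y. (\<bar>y\<bar> + R) ^ 4 * exp (T * \<bar>y\<bar>) \<partial>\<mu>)"
  define V where "V = (\<integral>y. (\<bar>y\<bar> + R)\<^sup>2 * exp (T * \<bar>y\<bar>) \<partial>\<mu>)"
  define v where "v = (\<integral>y. y\<^sup>2 * exp (- T * \<bar>y\<bar>) \<partial>\<mu>)"
  have iC: "integrable \<mu> (\<lambda>y. exp (T * \<bar>y\<bar>))" using integrable_exp_abs T by simp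
  have i4: "integrable \<mu> (\<lambda>y. (\<bar>y\<bar> + R) ^ 4 * exp (T * \<bar>y\<bar>))"
    by (rule integrable_quartic_exp[OF T(3,2), where c=c]) (auto simp: abs_mult c4' mult_right_mono)
  have i2: "integrable \<mu> (\<lambda>y. (\<bar>y\<bar> + R)\<^sup>2 * exp (T * \<bar>y\<bar>))"
    by (rule integrable_quartic_exp[OF T(3,2), where c=c]) (auto simp: abs_mult c2 mult_right_mono)
  \<comment> \<open>Three alternative dominating functions; \<open>bd\<close> turns a pointwise
    bound by any of them into integrability.\<close>
  define small where "small y z \<longleftrightarrow> z \<le> (\<bar>y\<bar> + R) ^ 4 * exp (T * \<bar>y\<bar>)
    \<or> z \<le> (\<bar>y\<bar> + R)\<^sup>2 * exp (T * \<bar>y\<bar>) \<or> z \<le> c * (1 + y ^ 4)" for y z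
  have bd: "integrable \<mu> f" if [measurable]: "f \<in> borel_measurable borel"
    and "\<And>y. small y \<bar>f y\<bar>" for f
  proof (rule integrable_quartic_exp[OF T(3,2), where c=c])
    fix y :: real
    have e: "1 \<le> exp (T * \<bar>y\<bar>)" using T by simp
    have "(\<bar>y\<bar> + R) ^ 4 * exp (T * \<bar>y\<bar>) \<le> c * (1 + y ^ 4) * exp (T * \<bar>y\<bar>)"
      "(\<bar>y\<bar> + R)\<^sup>2 * exp (T * \<bar>y\<bar>) \<le> c * (1 + y ^ 4) * exp (T * \<bar>y\<bar>)"
      using c4'[of y] c2[of y] by (auto intro!: mult_right_mono)
    moreover have "c * (1 + y ^ 4) * 1 \<le> c * (1 + y ^ 4) * exp (T * \<bar>y\<bar>)"
      using e c0 by (intro mult_left_mono) auto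
    ultimately show "\<bar>f y\<bar> \<le> c * (1 + y ^ 4) * exp (T * \<bar>y\<bar>)"
      using that(2)[of y] unfolding small_def by linarith
  qed fact
  have e1: "exp (- T * \<bar>y\<bar>) \<le> 1" for y using T by simp
  have y2c: "y\<^sup>2 \<le> c * (1 + y ^ 4)" "\<bar>y\<bar> \<le> c * (1 + y ^ 4)" for y
  proof -
    have "y\<^sup>2 \<le> 1 + y ^ 4" "\<bar>y\<bar> \<le> 1 + y ^ 4" by sos+
    moreover have "1 * (1 + y ^ 4) \<le> c * (1 + y ^ 4)" using c0 by (intro mult_right_mono) auto
    ultimately show "y\<^sup>2 \<le> c * (1 + y ^ 4)" "\<bar>y\<bar> \<le> c * (1 + y ^ 4)"
      by (simp_all only: mult_1)
  qed
  have iv2: "integrable \<mu> (\<lambda>y. y\<^sup>2 * exp (- T * \<bar>y\<bar>))"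
  proof (rule bd)
    fix y :: real
    have "y\<^sup>2 * exp (- T * \<bar>y\<bar>) \<le> y\<^sup>2 * 1" by (intro mult_left_mono e1) auto
    then show "small y \<bar>y\<^sup>2 * exp (- T * \<bar>y\<bar>)\<bar>"
      using y2c[of y] by (simp add: small_def abs_mult)
  qed measurable
  have iv1: "integrable \<mu> (\<lambda>y. y * exp (- T * \<bar>y\<bar>))"
  proof (rule bd)
    fix y :: real
    have "\<bar>y\<bar> * exp (- T * \<bar>y\<bar>) \<le> \<bar>y\<bar> * 1" by (intro mult_left_mono e1) auto
    then show "small y \<bar>y * exp (- T * \<bar>y\<bar>)\<bar>"
      using y2c[of y] by (simp add: small_def abs_mult)
  qed measurable
  have iv0: "integrable \<mu> (\<lambda>y. exp (- T * \<bar>y\<bar>))"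
    using T by (intro integrable_const_bound[where B=1]) auto
  have v: "0 < v"
  proof -
    have "v \<noteq> 0"
    proof
      assume "v = 0"
      then have "AE y in \<mu>. y\<^sup>2 * exp (- T * \<bar>y\<bar>) = 0"
        using integral_nonneg_eq_0_iff_AE[OF iv2] unfolding v_def by simp
      then have "AE y in \<mu>. y \<in> {0}" by eventually_elim simp
      then have "measure \<mu> {0} = 1" by (subst prob_eq_1) (auto simp: sets_mu)
      then show False using nondegenerate by simp
    qed
    moreover have "0 \<le> v" by (simp add: v_def)
    ultimately show ?thesis by simp
  qed
  have "1 = (\<integral>y. (1::real) \<partial>\<mu>)" by simp
  also have "\<dots> \<le> C" unfolding C_def using T by (intro integral_mono iC) auto
  finally have C: "1 \<le> C" .
  have m40: "0 \<le> m4" using R(1) by (simp add: m4_def)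
  have V0: "0 \<le> V" by (simp add: V_def)
  \<comment> \<open>Chosen so that \<open>m4 \<le> K * (v / C)^2\<close>; the 3 is what stability
    under independent sums demands.\<close>
  define K where "K = max 3 (m4 * C\<^sup>2 / v\<^sup>2)"
  have tilt: "\<exists>w \<zeta> a t. tilts K V T R x \<theta> w \<zeta> a t" if x: "0 < tail \<bar>x\<bar>" "\<bar>x\<bar> \<le> R" for x \<theta>
  proof -
    obtain t where t: "\<bar>t\<bar> \<le> T" and t0: "(\<integral>y. (y - x) * exp (t * y) \<partial>\<mu>) = 0"
      using tilted_mean_eq[OF T R(1) T1 x(2)] by blast
    have it: "integrable \<mu> (\<lambda>y. exp (t * y))"
      by (rule Bochner_Integration.integrable_bound[OF iC]) (use expT[OF t] in auto)
    then have td: "t \<in> mg_dom" by (simp add: mg_dom_def)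
    have i1: "integrable \<mu> (\<lambda>y. y)" by (rule bd) (use y2c in \<open>auto simp: small_def\<close>)
    \<comment> \<open>\<open>1 + u \<le> exp u\<close> and the vanishing mean give
      \<open>1 \<le> mg t\<close>, so dividing by \<open>mg t\<close> does not enlarge the
      density.\<close>
    have "1 = (\<integral>y. 1 + t * y \<partial>\<mu>)" using i1 by (simp add: mean_0)
    also have "\<dots> \<le> mg t" unfolding mg_def using i1 it
      by (intro integral_mono) (auto intro: exp_ge_add_one_self)
    finally have M1: "1 \<le> mg t" .
    have MC: "mg t \<le> C" unfolding mg_def C_def using expT[OF t] by (intro integral_mono it iC) auto
    define w where "w y = exp (t * y) / mg t" for y
    have [measurable]: "w \<in> borel_measurable borel" unfolding w_def[abs_def] by measurable
    have w0: "0 \<le> w y" for y using M1 by (simp add: w_def)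
    have wup: "w y \<le> exp (T * \<bar>y\<bar>)" for y
    proof -
      have "w y \<le> exp (t * y)" using M1 by (simp add: w_def divide_le_eq mult_le_cancel_left1)
      then show ?thesis using expT(1)[OF t, of y] by linarith
    qed
    have wlo: "exp (- T * \<bar>y\<bar>) / C \<le> w y" for y
      unfolding w_def using expT(2)[OF t, of y] M1 MC by (intro frac_le) auto
    have yx: "\<bar>y - x\<bar> \<le> \<bar>y\<bar> + R" for y using x(2) by linarith
    have k4: "w y * (y - x) ^ 4 \<le> (\<bar>y\<bar> + R) ^ 4 * exp (T * \<bar>y\<bar>)" for y
    proof -
      have "(y - x) ^ 4 = \<bar>y - x\<bar> ^ 4" by (simp add: power_even_abs)
      also have "\<dots> \<le> (\<bar>y\<bar> + R) ^ 4" using yx by (intro power_mono) auto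
      finally have "w y * (y - x) ^ 4 \<le> exp (T * \<bar>y\<bar>) * (\<bar>y\<bar> + R) ^ 4"
        using wup[of y] by (intro mult_mono) auto
      then show ?thesis by (simp add: mult.commute)
    qed
    have k2: "w y * (y - x)\<^sup>2 \<le> (\<bar>y\<bar> + R)\<^sup>2 * exp (T * \<bar>y\<bar>)" for y
    proof -
      have "(y - x)\<^sup>2 = \<bar>y - x\<bar>\<^sup>2" by simp
      also have "\<dots> \<le> (\<bar>y\<bar> + R)\<^sup>2" using yx by (intro power_mono) auto
      finally have "w y * (y - x)\<^sup>2 \<le> exp (T * \<bar>y\<bar>) * (\<bar>y\<bar> + R)\<^sup>2"
        using wup[of y] by (intro mult_mono) auto
      then show ?thesis by (simp add: mult.commute)
    qed
    have iw4: "integrable \<mu> (\<lambda>y. w y * (y - x) ^ 4)"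
      by (rule bd) (use k4 w0 in \<open>auto simp: small_def abs_mult power_even_abs\<close>)
    have iw2: "integrable \<mu> (\<lambda>y. w y * (y - x)\<^sup>2)"
      by (rule bd) (use k2 w0 in \<open>auto simp: small_def abs_mult\<close>)
    let ?\<nu> = "density \<mu> (\<lambda>y. ennreal (w y))"
    have dens: "(\<integral>y. f y \<partial>?\<nu>) = (\<integral>y. w y * f y \<partial>\<mu>)" "integrable ?\<nu> f \<longleftrightarrow> integrable \<mu> (\<lambda>y. w y * f y)"
      if "f \<in> borel_measurable borel" for f :: "real \<Rightarrow> real"
      using that w0 by (simp_all add: integral_real_density integrable_real_density)
    have "prob_space ?\<nu>"
    proof (rule prob_space_density_real)
      show "integrable \<mu> w" using it by (simp add: w_def[abs_def])
      show "(\<integral>y. w y \<partial>\<mu>) = 1" using M1 by (simp add: w_def mg_def)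
    qed (use w0 in auto)
    moreover have "integrable ?\<nu> (\<lambda>y. (y - x) ^ 4)" using iw4 by (simp add: dens)
    moreover have "(\<integral>y. y - x \<partial>?\<nu>) = 0"
    proof -
      have "(\<integral>y. y - x \<partial>?\<nu>) = (\<integral>y. ((y - x) * exp (t * y)) / mg t \<partial>\<mu>)"
        by (subst dens) (auto simp: w_def mult.commute)
      also have "\<dots> = 0" using t0 by simp
      finally show ?thesis .
    qed
    moreover have "(\<integral>y. (y - x) ^ 4 \<partial>?\<nu>) \<le> K * (\<integral>y. (y - x)\<^sup>2 \<partial>?\<nu>)\<^sup>2"
    proof -
      have "(\<integral>y. (y - x) ^ 4 \<partial>?\<nu>) \<le> m4"
        unfolding m4_def by (subst dens) (auto intro!: integral_mono iw4 i4 k4)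
      also have "\<dots> = (m4 * C\<^sup>2 / v\<^sup>2) * (v / C)\<^sup>2" using v C by (simp add: power_divide)
      also have "\<dots> \<le> K * (\<integral>y. (y - x)\<^sup>2 \<partial>?\<nu>)\<^sup>2"
      proof (intro mult_mono power_mono)
        \<comment> \<open>Against the even weight \<open>exp (- T * \<bar>y\<bar>)\<close> the cross
          term vanishes, so shifting the centre from 0 to \<open>x\<close> can only increase the
          second moment. This makes the lower bound on the variance uniform in
          \<open>x\<close>.\<close>
        have odd: "(\<integral>y. y * exp (- T * \<bar>y\<bar>) \<partial>\<mu>) = 0" by (rule integral_odd_eq_0) auto
        have eq: "(y - x)\<^sup>2 * exp (- T * \<bar>y\<bar>) = y\<^sup>2 * exp (- T * \<bar>y\<bar>) - 2 * x * (y * exp (- T * \<bar>y\<bar>)) + x\<^sup>2 * exp (- T * \<bar>y\<bar>)" for y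
          by (simp add: power2_diff algebra_simps)
        have ie: "integrable \<mu> (\<lambda>y. (y - x)\<^sup>2 * exp (- T * \<bar>y\<bar>))"
          unfolding eq using iv0 iv1 iv2 by (intro Bochner_Integration.integrable_add Bochner_Integration.integrable_diff integrable_mult_right)
        have "(\<integral>y. (y - x)\<^sup>2 * exp (- T * \<bar>y\<bar>) \<partial>\<mu>) = v - 2 * x * (\<integral>y. y * exp (- T * \<bar>y\<bar>) \<partial>\<mu>) + x\<^sup>2 * (\<integral>y. exp (- T * \<bar>y\<bar>) \<partial>\<mu>)"
          unfolding eq v_def using iv0 iv1 iv2
          by (subst Bochner_Integration.integral_add, auto)+
        also have "\<dots> \<ge> v" unfolding odd by simp
        finally have "v / C \<le> (\<integral>y. (y - x)\<^sup>2 * exp (- T * \<bar>y\<bar>) / C \<partial>\<mu>)"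
          using C by (simp add: divide_right_mono)
        also have "\<dots> \<le> (\<integral>y. w y * (y - x)\<^sup>2 \<partial>\<mu>)"
        proof (intro integral_mono iw2)
          show "integrable \<mu> (\<lambda>y. (y - x)\<^sup>2 * exp (- T * \<bar>y\<bar>) / C)" using ie by simp
          show "(y - x)\<^sup>2 * exp (- T * \<bar>y\<bar>) / C \<le> w y * (y - x)\<^sup>2" for y
            using mult_left_mono[OF wlo[of y], of "(y - x)\<^sup>2"] by (simp add: mult.commute)
        qed
        finally show "v / C \<le> (\<integral>y. (y - x)\<^sup>2 \<partial>?\<nu>)" by (simp add: dens)
      qed (use v C in \<open>auto simp: K_def\<close>)
      finally show ?thesis .
    qed
    moreover have "(\<integral>y. (y - x)\<^sup>2 \<partial>?\<nu>) \<le> V"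
      unfolding V_def by (subst dens) (auto intro!: integral_mono iw2 i2 k2)
    moreover have "w y \<le> exp ((t * x - ln (mg t)) + t * (y - x))" for y
    proof -
      have "w y = exp (t * y - ln (mg t))" using M1 by (simp add: w_def exp_diff)
      then show ?thesis by (simp add: algebra_simps)
    qed
    moreover have "t * x - ln (mg t) \<le> trunc_rate R x"
      using rate_ge[OF x(1) td] x(2) by (simp add: trunc_rate_def)
    ultimately have "tilts K V T R x \<theta> w (\<lambda>y. y - x) (t * x - ln (mg t)) t"
      unfolding tilts_def using w0 t by auto
    then show ?thesis by blast
  qed
  have "\<exists>w \<zeta> a t. tilts K V T R x \<theta> w \<zeta> a t" if "0 < tail \<bar>x\<bar>" for x \<theta>
    using tilt[OF that] halfline_tilts[OF that _ V0, of R T K \<theta>] T by (cases "\<bar>x\<bar> \<le> R") auto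
  moreover have "3 \<le> K" by (simp add: K_def)
  ultimately show ?thesis by blast
qed

end

section \<open>Exponential bounds for half-spaces and for coverage\<close>

context steep_symmetric_law begin

text \<open>Under the product \<open>?N\<close> of the coordinate tilts, \<open>Z\<close> is
  nonnegative with probability at least \<open>2 * c\<close>, and the log-density fluctuation
  \<open>S\<close> reaches \<open>e * n\<close> with probability at most \<open>c\<close>. On the
  remaining event, of probability at least \<open>c\<close>, the density is at most
  \<open>exp A\<close>, so the original measure of the half-space is at least
  \<open>c * exp (- A)\<close>.\<close>

lemma depth_lower_bound:
  assumes R: "0 \<le> R" "R < R'" "0 < tail R'" and e: "0 < e"
  shows "\<exists>c>0. \<exists>n0. \<forall>n\<ge>n0. \<forall>x \<theta>. (\<forall>i<n. 0 < tail \<bar>x i\<bar>) \<longrightarrow>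
    c * exp (- (\<Sum>i<n. trunc_rate R (x i)) - e * real n)
      \<le> measure (mu_n \<mu> n) {y\<in>space (mu_n \<mu> n). 0 \<le> (\<Sum>i<n. \<theta> i * (y i - x i))}"
proof -
  obtain K V T where K: "3 \<le> K"
    and ex: "\<And>x \<theta>. 0 < tail \<bar>x\<bar> \<Longrightarrow> \<exists>w \<zeta> a t. tilts K V T R x \<theta> w \<zeta> a t"
    using coordinate_tilts[OF R] by blast
  \<comment> \<open>Half of the \<open>1 / (24 * K^2)\<close> from the moment bound; the other half
    is given up to the fluctuation of the density.\<close>
  define c where "c = 1 / (48 * K\<^sup>2)"
  have c: "0 < c" "1 / (24 * K\<^sup>2) = 2 * c" using K by (auto simp: c_def)
  \<comment> \<open>From here on Chebyshev's bound \<open>T^2 * V / (e^2 * n)\<close> for the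
    fluctuation is at most \<open>c\<close>; the summand 1 ensures that \<open>n\<close> is
    positive.\<close>
  define n0 where "n0 = nat \<lceil>T\<^sup>2 * V / (e\<^sup>2 * c)\<rceil> + 1"
  have "c * exp (- (\<Sum>i<n. trunc_rate R (x i)) - e * real n)
      \<le> measure (mu_n \<mu> n) {y\<in>space (mu_n \<mu> n). 0 \<le> (\<Sum>i<n. \<theta> i * (y i - x i))}"
    if n: "n0 \<le> n" and x: "\<forall>i<n. 0 < tail \<bar>x i\<bar>" for n x \<theta>
  proof -
    have n1: "1 \<le> n" using n by (simp add: n0_def)
    \<comment> \<open>Indices from \<open>n\<close> on reuse coordinate 0, because
      \<open>PiM_density\<close> wants a probability density for every index, not only for those
      below \<open>n\<close>.\<close>
    define k where "k i = (if i < n then i else 0)" for i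
    have "\<forall>i. \<exists>w \<zeta> a t. tilts K V T R (x (k i)) (\<theta> (k i)) w \<zeta> a t"
      using n1 x by (intro allI ex) (auto simp: k_def)
    then obtain w \<zeta> a t where tl: "\<And>i. tilts K V T R (x (k i)) (\<theta> (k i)) (w i) (\<zeta> i) (a i) (t i)"
      by metis
    let ?D = "\<lambda>i. density \<mu> (\<lambda>y. ennreal (w i y))"
    have wm[measurable]: "w i \<in> borel_measurable borel" and zm[measurable]: "\<zeta> i \<in> borel_measurable borel"
      and w0: "0 \<le> w i y" and pD: "prob_space (?D i)"
      and z4: "integrable (?D i) (\<lambda>y. \<zeta> i y ^ 4)" and z1: "(\<integral>y. \<zeta> i y \<partial>?D i) = 0"
      and zK: "(\<integral>y. \<zeta> i y ^ 4 \<partial>?D i) \<le> K * (\<integral>y. (\<zeta> i y)\<^sup>2 \<partial>?D i)\<^sup>2"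
      and zV: "(\<integral>y. (\<zeta> i y)\<^sup>2 \<partial>?D i) \<le> V" and tT: "\<bar>t i\<bar> \<le> T"
      and we: "w i y \<le> exp (a i + t i * \<zeta> i y)" for i y
      using tl[of i] unfolding tilts_def by auto
    have al: "a i \<le> trunc_rate R (x i)" and th: "0 < w i y \<Longrightarrow> \<theta> i * \<zeta> i y \<le> \<theta> i * (y - x i)"
      if "i < n" for i y
      using tl[of i] that unfolding tilts_def k_def by auto
    let ?I = "{..<n}"
    let ?Q = "PiM ?I (\<lambda>_. \<mu>)"
    let ?N = "PiM ?I ?D"
    interpret Q: prob_space ?Q by (intro prob_space_PiM prob_space_axioms)
    interpret N: prob_space ?N by (intro prob_space_PiM pD)
    have NQ: "?N = density ?Q (\<lambda>y. \<Prod>i\<in>?I. ennreal (w i (y i)))"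
      by (intro PiM_density prob_space_axioms pD) auto
    have sN[measurable_cong]: "sets ?N = sets ?Q" by (simp add: NQ)
    have spN: "space ?N = space ?Q" by (simp add: NQ)
    have comp: "(\<lambda>y. f (y i)) \<in> borel_measurable ?Q" if "f \<in> borel_measurable borel" "i \<in> ?I"
      for f :: "real \<Rightarrow> 'b::topological_space" and i
      using measurable_compose[OF measurable_component_singleton[OF that(2), of "\<lambda>_. \<mu>"], of f borel] that(1)
      unfolding measurable_cong_sets[OF sets_mu refl] by blast
    have zD: "\<zeta> i \<in> borel_measurable (?D i)" for i by measurable
    define Z where "Z y = (\<Sum>i\<in>?I. \<theta> i * \<zeta> i (y i))" for y
    define S where "S y = (\<Sum>i\<in>?I. t i * \<zeta> i (y i))" for y
    have Zm[measurable]: "Z \<in> borel_measurable ?Q" unfolding Z_def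
      by (intro borel_measurable_sum borel_measurable_times borel_measurable_const comp zm)
    have Sm[measurable]: "S \<in> borel_measurable ?Q" unfolding S_def
      by (intro borel_measurable_sum borel_measurable_times borel_measurable_const comp zm)
    have z2: "integrable (?D i) (\<lambda>y. (\<zeta> i y)\<^sup>2)" for i
      using prob_space.integrable_power_le4[OF pD zD z4, of 2] by simp
    have mom: "integrable ?N (\<lambda>y. Z y ^ 4) \<and> N.expectation Z = 0 \<and>
        N.expectation (\<lambda>y. Z y ^ 4) \<le> K * (N.expectation (\<lambda>y. (Z y)\<^sup>2))\<^sup>2"
      unfolding Z_def
    proof (rule N.indep_vars_sum_fourth_moment)
      show "N.indep_vars (\<lambda>_. borel) (\<lambda>i y. \<theta> i * \<zeta> i (y i)) ?I"
        using indep_vars_PiM_coordinates[of ?I ?D "\<lambda>i y. \<theta> i * \<zeta> i y"] pD by simp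
      fix i assume i: "i \<in> ?I"
      have cm: "(\<integral>y. f (y i) \<partial>?N) = (\<integral>y. f y \<partial>?D i)" "integrable ?N (\<lambda>y. f (y i)) \<longleftrightarrow> integrable (?D i) f"
        if "f \<in> borel_measurable borel" for f :: "real \<Rightarrow> real"
        using PiM_component_integral[of ?I ?D i f] pD i that by auto
      show "integrable ?N (\<lambda>y. (\<theta> i * \<zeta> i (y i)) ^ 4)"
        using z4[of i] by (subst cm) (auto simp: power_mult_distrib)
      show "N.expectation (\<lambda>y. \<theta> i * \<zeta> i (y i)) = 0"
        using z1[of i] by (subst cm) auto
      have "N.expectation (\<lambda>y. (\<theta> i * \<zeta> i (y i)) ^ 4) = \<theta> i ^ 4 * (\<integral>y. \<zeta> i y ^ 4 \<partial>?D i)"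
        by (subst cm) (auto simp: power_mult_distrib)
      also have "\<dots> \<le> \<theta> i ^ 4 * (K * (\<integral>y. (\<zeta> i y)\<^sup>2 \<partial>?D i)\<^sup>2)"
        using zK[of i] by (intro mult_left_mono) auto
      also have "\<dots> = K * ((\<theta> i)\<^sup>2 * (\<integral>y. (\<zeta> i y)\<^sup>2 \<partial>?D i))\<^sup>2"
        by (simp add: power_mult_distrib)
      also have "(\<theta> i)\<^sup>2 * (\<integral>y. (\<zeta> i y)\<^sup>2 \<partial>?D i) = N.expectation (\<lambda>y. (\<theta> i * \<zeta> i (y i))\<^sup>2)"
        by (subst cm) (auto simp: power_mult_distrib)
      finally show "N.expectation (\<lambda>y. (\<theta> i * \<zeta> i (y i)) ^ 4) \<le> K * (N.expectation (\<lambda>y. (\<theta> i * \<zeta> i (y i))\<^sup>2))\<^sup>2" .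
    qed (use K in auto)
    have ZN: "2 * c \<le> N.prob {y\<in>space ?N. 0 \<le> Z y}"
      unfolding c(2)[symmetric] using mom K by (intro N.prob_nonneg_ge_of_moments) auto
    have "N.prob {y\<in>space ?N. e * real n \<le> \<bar>\<Sum>i\<in>?I. t i * \<zeta> i (y i) - (\<integral>y. t i * \<zeta> i y \<partial>?D i)\<bar>}
        \<le> real (card ?I) * (T\<^sup>2 * V) / (e * real n)\<^sup>2"
    proof (rule PiM_sum_deviation_le)
      fix i assume "i \<in> ?I"
      show "integrable (?D i) (\<lambda>y. (t i * \<zeta> i y)\<^sup>2)" using z2[of i] by (simp add: power_mult_distrib)
      have "(\<integral>y. (t i * \<zeta> i y)\<^sup>2 \<partial>?D i) = (t i)\<^sup>2 * (\<integral>y. (\<zeta> i y)\<^sup>2 \<partial>?D i)" by (simp add: power_mult_distrib)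
      also have "\<dots> \<le> T\<^sup>2 * V"
      proof (intro mult_mono zV)
        show "(t i)\<^sup>2 \<le> T\<^sup>2" using tT[of i] by (metis abs_ge_zero abs_le_square_iff abs_of_nonneg order_trans)
      qed auto
      finally show "(\<integral>y. (t i * \<zeta> i y)\<^sup>2 \<partial>?D i) \<le> T\<^sup>2 * V" .
    qed (use e n1 pD in auto)
    then have "N.prob {y\<in>space ?N. e * real n \<le> \<bar>S y\<bar>} \<le> real n * (T\<^sup>2 * V) / (e * real n)\<^sup>2"
      by (simp add: S_def z1)
    also have "\<dots> \<le> c"
    proof -
      have "T\<^sup>2 * V / (e\<^sup>2 * c) \<le> real n" using n unfolding n0_def by linarith
      then have "T\<^sup>2 * V \<le> real n * (e\<^sup>2 * c)" using e c by (simp add: field_simps)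
      then have "real n * (T\<^sup>2 * V) \<le> real n * (real n * (e\<^sup>2 * c))" by (intro mult_left_mono) auto
      then show ?thesis using e n1 by (simp add: power_mult_distrib divide_le_eq power2_eq_square mult_ac)
    qed
    finally have SN: "N.prob {y\<in>space ?N. e * real n \<le> \<bar>S y\<bar>} \<le> c" .
    define G where "G = {y\<in>space ?N. 0 \<le> Z y} - {y\<in>space ?N. e * real n \<le> \<bar>S y\<bar>}"
    have Gm[measurable]: "G \<in> sets ?Q" unfolding G_def spN by measurable
    have "c \<le> N.prob {y\<in>space ?N. 0 \<le> Z y} - N.prob {y\<in>space ?N. e * real n \<le> \<bar>S y\<bar>}"
      using ZN SN by simp
    also have "\<dots> \<le> N.prob G"
    proof -
      have "N.prob {y\<in>space ?N. 0 \<le> Z y} \<le> N.prob (G \<union> {y\<in>space ?N. e * real n \<le> \<bar>S y\<bar>})"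
        by (intro N.finite_measure_mono) (auto simp: G_def)
      also have "\<dots> \<le> N.prob G + N.prob {y\<in>space ?N. e * real n \<le> \<bar>S y\<bar>}"
        by (intro measure_Un_le) auto
      finally show ?thesis by simp
    qed
    finally have cG: "c \<le> N.prob G" .
    define E where "E = {y\<in>space ?Q. 0 \<le> (\<Sum>i<n. \<theta> i * (y i - x i))}"
    have Em[measurable]: "E \<in> sets ?Q"
    proof -
      have "(\<lambda>y. \<Sum>i<n. \<theta> i * (y i - x i)) \<in> borel_measurable ?Q"
        by (intro borel_measurable_sum borel_measurable_times borel_measurable_const borel_measurable_diff comp) auto
      then show ?thesis unfolding E_def by measurable
    qed
    define A where "A = (\<Sum>i<n. a i) + e * real n"
    have "ennreal c \<le> emeasure ?N G" using cG by (simp add: N.emeasure_eq_measure)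
    also have "\<dots> = (\<integral>\<^sup>+y. (\<Prod>i\<in>?I. ennreal (w i (y i))) * indicator G y \<partial>?Q)"
      unfolding NQ by (intro emeasure_density Gm borel_measurable_prod_ennreal comp) auto
    also have "\<dots> \<le> (\<integral>\<^sup>+y. ennreal (exp A) * indicator E y \<partial>?Q)"
    proof (intro nn_integral_mono)
      fix y assume y: "y \<in> space ?Q"
      have pr: "(\<Prod>i\<in>?I. ennreal (w i (y i))) = ennreal (\<Prod>i\<in>?I. w i (y i))"
        using w0 by (intro prod_ennreal) auto
      \<comment> \<open>Where some factor \<open>w i\<close> vanishes the left side is 0; elsewhere
        on \<open>G\<close> the last clause of \<open>tilts\<close> turns \<open>0 \<le> Z y\<close>
        into membership in the half-space \<open>E\<close>.\<close>
      show "(\<Prod>i\<in>?I. ennreal (w i (y i))) * indicator G y \<le> ennreal (exp A) * indicator E y"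
      proof (cases "y \<in> G \<and> (\<forall>i<n. 0 < w i (y i))")
        case True
        then have G: "0 \<le> Z y" "\<bar>S y\<bar> < e * real n" by (auto simp: G_def)
        have "Z y \<le> (\<Sum>i<n. \<theta> i * (y i - x i))"
          unfolding Z_def using True th by (intro sum_mono) auto
        then have "y \<in> E" using G y by (simp add: E_def)
        have "(\<Prod>i\<in>?I. w i (y i)) \<le> (\<Prod>i\<in>?I. exp (a i + t i * \<zeta> i (y i)))"
          using w0 we by (intro prod_mono) auto
        also have "\<dots> = exp ((\<Sum>i<n. a i) + S y)"
          by (simp add: S_def exp_sum[symmetric] sum.distrib)
        also have "\<dots> \<le> exp A" using G by (simp add: A_def)
        finally have "(\<Prod>i\<in>?I. w i (y i)) \<le> exp A" .
        with \<open>y \<in> E\<close> show ?thesis using pr True by (simp add: ennreal_leI)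
      next
        case False
        then consider "y \<notin> G" | i where "i < n" "\<not> 0 < w i (y i)" by auto
        then show ?thesis
        proof cases
          case 2
          then have "w i (y i) = 0" using w0[of i "y i"] by simp
          then have "(\<Prod>i\<in>?I. w i (y i)) = 0" using 2 by (intro prod_zero) auto
          then show ?thesis unfolding pr by (simp only: ennreal_0 mult_zero_left zero_le)
        qed simp
      qed
    qed
    also have "\<dots> = ennreal (exp A * Q.prob E)"
      by (simp add: nn_integral_cmult Q.emeasure_eq_measure ennreal_mult)
    finally have "c \<le> exp A * Q.prob E" by (simp add: ennreal_le_iff)
    then have "exp (- A) * c \<le> exp (- A) * (exp A * Q.prob E)" by (intro mult_left_mono) auto
    then have "c * exp (- A) \<le> Q.prob E" by (simp add: mult.assoc[symmetric] mult_exp_exp mult.commute)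
    moreover have "c * exp (- (\<Sum>i<n. trunc_rate R (x i)) - e * real n) \<le> c * exp (- A)"
      using c al by (intro mult_left_mono) (auto simp: A_def intro!: sum_mono)
    ultimately show ?thesis unfolding mu_n_def E_def by simp
  qed
  then show ?thesis using c(1) by blast
qed

text \<open>One half-space suffices: its normal has as coordinates parameters \<open>t i\<close>
  that attain the supremum for \<open>rate (x i)\<close> up to \<open>e\<close>. Chernoff bounds its
  mass, and the factor \<open>N\<close> is the union bound over the samples, one of which lies in it
  if \<open>x\<close> is covered.\<close>

lemma hull_prob_upper_bound:
  assumes x: "\<And>i. i < n \<Longrightarrow> 0 < tail \<bar>x i\<bar>" and e: "0 < e" and N: "0 < N"
  defines "Q \<equiv> PiM {..<N} (\<lambda>_. mu_n \<mu> n)"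
  shows "measure Q {X\<in>space Q. hull_sqdist n {..<N} x X = 0}
    \<le> real N * exp (- (\<Sum>i<n. rate (x i)) + e * real n)"
proof -
  let ?P = "mu_n \<mu> n"
  interpret P: prob_space ?P unfolding mu_n_def by (intro prob_space_PiM prob_space_axioms)
  interpret Q: prob_space Q unfolding Q_def by (intro prob_space_PiM P.prob_space_axioms)
  interpret PP: product_sigma_finite "\<lambda>_::nat. \<mu>" by standard
  have "\<forall>i. \<exists>t. i < n \<longrightarrow> t \<in> mg_dom \<and> rate (x i) - e \<le> t * x i - ln (mg t)"
    using rate_approx[OF x e] by blast
  then obtain t where t: "\<And>i. i < n \<Longrightarrow> t i \<in> mg_dom" "\<And>i. i < n \<Longrightarrow> rate (x i) - e \<le> t i * x i - ln (mg (t i))"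
    by metis
  define H where "H = {y\<in>space ?P. 0 \<le> (\<Sum>i<n. t i * (y i - x i))}"
  have coord: "(\<lambda>y. y i) \<in> borel_measurable ?P" if "i \<in> {..<n}" for i
    using measurable_component_singleton[OF that, of "\<lambda>_. \<mu>"]
    unfolding mu_n_def measurable_cong_sets[OF refl sets_mu] by simp
  have "(\<lambda>y. \<Sum>i<n. t i * (y i - x i)) \<in> borel_measurable ?P"
    by (intro borel_measurable_sum borel_measurable_times borel_measurable_const borel_measurable_diff coord) auto
  then have H[measurable]: "H \<in> sets ?P" unfolding H_def by measurable
  have PH: "P.prob H \<le> exp (- (\<Sum>i<n. rate (x i)) + e * real n)"
  proof -
    have "emeasure ?P H = (\<integral>\<^sup>+y. indicator H y \<partial>?P)" by simp
    also have "\<dots> \<le> (\<integral>\<^sup>+y. (\<Prod>i\<in>{..<n}. ennreal (exp (t i * (y i - x i)))) \<partial>?P)"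
    proof (intro nn_integral_mono)
      fix y
      have "indicator H y \<le> ennreal (exp (\<Sum>i<n. t i * (y i - x i)))"
        by (auto simp: indicator_def H_def)
      then show "indicator H y \<le> (\<Prod>i\<in>{..<n}. ennreal (exp (t i * (y i - x i))))"
        by (subst prod_ennreal) (auto simp: exp_sum)
    qed
    also have "\<dots> = (\<Prod>i\<in>{..<n}. \<integral>\<^sup>+y. ennreal (exp (t i * (y - x i))) \<partial>\<mu>)"
      unfolding mu_n_def by (intro PP.product_nn_integral_prod) auto
    also have "\<dots> = (\<Prod>i\<in>{..<n}. ennreal (exp (- (t i * x i - ln (mg (t i))))))"
    proof (intro prod.cong refl)
      fix i assume "i \<in> {..<n}"
      then have ti: "t i \<in> mg_dom" using t by simp
      have eq: "exp (t i * (y - x i)) = exp (- (t i * x i)) * exp (t i * y)" for y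
        by (simp add: mult_exp_exp algebra_simps)
      have "(\<integral>\<^sup>+y. ennreal (exp (t i * (y - x i))) \<partial>\<mu>) = ennreal (\<integral>y. exp (- (t i * x i)) * exp (t i * y) \<partial>\<mu>)"
        unfolding eq using ti by (intro nn_integral_eq_integral) (auto simp: mg_dom_def)
      also have "\<dots> = ennreal (exp (- (t i * x i)) * mg (t i))" by (simp add: mg_def)
      also have "exp (- (t i * x i)) * mg (t i) = exp (- (t i * x i)) * exp (ln (mg (t i)))" using mg_pos[OF ti] by simp
      also have "\<dots> = exp (- (t i * x i - ln (mg (t i))))" unfolding mult_exp_exp by simp
      finally show "(\<integral>\<^sup>+y. ennreal (exp (t i * (y - x i))) \<partial>\<mu>) = ennreal (exp (- (t i * x i - ln (mg (t i)))))" .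
    qed
    also have "\<dots> = ennreal (exp (\<Sum>i<n. - (t i * x i - ln (mg (t i)))))"
      by (subst prod_ennreal) (auto simp: exp_sum)
    finally have "P.prob H \<le> exp (\<Sum>i<n. - (t i * x i - ln (mg (t i))))"
      by (simp add: P.emeasure_eq_measure)
    also have "\<dots> \<le> exp (- (\<Sum>i<n. rate (x i)) + e * real n)"
    proof -
      have "(\<Sum>i<n. - (t i * x i - ln (mg (t i)))) \<le> (\<Sum>i<n. - rate (x i) + e)"
        using t(2) by (intro sum_mono) fastforce
      then show ?thesis by (simp add: sum_subtractf mult.commute)
    qed
    finally show ?thesis .
  qed
  define B where "B j = {X\<in>space Q. X j \<in> H}" for j
  have cj: "(\<lambda>X. X j) \<in> measurable Q ?P" if "j < N" for j
    unfolding Q_def using that by (intro measurable_component_singleton) auto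
  have B[measurable]: "B j \<in> sets Q" if "j < N" for j
    using measurable_sets[OF cj[OF that] H] by (simp add: B_def vimage_def Int_def conj_commute)
  have BH: "Q.prob (B j) = P.prob H" if "j < N" for j
  proof -
    have "distr Q ?P (\<lambda>X. X j) = ?P"
      unfolding Q_def using that by (intro distr_PiM_component P.prob_space_axioms) auto
    then have "P.prob H = measure (distr Q ?P (\<lambda>X. X j)) H" by simp
    also have "\<dots> = Q.prob (B j)"
      using cj[OF that] H by (subst measure_distr) (auto simp: B_def vimage_def Int_def conj_commute)
    finally show ?thesis by simp
  qed
  have "{X\<in>space Q. hull_sqdist n {..<N} x X = 0} \<subseteq> (\<Union>j\<in>{..<N}. B j)"
  proof
    fix X assume X: "X \<in> {X\<in>space Q. hull_sqdist n {..<N} x X = 0}"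
    have Xj: "X j \<in> space ?P" if "j < N" for j
      using measurable_space[OF cj[OF that]] X by auto
    obtain b where b: "b \<in> wsimplex {..<N}" "comb_sqdist n {..<N} x X b = 0"
      using hull_sqdist_attained[of "{..<N}" n x X] X N by (force simp: lessThan_empty_iff)
    then have bx: "(\<Sum>j<N. b j * X j i) = x i" if "i < n" for i
      using that by (auto simp: comb_sqdist_def sum_nonneg_eq_0_iff)
    have b': "\<And>j. j < N \<Longrightarrow> 0 \<le> b j" "(\<Sum>j<N. b j) = 1" using b(1) by (auto simp: wsimplex_def)
    \<comment> \<open>The weighted average of these sums is 0, because the weighted samples average
      to \<open>x\<close>; hence they cannot all be negative.\<close>
    have "\<exists>j<N. 0 \<le> (\<Sum>i<n. t i * (X j i - x i))"
    proof (rule ccontr)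
      assume "\<not> ?thesis"
      then have neg: "(\<Sum>i<n. t i * (X j i - x i)) < 0" if "j < N" for j using that by auto
      have "(\<Sum>j<N. b j * (\<Sum>i<n. t i * (X j i - x i))) = (\<Sum>j<N. \<Sum>i<n. t i * (b j * X j i - b j * x i))"
        by (simp add: sum_distrib_left algebra_simps)
      also have "\<dots> = (\<Sum>i<n. \<Sum>j<N. t i * (b j * X j i - b j * x i))" by (rule sum.swap)
      also have "\<dots> = (\<Sum>i<n. t i * ((\<Sum>j<N. b j * X j i) - (\<Sum>j<N. b j) * x i))"
        by (simp add: sum_distrib_left[symmetric] sum_subtractf sum_distrib_right)
      also have "\<dots> = 0" using bx b'(2) by simp
      finally have s0: "(\<Sum>j<N. - (b j * (\<Sum>i<n. t i * (X j i - x i)))) = 0" by (simp add: sum_negf)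
      have "\<forall>j\<in>{..<N}. - (b j * (\<Sum>i<n. t i * (X j i - x i))) = 0"
      proof (subst sum_nonneg_eq_0_iff[symmetric])
        fix j assume "j \<in> {..<N}"
        then show "0 \<le> - (b j * (\<Sum>i<n. t i * (X j i - x i)))"
          using b'(1)[of j] neg[of j] by (simp add: mult_nonneg_nonpos)
      qed (use s0 in auto)
      then have "\<forall>j\<in>{..<N}. b j = 0" using neg by fastforce
      then show False using b'(2) by simp
    qed
    then show "X \<in> (\<Union>j\<in>{..<N}. B j)" using X Xj by (auto simp: B_def H_def)
  qed
  then have "Q.prob {X\<in>space Q. hull_sqdist n {..<N} x X = 0} \<le> Q.prob (\<Union>j\<in>{..<N}. B j)"
    by (intro Q.finite_measure_mono) auto
  also have "\<dots> \<le> (\<Sum>j\<in>{..<N}. Q.prob (B j))"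
    by (intro Q.finite_measure_subadditive_finite) auto
  also have "\<dots> = real N * P.prob H" using BH by simp
  also have "\<dots> \<le> real N * exp (- (\<Sum>i<n. rate (x i)) + e * real n)" using PH by (intro mult_left_mono) auto
  finally show ?thesis .
qed

end

section \<open>Convergence of the thresholds\<close>

text \<open>Supplies the test sizes \<open>N > n\<close> at which a threshold on the wrong side of
  the limit is refuted.\<close>

lemma eventually_nat_between_exp:
  fixes a b :: real
  assumes "0 < a" "a < b"
  shows "\<forall>\<^sub>F n in sequentially. \<exists>N>n. exp (a * real n) \<le> real N \<and> real N \<le> exp (b * real n)"
proof -
  \<comment> \<open>The first summand makes the two exponentials differ by a factor 2, so that an
    integer fits between them; the second makes \<open>exp (a * n)\<close> exceed \<open>n\<close>,
    by way of \<open>(1 + a * n / 2)^2\<close>.\<close>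
  define m where "m = nat \<lceil>1 / (b - a)\<rceil> + nat \<lceil>4 / a\<^sup>2\<rceil>"
  have "\<exists>N>n. exp (a * real n) \<le> real N \<and> real N \<le> exp (b * real n)" if n: "m \<le> n" for n
  proof -
    have n1: "1 / (b - a) \<le> real n" and n2: "4 / a\<^sup>2 \<le> real n" using n unfolding m_def by linarith+
    have "1 \<le> (b - a) * real n" using n1 assms by (simp add: field_simps)
    then have "2 \<le> exp ((b - a) * real n)"
      using exp_ge_add_one_self[of "(b - a) * real n"] by linarith
    then have "exp (a * real n) * 2 \<le> exp (a * real n) * exp ((b - a) * real n)" by (intro mult_left_mono) auto
    also have "\<dots> = exp (b * real n)" by (simp add: mult_exp_exp algebra_simps)
    finally have ub: "exp (a * real n) * 2 \<le> exp (b * real n)" .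
    have "1 + a * real n / 2 \<le> exp (a * real n / 2)" by (rule exp_ge_add_one_self)
    then have "(1 + a * real n / 2)\<^sup>2 \<le> (exp (a * real n / 2))\<^sup>2" using assms by (intro power_mono) auto
    also have "\<dots> = exp (a * real n)" by (simp add: power2_eq_square mult_exp_exp)
    finally have e: "(1 + a * real n / 2)\<^sup>2 \<le> exp (a * real n)" .
    have "real n * 4 \<le> real n * (a\<^sup>2 * real n)" using n2 assms by (intro mult_left_mono) (auto simp: field_simps)
    moreover have "(1 + a * real n / 2)\<^sup>2 = 1 + a * real n + real n * (a\<^sup>2 * real n) / 4"
      by (simp add: power2_eq_square field_simps)
    moreover have "0 \<le> a * real n" using assms by simp
    ultimately have lt: "real n < exp (a * real n)" using e by linarith
    define N where "N = nat \<lceil>exp (a * real n)\<rceil>"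
    have N: "exp (a * real n) \<le> real N" "real N \<le> exp (a * real n) + 1"
      unfolding N_def using exp_gt_zero[of "a * real n"] by linarith+
    have "1 \<le> exp (a * real n)" using assms by simp
    then have "real N \<le> exp (b * real n)" using N ub by linarith
    then show ?thesis using N lt by (intro exI[of _ N]) auto
  qed
  then show ?thesis unfolding eventually_sequentially by blast
qed

lemma tendsto_ereal_of_bounds:
  fixes f :: "nat \<Rightarrow> ereal" and k :: real
  assumes k: "0 < k"
    and b: "\<And>e. 0 < e \<Longrightarrow> e < k \<Longrightarrow> \<forall>\<^sub>F n in sequentially. ereal (k - e) \<le> f n \<and> f n \<le> ereal (k + e)"
  shows "f \<longlonglongrightarrow> ereal k"
proof (rule order_tendstoI)
  fix a assume "a < ereal k"
  then obtain r where r: "a < ereal r" "r < k" using ereal_dense2[of a "ereal k"] by auto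
  define e where "e = min (k - r) (k / 2)"
  have "0 < e" "e < k" "r \<le> k - e" using r k by (auto simp: e_def)
  then show "\<forall>\<^sub>F n in sequentially. a < f n"
    using b[of e] r by (auto elim!: eventually_mono) (meson ereal_less_eq(3) order_less_le_trans)
next
  fix a assume "ereal k < a"
  then obtain r where r: "ereal r < a" "k < r" using ereal_dense2[of "ereal k" a] by auto
  define e where "e = min (r - k) (k / 2)"
  have "0 < e" "e < k" "k + e \<le> r" using r k by (auto simp: e_def)
  then show "\<forall>\<^sub>F n in sequentially. f n < a"
    using b[of e] r by (auto elim!: eventually_mono) (meson ereal_less_eq(3) order_le_less_trans)
qed

lemma tendsto_const_over_nat: "(\<lambda>n. C / real n) \<longlonglongrightarrow> 0"
  using tendsto_mult[OF tendsto_const lim_1_over_n, of C] by simp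

lemma tendsto_exp_neg_nat:
  assumes "0 < h"
  shows "(\<lambda>n. exp (- h * real n)) \<longlonglongrightarrow> 0" "(\<lambda>n. real n * exp (- h * real n)) \<longlonglongrightarrow> 0"
proof -
  have eq: "exp (- h * real n) = exp (- h) ^ n" for n by (simp add: exp_of_nat_mult[symmetric] mult.commute)
  show "(\<lambda>n. exp (- h * real n)) \<longlonglongrightarrow> 0" unfolding eq using assms by (intro LIMSEQ_power_zero) auto
  show "(\<lambda>n. real n * exp (- h * real n)) \<longlonglongrightarrow> 0" unfolding eq using assms powser_times_n_limit_0[of "exp (- h)"] by simp
qed

section \<open>Transition of the expected coverage at the mean rate\<close>

context steep_symmetric_law begin

abbreviation mean_rate :: real where "mean_rate \<equiv> \<integral>y. rate y \<partial>\<mu>"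

lemma AE_tail_pos_PiM: "AE x in mu_n \<mu> n. \<forall>i<n. 0 < tail \<bar>x i\<bar>"
proof -
  have "AE x in mu_n \<mu> n. 0 < tail \<bar>x i\<bar>" if "i < n" for i
    unfolding mu_n_def using that AE_tail_pos
    by (intro AE_PiM_component[where P="\<lambda>y. 0 < tail \<bar>y\<bar>"] prob_space_axioms) auto
  then have "AE x in mu_n \<mu> n. \<forall>i\<in>{..<n}. 0 < tail \<bar>x i\<bar>"
    by (intro AE_finite_allI) auto
  then show ?thesis by eventually_elim simp
qed

lemma mean_sum_deviation:
  fixes f :: "real \<Rightarrow> real"
  assumes [measurable]: "f \<in> borel_measurable borel" and f2: "integrable \<mu> (\<lambda>y. (f y)\<^sup>2)" and h: "0 < h" and n: "0 < n"
  shows "measure (mu_n \<mu> n) {x\<in>space (mu_n \<mu> n). h * real n \<le> \<bar>(\<Sum>i<n. f (x i)) - real n * (\<integral>y. f y \<partial>\<mu>)\<bar>}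
    \<le> ((\<integral>y. (f y)\<^sup>2 \<partial>\<mu>) / h\<^sup>2) / real n"
proof -
  have "measure (mu_n \<mu> n) {x\<in>space (mu_n \<mu> n). h * real n \<le> \<bar>\<Sum>i<n. f (x i) - (\<integral>y. f y \<partial>\<mu>)\<bar>}
    \<le> real (card {..<n}) * (\<integral>y. (f y)\<^sup>2 \<partial>\<mu>) / (h * real n)\<^sup>2"
    unfolding mu_n_def using f2 h n by (intro PiM_sum_deviation_le prob_space_axioms) auto
  then show ?thesis using n by (simp add: sum_subtractf power_mult_distrib power2_eq_square mult_ac)
qed

lemma exp_cover_eventually_small:
  assumes e: "0 < e" and d: "0 < d"
  shows "\<forall>\<^sub>F n in sequentially. \<forall>N>0. real N \<le> exp ((mean_rate - e) * real n) \<longrightarrow> exp_cover \<mu> n N \<le> d"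
proof -
  \<comment> \<open>One share of \<open>e\<close> for the deviation of the sum of rates, one for the
    slack in \<open>hull_prob_upper_bound\<close>, and one that survives as the decay
    \<open>exp (- h * n)\<close>.\<close>
  define h where "h = e / 3"
  have h: "0 < h" using e by (simp add: h_def)
  define V where "V = (\<integral>y. (rate y)\<^sup>2 \<partial>\<mu>) / h\<^sup>2"
  have "(\<lambda>n. V / real n + exp (- h * real n)) \<longlonglongrightarrow> 0 + 0"
    using h by (intro tendsto_add tendsto_const_over_nat tendsto_exp_neg_nat)
  then have "\<forall>\<^sub>F n in sequentially. V / real n + exp (- h * real n) < d"
    using d by (intro order_tendstoD) auto
  then show ?thesis
    using eventually_gt_at_top[of 0]
  proof eventually_elim
    case (elim n)
    show ?case
    proof (intro allI impI)
      fix N :: nat assume N: "0 < N" "real N \<le> exp ((mean_rate - e) * real n)"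
      let ?P = "mu_n \<mu> n"
      let ?Q = "PiM {..<N} (\<lambda>_. ?P)"
      interpret P: prob_space ?P unfolding mu_n_def by (intro prob_space_PiM prob_space_axioms)
      interpret Q: prob_space ?Q by (intro prob_space_PiM P.prob_space_axioms)
      define p where "p x = measure ?Q {X\<in>space ?Q. hull_sqdist n {..<N} x X = 0}" for x
      have pm[measurable]: "p \<in> borel_measurable ?P" and ec: "exp_cover \<mu> n N = (\<integral>x. p x \<partial>?P)"
        unfolding p_def[abs_def] using exp_cover_swap[OF prob_space_axioms sets_mu N(1), of n] by auto
      define B where "B = {x\<in>space ?P. h * real n \<le> \<bar>(\<Sum>i<n. rate (x i)) - real n * mean_rate\<bar>}"
      have "(\<lambda>x. rate (x i)) \<in> borel_measurable ?P" if "i \<in> {..<n}" for i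
        unfolding mu_n_def using that by (intro measurable_compose[OF measurable_component_singleton]) auto
      then have "(\<lambda>x. \<Sum>i<n. rate (x i)) \<in> borel_measurable ?P" by (intro borel_measurable_sum) auto
      then have B[measurable]: "B \<in> sets ?P" unfolding B_def by measurable
      have PB: "P.prob B \<le> V / real n"
        unfolding B_def V_def using h elim integrable_rate_sq by (intro mean_sum_deviation) auto
      have "exp_cover \<mu> n N \<le> (\<integral>x. indicator B x + exp (- h * real n) \<partial>?P)"
        unfolding ec
      proof (rule integral_mono_AE)
        show "integrable ?P p" by (intro P.integrable_const_bound[where B=1]) (auto simp: p_def)
        have "integrable ?P (indicator B :: _ \<Rightarrow> real)"
          by (intro P.integrable_const_bound[where B=1]) (auto simp: indicator_def)
        then show "integrable ?P (\<lambda>x. indicator B x + exp (- h * real n))" by simp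
        show "AE x in ?P. p x \<le> indicator B x + exp (- h * real n)"
          using AE_tail_pos_PiM[of n] AE_space
        proof eventually_elim
          case (elim x)
          show ?case
          proof (cases "x \<in> B")
            case True
            have "p x \<le> 1" by (simp add: p_def)
            then show ?thesis using True by (simp add: add_increasing2)
          next
            case False
            then have r: "real n * mean_rate - h * real n \<le> (\<Sum>i<n. rate (x i))" using elim by (simp add: B_def)
            have "p x \<le> real N * exp (- (\<Sum>i<n. rate (x i)) + h * real n)"
              unfolding p_def using elim N h by (intro hull_prob_upper_bound) auto
            also have "\<dots> \<le> exp ((mean_rate - e) * real n) * exp (- (real n * mean_rate - h * real n) + h * real n)"
              using N r by (intro mult_mono) auto
            also have "\<dots> = exp (- h * real n)" by (simp add: mult_exp_exp h_def algebra_simps)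
            finally show ?thesis using False by simp
          qed
        qed
      qed
      also have "\<dots> = P.prob B + exp (- h * real n)"
        by (subst Bochner_Integration.integral_add)
          (auto simp: P.prob_space intro!: P.integrable_const_bound[where B=1])
      finally show "exp_cover \<mu> n N \<le> d" using PB elim(1) by linarith
    qed
  qed
qed

lemma exp_cover_eventually_large:
  assumes e: "0 < e" and d: "0 < d"
  shows "\<forall>\<^sub>F n in sequentially. \<forall>N\<ge>2. exp ((mean_rate + e) * real n) \<le> real N \<longrightarrow> 1 - d \<le> exp_cover \<mu> n N"
proof -
  \<comment> \<open>One share of \<open>e\<close> for the truncation of the rate, one for the
    deviation of its sum, one for the loss in \<open>depth_lower_bound\<close>; the last one beats
    the factor \<open>n + 1\<close>.\<close>
  define h where "h = e / 4"
  have h: "0 < h" using e by (simp add: h_def)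
  obtain R R' where R: "0 \<le> R" "R < R'" "0 < tail R'" and mR: "(\<integral>y. trunc_rate R y \<partial>\<mu>) \<le> mean_rate + h"
    using mean_trunc_rate_le[OF h] by blast
  obtain c n0 where c: "0 < c" and depth: "\<And>n x \<theta>. n0 \<le> n \<Longrightarrow> (\<forall>i<n. 0 < tail \<bar>x i\<bar>) \<Longrightarrow>
      c * exp (- (\<Sum>i<n. trunc_rate R (x i)) - h * real n)
      \<le> measure (mu_n \<mu> n) {y\<in>space (mu_n \<mu> n). 0 \<le> (\<Sum>i<n. \<theta> i * (y i - x i))}"
    using depth_lower_bound[OF R h] by blast
  define V where "V = (\<integral>y. (trunc_rate R y)\<^sup>2 \<partial>\<mu>) / h\<^sup>2"
  define r where "r n = (real n * exp (- h * real n) + exp (- h * real n)) / c" for n :: nat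
  have "(\<lambda>n. V / real n + r n) \<longlonglongrightarrow> 0 + (0 + 0) / c"
    unfolding r_def using h c by (intro tendsto_add tendsto_divide tendsto_const tendsto_const_over_nat tendsto_exp_neg_nat) auto
  then have "\<forall>\<^sub>F n in sequentially. V / real n + r n < d"
    using d by (intro order_tendstoD) auto
  then show ?thesis
    using eventually_gt_at_top[of 0] eventually_ge_at_top[of n0]
  proof eventually_elim
    case (elim n)
    show ?case
    proof (intro allI impI)
      fix N :: nat assume N: "2 \<le> N" "exp ((mean_rate + e) * real n) \<le> real N"
      let ?P = "mu_n \<mu> n"
      let ?Q = "PiM {..<N} (\<lambda>_. ?P)"
      interpret P: prob_space ?P unfolding mu_n_def by (intro prob_space_PiM prob_space_axioms)
      interpret Q: prob_space ?Q by (intro prob_space_PiM P.prob_space_axioms)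
      define p where "p x = measure ?Q {X\<in>space ?Q. hull_sqdist n {..<N} x X = 0}" for x
      have "0 < N" using N by simp
      then have pm[measurable]: "p \<in> borel_measurable ?P" and ec: "exp_cover \<mu> n N = (\<integral>x. p x \<partial>?P)"
        unfolding p_def[abs_def] using exp_cover_swap[OF prob_space_axioms sets_mu, of N n] by auto
      have coord: "(\<lambda>y. y i) \<in> borel_measurable ?P" if "i < n" for i
        using measurable_component_singleton[of i "{..<n}" "\<lambda>_. \<mu>"] that
        unfolding mu_n_def measurable_cong_sets[OF refl sets_mu] by simp
      define B where "B = {x\<in>space ?P. h * real n \<le> \<bar>(\<Sum>i<n. trunc_rate R (x i)) - real n * (\<integral>y. trunc_rate R y \<partial>\<mu>)\<bar>}"
      have "(\<lambda>x. trunc_rate R (x i)) \<in> borel_measurable ?P" if "i \<in> {..<n}" for i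
        unfolding mu_n_def using that by (intro measurable_compose[OF measurable_component_singleton]) auto
      then have "(\<lambda>x. \<Sum>i<n. trunc_rate R (x i)) \<in> borel_measurable ?P" by (intro borel_measurable_sum) auto
      then have B[measurable]: "B \<in> sets ?P" unfolding B_def by measurable
      have PB: "P.prob B \<le> V / real n"
        unfolding B_def V_def using h elim integrable_trunc_rate_sq by (intro mean_sum_deviation) auto
      have iB: "integrable ?P (indicator B :: _ \<Rightarrow> real)"
        by (intro P.integrable_const_bound[where B=1]) (auto simp: indicator_def)
      have "1 - P.prob B - r n = (\<integral>x. 1 - r n - indicator B x \<partial>?P)"
        using iB by (simp add: P.prob_space)
      also have "\<dots> \<le> exp_cover \<mu> n N"
        unfolding ec
      proof (rule integral_mono_AE)
        show "integrable ?P p" by (intro P.integrable_const_bound[where B=1]) (auto simp: p_def)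
        show "integrable ?P (\<lambda>x. 1 - r n - indicator B x)" using iB by simp
        show "AE x in ?P. 1 - r n - indicator B x \<le> p x"
          using AE_tail_pos_PiM[of n] AE_space
        proof eventually_elim
          case (elim x)
          show ?case
          proof (cases "x \<in> B")
            case True
            have "0 \<le> r n" using c by (simp add: r_def)
            moreover have "0 \<le> p x" by (simp add: p_def)
            ultimately show ?thesis using True by simp
          next
            case False
            have mn: "real n * (\<integral>y. trunc_rate R y \<partial>\<mu>) \<le> real n * (mean_rate + h)"
              using mR by (intro mult_left_mono) auto
            have "(\<Sum>i<n. trunc_rate R (x i)) < real n * (\<integral>y. trunc_rate R y \<partial>\<mu>) + h * real n"
              using False elim by (simp add: B_def)
            then have s: "(\<Sum>i<n. trunc_rate R (x i)) \<le> real n * (mean_rate + h) + h * real n" using mn by linarith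
            define q where "q = c * exp (- (real n * (mean_rate + h) + h * real n) - h * real n)"
            have q: "0 < q" using c by (simp add: q_def)
            have dq: "q \<le> measure ?P {y\<in>space ?P. (\<Sum>i<n. \<theta> i * (y i - x i)) \<le> 0}" for \<theta>
            proof -
              have "q \<le> c * exp (- (\<Sum>i<n. trunc_rate R (x i)) - h * real n)"
                unfolding q_def using c s by (intro mult_left_mono) auto
              \<comment> \<open>The depth bound is applied to \<open>- \<theta>\<close>, as the
                half-space wanted here lies on the nonpositive side.\<close>
              also have "\<dots> \<le> measure ?P {y\<in>space ?P. 0 \<le> (\<Sum>i<n. - \<theta> i * (y i - x i))}"
                using elim \<open>n0 \<le> n\<close> by (intro depth) auto
              finally show ?thesis by (simp add: sum_negf)
            qed
            have miss: "measure ?Q {X\<in>space ?Q. 0 < hull_sqdist n {..<N} x X} \<le> (real n + 1) / (q * real N)"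
              by (rule prob_hull_misses_le[OF P.prob_space_axioms coord q N(1) dq])
            have "q * exp ((mean_rate + e) * real n) \<le> q * real N" using N q by (intro mult_left_mono) auto
            moreover have "q * exp ((mean_rate + e) * real n) = c * exp (h * real n)"
              by (simp add: q_def mult.assoc mult_exp_exp) (simp add: h_def algebra_simps)
            ultimately have "(real n + 1) / (q * real N) \<le> (real n + 1) / (c * exp (h * real n))"
              using c by (intro divide_left_mono mult_pos_pos) (auto intro: q \<open>0 < N\<close>)
            also have "\<dots> = r n" by (simp add: r_def exp_minus field_simps)
            finally have miss': "measure ?Q {X\<in>space ?Q. 0 < hull_sqdist n {..<N} x X} \<le> r n" using miss by linarith
            have ne: "{..<N} \<noteq> {}" using \<open>0 < N\<close> by (simp add: lessThan_empty_iff)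
            have hm[measurable]: "(\<lambda>X. hull_sqdist n {..<N} x X) \<in> borel_measurable ?Q"
            proof (rule hull_sqdist_measurable)
              fix i j assume "i < n" "j \<in> {..<N}"
              then show "(\<lambda>X. X j i) \<in> borel_measurable ?Q"
                by (intro measurable_compose[OF measurable_component_singleton[of j "{..<N}"] coord]) auto
            qed (use ne in auto)
            have "{X\<in>space ?Q. hull_sqdist n {..<N} x X = 0} = space ?Q - {X\<in>space ?Q. 0 < hull_sqdist n {..<N} x X}"
              using hull_sqdist_nonneg[OF _ ne, of n x] by (auto simp: less_le)
            then have "p x = 1 - measure ?Q {X\<in>space ?Q. 0 < hull_sqdist n {..<N} x X}"
              unfolding p_def by (subst Q.prob_compl[symmetric]) auto
            then show ?thesis using miss' False by simp
          qed
        qed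
      qed
      finally show "1 - d \<le> exp_cover \<mu> n N" using PB elim(1) by linarith
    qed
  qed
qed

text \<open>The value \<open>mean_rate - e\<close> is itself a competitor in the supremum. A
  competitor above \<open>mean_rate + e\<close> would admit some \<open>N\<close> between the
  exponentials with rates \<open>mean_rate + e / 2\<close> and \<open>mean_rate + e\<close>, where
  the coverage is at least \<open>1 - d\<close>; this exceeds \<open>d\<close> because
  \<open>d < 1/2\<close>.\<close>

lemma varrho1_tendsto:
  assumes d: "0 < d" "d < 1/2"
  shows "(\<lambda>n. varrho1 \<mu> n d) \<longlonglongrightarrow> ereal mean_rate"
proof (rule tendsto_ereal_of_bounds[OF mean_rate_pos])
  fix e :: real assume e: "0 < e" "e < mean_rate"
  have pos: "0 < mean_rate + e / 2" and lt: "mean_rate + e / 2 < mean_rate + e" using e by simp_all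
  have e2: "0 < e / 2" using e by simp
  show "\<forall>\<^sub>F n in sequentially. ereal (mean_rate - e) \<le> varrho1 \<mu> n d \<and> varrho1 \<mu> n d \<le> ereal (mean_rate + e)"
    using exp_cover_eventually_small[OF e(1) d(1)] exp_cover_eventually_large[OF e2 d(1)]
      eventually_nat_between_exp[OF pos lt] eventually_gt_at_top[of 0]
  proof eventually_elim
    case (elim n)
    have "(SUP N \<in> {N. n < N \<and> real N \<le> exp ((mean_rate - e) * real n)}. ereal (exp_cover \<mu> n N)) \<le> ereal d"
      using elim(1) by (intro SUP_least) auto
    then have "ereal (mean_rate - e) \<le> varrho1 \<mu> n d"
      unfolding varrho1_def by (intro Sup_upper) auto
    moreover have "varrho1 \<mu> n d \<le> ereal (mean_rate + e)"
      unfolding varrho1_def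
    proof (rule Sup_least, clarify)
      fix r assume r: "(SUP N \<in> {N. n < N \<and> real N \<le> exp (r * real n)}. ereal (exp_cover \<mu> n N)) \<le> ereal d"
      show "ereal r \<le> ereal (mean_rate + e)"
      proof (rule ccontr)
        assume "\<not> ereal r \<le> ereal (mean_rate + e)"
        then have rr: "mean_rate + e < r" by simp
        obtain N where N: "n < N" "exp ((mean_rate + e / 2) * real n) \<le> real N" "real N \<le> exp ((mean_rate + e) * real n)"
          using elim(3) e by auto
        have "exp ((mean_rate + e) * real n) \<le> exp (r * real n)" using rr by (simp add: mult_right_mono)
        then have "real N \<le> exp (r * real n)" using N by linarith
        then have "ereal (exp_cover \<mu> n N) \<le> ereal d"
          using N by (intro order_trans[OF SUP_upper r]) auto
        moreover have "1 - d \<le> exp_cover \<mu> n N" using elim N by auto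
        ultimately show False using d by simp
      qed
    qed
    ultimately show ?case ..
  qed
qed

lemma varrho2_tendsto:
  assumes d: "0 < d" "d < 1/2"
  shows "(\<lambda>n. varrho2 \<mu> n d) \<longlonglongrightarrow> ereal mean_rate"
proof (rule tendsto_ereal_of_bounds[OF mean_rate_pos])
  fix e :: real assume e: "0 < e" "e < mean_rate"
  have pos: "0 < mean_rate - e" and lt: "mean_rate - e < mean_rate - e / 2" using e by simp_all
  have e2: "0 < e / 2" using e by simp
  show "\<forall>\<^sub>F n in sequentially. ereal (mean_rate - e) \<le> varrho2 \<mu> n d \<and> varrho2 \<mu> n d \<le> ereal (mean_rate + e)"
    using exp_cover_eventually_small[OF e2 d(1)] exp_cover_eventually_large[OF e(1) d(1)]
      eventually_nat_between_exp[OF pos lt] eventually_gt_at_top[of 0]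
  proof eventually_elim
    case (elim n)
    have "(INF N \<in> {N. n < N \<and> exp ((mean_rate + e) * real n) \<le> real N}. ereal (exp_cover \<mu> n N)) \<ge> ereal (1 - d)"
      using elim(2,4) by (intro INF_greatest) auto
    then have "varrho2 \<mu> n d \<le> ereal (mean_rate + e)"
      unfolding varrho2_def by (intro Inf_lower) auto
    moreover have "ereal (mean_rate - e) \<le> varrho2 \<mu> n d"
      unfolding varrho2_def
    proof (rule Inf_greatest, clarify)
      fix r assume r: "(INF N \<in> {N. n < N \<and> exp (r * real n) \<le> real N}. ereal (exp_cover \<mu> n N)) \<ge> ereal (1 - d)"
      show "ereal (mean_rate - e) \<le> ereal r"
      proof (rule ccontr)
        assume "\<not> ereal (mean_rate - e) \<le> ereal r"
        then have rr: "r < mean_rate - e" by simp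
        obtain N where N: "n < N" "exp ((mean_rate - e) * real n) \<le> real N" "real N \<le> exp ((mean_rate - e / 2) * real n)"
          using elim(3) e by auto
        have "exp (r * real n) \<le> exp ((mean_rate - e) * real n)" using rr by (simp add: mult_right_mono)
        then have "exp (r * real n) \<le> real N" using N by linarith
        then have "ereal (1 - d) \<le> ereal (exp_cover \<mu> n N)"
          using N by (intro order_trans[OF r INF_lower]) auto
        moreover have "exp_cover \<mu> n N \<le> d" using elim N by auto
        ultimately show False using d by simp
      qed
    qed
    ultimately show ?case by blast
  qed
qed

end

section \<open>From admissibility to the steep locale\<close>

context symmetric_law begin

lemma mgf_finite_iff: "mgf \<mu> t < \<infinity> \<longleftrightarrow> t \<in> mg_dom"
  by (simp add: mgf_def mg_dom_def integrable_iff_bounded)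

lemma tail_0_ge_half: "1 / 2 \<le> tail 0"
proof -
  have "{0..} \<union> {..- 0} = (UNIV :: real set)" by auto
  then have "1 = measure \<mu> ({0..} \<union> {..- 0})" by simp
  also have "\<dots> \<le> measure \<mu> {0..} + measure \<mu> {..- 0}"
    by (intro measure_Un_le) (auto simp: sets_mu)
  also have "\<dots> = 2 * tail 0" unfolding measure_le_neg by (simp add: tail_def)
  finally show ?thesis by simp
qed

lemma measure_abs_ge_le: "measure \<mu> {y. x \<le> \<bar>y\<bar>} \<le> 2 * tail x"
proof -
  have "measure \<mu> {y. x \<le> \<bar>y\<bar>} \<le> measure \<mu> ({x..} \<union> {..- x})"
    by (intro finite_measure_mono) (auto simp: sets_mu)
  also have "\<dots> \<le> measure \<mu> {x..} + measure \<mu> {..- x}"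
    by (intro measure_Un_le) (auto simp: sets_mu)
  finally show ?thesis unfolding measure_le_neg by (simp add: tail_def)
qed

text \<open>Log-concavity speaks about compact sets only, so the half-lines are exhausted by
  intervals \<open>{x..x + k}\<close>. Convex combinations of points of two half-lines stay in the
  half-line of the combined endpoints.\<close>

lemma tail_log_concave:
  assumes lc: "log_concave_measure \<mu>" and l: "0 < l" "l < 1" and pos: "0 < tail a" "0 < tail b"
  shows "tail a powr l * tail b powr (1 - l) \<le> tail (l * a + (1 - l) * b)"
proof -
  have lim: "(\<lambda>k. measure \<mu> {x..x + real k}) \<longlonglongrightarrow> tail x" for x
  proof -
    have "(\<lambda>k. measure \<mu> {x..x + real k}) \<longlonglongrightarrow> measure \<mu> (\<Union>k. {x..x + real k})"
      by (intro finite_Lim_measure_incseq) (auto simp: incseq_def sets_mu)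
    also have "(\<Union>k. {x..x + real k}) = {x..}"
    proof (intro equalityI subsetI)
      fix y assume y: "y \<in> {x..}"
      obtain k :: nat where "y - x \<le> real k" using real_arch_simple by blast
      then have "y \<in> {x..x + real k}" using y by auto
      then show "y \<in> (\<Union>k. {x..x + real k})" by blast
    qed auto
    finally show ?thesis by (simp add: tail_def)
  qed
  have "(\<lambda>k. measure \<mu> {a..a + real k} powr l * measure \<mu> {b..b + real k} powr (1 - l))
      \<longlonglongrightarrow> tail a powr l * tail b powr (1 - l)"
    using pos by (intro tendsto_mult tendsto_powr lim tendsto_const) auto
  moreover have "measure \<mu> {a..a + real k} powr l * measure \<mu> {b..b + real k} powr (1 - l) \<le> tail (l * a + (1 - l) * b)" for k
  proof -
    have "measure \<mu> {a..a + real k} powr l * measure \<mu> {b..b + real k} powr (1 - l)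
        \<le> measure \<mu> {l * u + (1 - l) * v | u v. u \<in> {a..a + real k} \<and> v \<in> {b..b + real k}}"
      using lc l unfolding log_concave_measure_def by (meson compact_Icc)
    also have "\<dots> \<le> tail (l * a + (1 - l) * b)"
      unfolding tail_def using l
      by (intro finite_measure_mono) (auto simp: sets_mu intro!: add_mono mult_left_mono)
    finally show ?thesis .
  qed
  ultimately show ?thesis by (meson LIMSEQ_le_const2)
qed

lemma mg_dom_of_exponential_tail:
  assumes le: "\<And>b. x0 \<le> b \<Longrightarrow> tail b \<le> exp (- A * b)" and t: "0 \<le> t" "t < A"
  shows "t \<in> mg_dom"
proof -
  define f where "f k = exp (t * (real k + 1)) * measure \<mu> {y\<in>space \<mu>. real k \<le> \<bar>y\<bar>}" for k :: nat
  have "summable f"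
  proof (rule summable_comparison_test'[where N="nat \<lceil>x0\<rceil>"])
    show "summable (\<lambda>k. (2 * exp t) * exp (t - A) ^ k)"
      using t by (intro summable_mult summable_geometric) auto
    fix k assume "nat \<lceil>x0\<rceil> \<le> k"
    then have "x0 \<le> real k" by linarith
    then have "measure \<mu> {y\<in>space \<mu>. real k \<le> \<bar>y\<bar>} \<le> 2 * exp (- A * real k)"
      using measure_abs_ge_le[of "real k"] le[of "real k"] by simp
    then have "f k \<le> exp (t * (real k + 1)) * (2 * exp (- A * real k))"
      unfolding f_def by (intro mult_left_mono) auto
    also have "\<dots> = 2 * (exp (t * (real k + 1)) * exp (- A * real k))" by simp
    also have "exp (t * (real k + 1)) * exp (- A * real k) = exp t * exp (t - A) ^ k"
      by (simp add: exp_of_nat_mult[symmetric] mult_exp_exp algebra_simps)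
    finally show "norm (f k) \<le> (2 * exp t) * exp (t - A) ^ k" by (simp add: f_def)
  qed
  then have fin: "(\<Sum>k. ennreal (f k)) < \<infinity>"
    by (subst suminf_ennreal2) (auto simp: f_def)
  have "(\<integral>\<^sup>+y. ennreal (exp (t * \<bar>y\<bar>)) \<partial>\<mu>) \<le> (\<Sum>k. ennreal (exp (t * (real k + 1))) * emeasure \<mu> {y\<in>space \<mu>. real k \<le> \<bar>y\<bar>})"
    using t by (intro nn_integral_le_layer_sum[where g="\<lambda>u. exp (t * u)"]) (auto simp: mult_left_mono)
  also have "\<dots> = (\<Sum>k. ennreal (f k))"
    by (simp add: f_def emeasure_eq_measure ennreal_mult)
  finally have i: "(\<integral>\<^sup>+y. ennreal (exp (t * \<bar>y\<bar>)) \<partial>\<mu>) < \<infinity>" using fin by (rule order_le_less_trans)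
  have "mgf \<mu> t \<le> (\<integral>\<^sup>+y. ennreal (exp (t * \<bar>y\<bar>)) \<partial>\<mu>)"
    unfolding mgf_def using t by (intro nn_integral_mono ennreal_leI) (auto simp: mult_left_mono)
  then show ?thesis using i mgf_finite_iff order_le_less_trans by blast
qed

text \<open>Let \<open>A\<close> be the supremum and \<open>A < B\<close>. If the tail fell below
  \<open>exp (- B * x) / 2\<close> at one \<open>x > 0\<close>, log-concavity would propagate
  \<open>exp (- B * b)\<close> as a bound to all \<open>b\<close> beyond, and parameters larger than
  \<open>A\<close> would be in the domain. So the tail stays above, and
  \<open>exp (A * k) * tail k\<close> does not tend to 0, as dominated convergence would require if
  \<open>A\<close> were in the domain.\<close>

lemma log_concave_boundary:
  assumes lc: "log_concave_measure \<mu>" and bdd: "bdd_above mg_dom" and r: "r \<in> mg_dom" "0 < r"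
    and pos: "\<And>x. 0 < tail x"
  shows "Sup mg_dom \<notin> mg_dom"
proof
  define A where "A = Sup mg_dom"
  have A: "0 < A" using cSup_upper[OF r(1) bdd] r by (simp add: A_def)
  have lower: "exp (- B * x) / 2 \<le> tail x" if B: "A < B" and x: "0 < x" for B x
  proof (rule ccontr)
    assume neg: "\<not> exp (- B * x) / 2 \<le> tail x"
    have "tail b \<le> exp (- B * b)" if b: "x \<le> b" for b
    proof (cases "b = x")
      case True
      have "tail x < exp (- B * x) / 2" using neg by simp
      also have "\<dots> \<le> exp (- B * x)" by simp
      finally show ?thesis using True by simp
    next
      case False
      \<comment> \<open>This writes \<open>x\<close> as the convex combination of 0 and
        \<open>b\<close>. The factor \<open>1/2\<close> in \<open>lower\<close> matches
        \<open>tail 0 \<ge> 1/2\<close>, so it cancels in the comparison.\<close>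
      define l where "l = 1 - x / b"
      have b': "x < b" "0 < b" using b False x by auto
      have l: "0 < l" "l < 1" "(1 - l) * b = x" using b' x by (auto simp: l_def)
      have "(1/2) powr l * tail b powr (1 - l) \<le> tail 0 powr l * tail b powr (1 - l)"
        using l tail_0_ge_half by (intro mult_right_mono powr_mono2) auto
      also have "\<dots> \<le> tail (l * 0 + (1 - l) * b)"
        using l pos by (intro tail_log_concave lc) auto
      also have "\<dots> < exp (- B * x) / 2" using neg l by simp
      finally have "ln ((1/2) powr l * tail b powr (1 - l)) < ln (exp (- B * x) / 2)"
        using pos[of b] by (subst ln_less_cancel_iff) auto
      then have "- l * ln 2 + (1 - l) * ln (tail b) < - B * x - ln 2"
        using pos[of b] by (simp add: ln_mult ln_powr ln_div)
      then have "(1 - l) * (ln (tail b) + ln 2) < - B * ((1 - l) * b)"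
        unfolding l(3) by (simp add: algebra_simps)
      then have "(1 - l) * (ln (tail b) + ln 2) < (1 - l) * (- B * b)" by (simp add: algebra_simps)
      then have "ln (tail b) + ln 2 < - B * b" using l(2) by (subst (asm) mult_less_cancel_left_pos) auto
      moreover have "0 < ln (2::real)" by simp
      ultimately have "ln (tail b) < - B * b" by linarith
      then have "exp (ln (tail b)) < exp (- B * b)" by (simp only: exp_less_cancel_iff)
      then show ?thesis using pos[of b] by simp
    qed
    then have "(A + B) / 2 \<in> mg_dom" using A B by (intro mg_dom_of_exponential_tail[of x B]) auto
    then show False using cSup_upper[OF _ bdd, of "(A + B) / 2"] B by (simp add: A_def)
  qed
  assume "Sup mg_dom \<in> mg_dom"
  then have iA: "integrable \<mu> (\<lambda>y. exp (A * y))" by (simp add: A_def mg_dom_def)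
  have "(\<lambda>k. \<integral>y. exp (A * y) * indicator {real k..} y \<partial>\<mu>) \<longlonglongrightarrow> (\<integral>y. 0 \<partial>\<mu>)"
  proof (rule integral_dominated_convergence[where w="\<lambda>y. exp (A * y)"])
    show "AE y in \<mu>. (\<lambda>k. exp (A * y) * indicator {real k..} y) \<longlonglongrightarrow> 0"
    proof (rule always_eventually, intro allI tendsto_eventually)
      fix y
      obtain m :: nat where "y < real m" using reals_Archimedean2 by blast
      then show "\<forall>\<^sub>F k in sequentially. exp (A * y) * indicator {real k..} y = 0"
        unfolding eventually_sequentially by (intro exI[of _ m]) (auto simp: indicator_def)
    qed
    show "AE y in \<mu>. norm (exp (A * y) * indicator {real k..} y) \<le> exp (A * y)" for k
      by (intro always_eventually allI) (auto simp: indicator_def)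
  qed (use iA in auto)
  then have "\<forall>\<^sub>F k in sequentially. (\<integral>y. exp (A * y) * indicator {real k..} y \<partial>\<mu>) < exp (- 1) / 2"
    by (intro order_tendstoD) auto
  then obtain k where k: "1 \<le> k" "(\<integral>y. exp (A * y) * indicator {real k..} y \<partial>\<mu>) < exp (- 1) / 2"
    unfolding eventually_sequentially by (meson nle_le)
  \<comment> \<open>\<open>lower\<close> is used with \<open>B = A + 1 / k\<close> at
    \<open>x = k\<close>: the excess over \<open>A\<close> then costs only the fixed factor
    \<open>exp (- 1)\<close>.\<close>
  have "exp (- 1) / 2 = exp (A * real k) * (exp (- (A + 1 / real k) * real k) / 2)"
    using k by (simp add: mult_exp_exp algebra_simps)
  also have "\<dots> \<le> exp (A * real k) * tail (real k)"
    using k by (intro mult_left_mono lower) auto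
  also have "\<dots> = (\<integral>y. exp (A * real k) * indicator {real k..} y \<partial>\<mu>)" by (simp add: tail_def)
  also have "\<dots> \<le> (\<integral>y. exp (A * y) * indicator {real k..} y \<partial>\<mu>)"
  proof (intro integral_mono)
    show "integrable \<mu> (\<lambda>y. exp (A * real k) * indicator {real k..} y)"
      by (intro integrable_mult_right integrable_const_bound[where B=1]) (auto simp: indicator_def)
    show "integrable \<mu> (\<lambda>y. exp (A * y) * indicator {real k..} y)"
      by (rule Bochner_Integration.integrable_bound[OF iA]) (auto simp: indicator_def)
  qed (use A in \<open>auto simp: indicator_def mult_left_mono\<close>)
  finally show False using k by simp
qed

lemma exp_shift_eq_mg: "(\<integral>y. exp (T * (y - R)) \<partial>\<mu>) = exp (- T * R) * mg T"
proof -
  have "exp (T * (y - R)) = exp (- T * R) * exp (T * y)" for y by (simp add: mult_exp_exp algebra_simps)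
  then show ?thesis by (simp add: mg_def)
qed

text \<open>The mass beyond \<open>R'\<close> alone contributes
  \<open>exp (T * (R' - R)) * tail R'\<close>, which exceeds 1 for large \<open>T\<close>.\<close>

lemma steep_of_full_domain:
  assumes dom: "\<And>t. t \<in> mg_dom" and R: "R < R'" "0 < tail R'"
  shows "\<exists>T>0. \<exists>T'>T. integrable \<mu> (\<lambda>y. exp (T' * y)) \<and> 1 \<le> (\<integral>y. exp (T * (y - R)) \<partial>\<mu>)"
proof -
  define T where "T = max 1 (- ln (tail R') / (R' - R))"
  have T: "0 < T" "- ln (tail R') / (R' - R) \<le> T" by (auto simp: T_def)
  have "- ln (tail R') \<le> T * (R' - R)" using T R by (simp add: field_simps)
  then have "1 \<le> exp (T * (R' - R) + ln (tail R'))" by simp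
  also have "\<dots> = exp (T * (R' - R)) * tail R'" using R by (simp add: exp_add)
  also have "exp (T * (R' - R)) = exp (- T * R) * exp (T * R')" by (simp add: mult_exp_exp algebra_simps)
  finally have "1 \<le> exp (- T * R) * (exp (T * R') * tail R')" by (simp add: mult.assoc)
  also have "\<dots> \<le> exp (- T * R) * mg T"
    using T dom by (intro mult_left_mono exp_mult_tail_le_mg) auto
  finally have "1 \<le> (\<integral>y. exp (T * (y - R)) \<partial>\<mu>)" by (simp add: exp_shift_eq_mg)
  moreover have "integrable \<mu> (\<lambda>y. exp ((T + 1) * y))" using dom[of "T + 1"] by (simp add: mg_dom_def)
  ultimately show ?thesis using T by (intro exI[of _ T] conjI exI[of _ "T + 1"]) auto
qed

text \<open>Otherwise the shifted exponential moments stay below 1 for all positive parameters below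
  the supremum, and Fatou's lemma puts the supremum itself into the domain.\<close>

lemma steep_of_open_domain:
  assumes bdd: "bdd_above mg_dom" and r: "r \<in> mg_dom" "0 < r" and nA: "Sup mg_dom \<notin> mg_dom"
  shows "\<exists>T>0. \<exists>T'>T. integrable \<mu> (\<lambda>y. exp (T' * y)) \<and> 1 \<le> (\<integral>y. exp (T * (y - R)) \<partial>\<mu>)"
proof (rule ccontr)
  assume neg: "\<not> ?thesis"
  define A where "A = Sup mg_dom"
  have A: "0 < A" using cSup_upper[OF r(1) bdd] r by (simp add: A_def)
  have inner: "integrable \<mu> (\<lambda>y. exp (t * y))" if t: "0 \<le> t" "t < A" for t
  proof -
    obtain s where s: "s \<in> mg_dom" "t < s" using less_cSupD[of mg_dom t] t r(1) by (auto simp: A_def)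
    show ?thesis
      by (rule Bochner_Integration.integrable_bound[OF integrable_exp_abs[OF s(1), of t]])
        (use s t in \<open>auto simp: mult_left_mono\<close>)
  qed
  \<comment> \<open>A sequence increasing to \<open>A\<close>; the 2 keeps it positive from
    \<open>k = 0\<close> on.\<close>
  define T where "T k = A - A / (real k + 2)" for k :: nat
  have T: "0 < T k" "T k < A" for k
    using A by (auto simp: T_def field_simps intro!: add_pos_nonneg)
  have le1: "(\<integral>\<^sup>+y. ennreal (exp (T k * (y - R))) \<partial>\<mu>) \<le> 1" for k
  proof -
    have i: "integrable \<mu> (\<lambda>y. exp (T k * y))" using inner T by (simp add: less_imp_le)
    have "exp (T k * (y - R)) = exp (- T k * R) * exp (T k * y)" for y by (simp add: mult_exp_exp algebra_simps)
    then have i': "integrable \<mu> (\<lambda>y. exp (T k * (y - R)))" using i by simp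
    have T2: "T k < (T k + A) / 2" "0 \<le> (T k + A) / 2" "(T k + A) / 2 < A" using T[of k] A by auto
    then have "\<not> 1 \<le> (\<integral>y. exp (T k * (y - R)) \<partial>\<mu>)"
      using neg T(1)[of k] inner[OF T2(2,3)] by blast
    then have "(\<integral>y. exp (T k * (y - R)) \<partial>\<mu>) < 1" by simp
    then have "ennreal (\<integral>y. exp (T k * (y - R)) \<partial>\<mu>) \<le> 1" by (simp add: less_imp_le)
    then show ?thesis using nn_integral_eq_integral[OF i'] by simp
  qed
  have limT: "T \<longlonglongrightarrow> A"
  proof -
    have "(\<lambda>k. A - A / real k) \<longlonglongrightarrow> A - 0" by (intro tendsto_diff tendsto_const tendsto_const_over_nat)
    from LIMSEQ_ignore_initial_segment[OF this, of 2] show ?thesis by (simp add: T_def[abs_def] add.commute)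
  qed
  have "(\<integral>\<^sup>+y. ennreal (exp (A * (y - R))) \<partial>\<mu>) = (\<integral>\<^sup>+y. liminf (\<lambda>k. ennreal (exp (T k * (y - R)))) \<partial>\<mu>)"
  proof (intro nn_integral_cong)
    fix y
    have "(\<lambda>k. ennreal (exp (T k * (y - R)))) \<longlonglongrightarrow> ennreal (exp (A * (y - R)))"
      by (intro tendsto_ennrealI tendsto_intros limT)
    then show "ennreal (exp (A * (y - R))) = liminf (\<lambda>k. ennreal (exp (T k * (y - R))))"
      by (intro lim_imp_Liminf[symmetric]) auto
  qed
  also have "\<dots> \<le> liminf (\<lambda>k. \<integral>\<^sup>+y. ennreal (exp (T k * (y - R))) \<partial>\<mu>)"
    by (rule nn_integral_liminf) measurable
  also have "\<dots> \<le> liminf (\<lambda>k::nat. 1)" by (intro Liminf_mono always_eventually allI le1)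
  also have "\<dots> = 1" by (simp add: Liminf_const)
  finally have "(\<integral>\<^sup>+y. ennreal (exp (A * (y - R))) \<partial>\<mu>) \<le> 1" .
  then have "integrable \<mu> (\<lambda>y. exp (A * (y - R)))"
    by (intro integrableI_nonneg) (auto intro: le_less_trans)
  then have "integrable \<mu> (\<lambda>y. exp (A * R) * exp (A * (y - R)))" by (rule integrable_mult_right)
  then have "integrable \<mu> (\<lambda>y. exp (A * y))" by (simp add: mult_exp_exp algebra_simps)
  then show False using nA by (simp add: mg_dom_def A_def)
qed

end

text \<open>With bounded support or an everywhere finite \<open>mgf\<close>, the domain of
  exponential moments is the whole line; in the log-concave case it is bounded without containing
  its supremum. The absence of an atom at a finite \<open>x_star\<close> is what lets intervals
  strictly inside the support exhaust the mass.\<close>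

lemma admissible_steep_symmetric_law:
  assumes "borel_prob \<mu>" "even_measure \<mu>" and adm: "admissible \<mu>"
  shows "steep_symmetric_law \<mu>"
proof -
  interpret symmetric_law \<mu>
    using assms by (auto simp: borel_prob_def symmetric_law_def symmetric_law_axioms_def)
  obtain r0 where r0: "0 < r0" "\<And>t. - r0 < t \<Longrightarrow> t < r0 \<Longrightarrow> mgf \<mu> t < \<infinity>"
    using adm by (auto simp: admissible_def)
  define r where "r = r0 / 2"
  have "mgf \<mu> r < \<infinity>" using r0 by (intro r0(2)) (auto simp: r_def)
  then have r: "0 < r" "r \<in> mg_dom" using r0(1) mgf_finite_iff[of r] by (simp_all add: r_def)
  have nondeg: "measure \<mu> {0} < 1"
  proof (rule ccontr)
    assume "\<not> measure \<mu> {0} < 1"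
    then have "measure \<mu> {0} = 1" using prob_le_1[of "{0}"] by linarith
    then have ae: "AE y in \<mu>. y = 0" using prob_eq_1[of "{0}"] by (simp add: sets_mu)
    have "(\<integral>y. y \<partial>\<mu>) = (\<integral>y. 0 \<partial>\<mu>)" using ae by (intro integral_cong_AE) auto
    then have "(\<integral>x. (x - (\<integral>y. y \<partial>\<mu>))\<^sup>2 \<partial>\<mu>) = (\<integral>x. 0 \<partial>\<mu>)"
      using ae by (intro integral_cong_AE) auto
    then show False using adm by (simp add: admissible_def)
  qed
  have between: "\<exists>R'>R. 0 < tail R'" if "ereal R < x_star \<mu>" for R
    using that unfolding x_star_def less_Sup_iff by (auto simp: tail_def)
  have x_star_ge: "ereal x \<le> x_star \<mu>" if "0 < tail x" for x
    using that unfolding x_star_def by (intro Sup_upper) (auto simp: tail_def)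
  \<comment> \<open>Since \<open>x_star\<close> is a supremum, tails are known to vanish only
    strictly beyond it; continuity from below transfers this to the open half-line.\<close>
  have tail_lim: "(\<lambda>k. tail (s + 1 / real (Suc k))) \<longlonglongrightarrow> measure \<mu> {s<..}" for s
  proof -
    have "(\<lambda>k. measure \<mu> {s + 1 / real (Suc k)..}) \<longlonglongrightarrow> measure \<mu> (\<Union>k. {s + 1 / real (Suc k)..})"
    proof (intro finite_Lim_measure_incseq)
      show "incseq (\<lambda>k. {s + 1 / real (Suc k)..})"
        by (intro incseq_SucI) (auto simp: field_simps elim!: order_trans[rotated])
    qed (auto simp: sets_mu)
    also have "(\<Union>k. {s + 1 / real (Suc k)..}) = {s<..}"
    proof (intro equalityI subsetI)
      fix y assume "y \<in> {s<..}"
      then obtain k where "1 / real (Suc k) < y - s" using reals_Archimedean[of "y - s"] by (auto simp: inverse_eq_divide)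
      then have "y \<in> {s + 1 / real (Suc k)..}" by simp
      then show "y \<in> (\<Union>k. {s + 1 / real (Suc k)..})" by blast
    next
      fix y assume "y \<in> (\<Union>k. {s + 1 / real (Suc k)..})"
      then obtain k where "s + 1 / real (Suc k) \<le> y" by auto
      moreover have "0 < 1 / real (Suc k)" by simp
      ultimately have "s < y" by linarith
      then show "y \<in> {s<..}" by simp
    qed
    finally show ?thesis by (simp add: tail_def)
  qed
  \<comment> \<open>Otherwise no mass lies to the right of 0, by evenness none to the left, and the
    law is concentrated at 0.\<close>
  have star_pos: "0 < x_star \<mu>"
  proof (rule ccontr)
    assume "\<not> 0 < x_star \<mu>"
    then have z: "tail x = 0" if "0 < x" for x
      using x_star_ge[of x] that tail_nonneg[of x]
      by (metis ereal_less(2) less_le not_less order_le_less_trans)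
    have "(\<lambda>k. tail (0 + 1 / real (Suc k))) \<longlonglongrightarrow> 0" using z by simp
    then have p0: "measure \<mu> {0<..} = 0" using tail_lim[of 0] LIMSEQ_unique by blast
    have n0: "measure \<mu> {..<0} = 0"
    proof -
      have "{y. - y \<in> {0<..}} = {..<0::real}" by auto
      then show ?thesis using measure_reflect[of "{0<..}"] p0 by simp
    qed
    have "1 = measure \<mu> ({0} \<union> ({0<..} \<union> {..<0}))"
    proof -
      have "{0} \<union> ({0<..} \<union> {..<0::real}) = UNIV" by auto
      then show ?thesis by simp
    qed
    also have "\<dots> \<le> measure \<mu> {0} + measure \<mu> ({0<..} \<union> {..<0})" by (intro measure_Un_le) (auto simp: sets_mu)
    also have "\<dots> \<le> measure \<mu> {0} + (measure \<mu> {0<..} + measure \<mu> {..<0})"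
      by (intro add_left_mono measure_Un_le) (auto simp: sets_mu)
    finally show False using nondeg p0 n0 by simp
  qed
  have bounded: "measure \<mu> {y. s \<le> \<bar>y\<bar>} = 0" if s: "x_star \<mu> = ereal s" for s
  proof -
    have "tail x = 0" if "s < x" for x
      using x_star_ge[of x] that tail_nonneg[of x] s by force
    then have "(\<lambda>k. tail (s + 1 / real (Suc k))) = (\<lambda>k. 0)" by (intro ext) auto
    then have "measure \<mu> {s<..} = 0" using tail_lim[of s] LIMSEQ_unique[OF _ tendsto_const] by fastforce
    moreover have "measure \<mu> {s} = 0" using adm s by (simp add: admissible_def)
    moreover have "tail s \<le> measure \<mu> {s} + measure \<mu> {s<..}"
    proof -
      have "{s..} = {s} \<union> {s<..}" by auto
      then show ?thesis unfolding tail_def using measure_Un_le[of "{s}" \<mu> "{s<..}"] by (simp add: sets_mu)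
    qed
    ultimately have "tail s = 0" using tail_nonneg[of s] by linarith
    then show ?thesis using measure_abs_ge_le[of s] measure_nonneg[of \<mu> "{y. s \<le> \<bar>y\<bar>}"] by linarith
  qed
  have exhaust: "\<exists>R\<ge>0. \<exists>R'>R. 0 < measure \<mu> {R'..} \<and> measure \<mu> {y. R < \<bar>y\<bar>} < e" if e: "0 < e" for e
  proof -
    have "\<exists>R\<ge>0. ereal R < x_star \<mu> \<and> measure \<mu> {y. R < \<bar>y\<bar>} < e"
    proof (cases "x_star \<mu> = \<infinity>")
      case True
      have "(\<lambda>k. measure \<mu> {y. real k < \<bar>y\<bar>}) \<longlonglongrightarrow> measure \<mu> (\<Inter>k. {y. real k < \<bar>y\<bar>})"
        by (intro finite_Lim_measure_decseq) (auto simp: decseq_def sets_mu)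
      also have "(\<Inter>k. {y. real k < \<bar>y\<bar>}) = {}"
      proof -
        have "\<exists>k. \<not> real k < \<bar>y\<bar>" for y :: real
          using real_arch_simple[of "\<bar>y\<bar>"] by (auto simp: not_less)
        then show ?thesis by blast
      qed
      finally have "\<forall>\<^sub>F k in sequentially. measure \<mu> {y. real k < \<bar>y\<bar>} < e"
        using e by (intro order_tendstoD) auto
      then obtain k :: nat where "measure \<mu> {y. real k < \<bar>y\<bar>} < e"
        by (auto simp: eventually_sequentially)
      then show ?thesis using True by (intro exI[of _ "real k"]) auto
    next
      case False
      then obtain s where s: "x_star \<mu> = ereal s" "0 < s"
        using star_pos by (cases "x_star \<mu>") auto
      \<comment> \<open>Starts at 0 and increases to \<open>s\<close> without reaching it, so each
        \<open>R k\<close> is strictly inside the support and the remaining mass tends to that of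
        \<open>{y. s \<le> \<bar>y\<bar>}\<close>, which is 0.\<close>
      define R where "R k = s - s / (real k + 1)" for k :: nat
      have R: "0 \<le> R k" "R k < s" for k using s by (auto simp: R_def field_simps)
      have "(\<lambda>k. measure \<mu> {y. R k < \<bar>y\<bar>}) \<longlonglongrightarrow> measure \<mu> (\<Inter>k. {y. R k < \<bar>y\<bar>})"
      proof (intro finite_Lim_measure_decseq)
        have "R k \<le> R l" if "k \<le> l" for k l
          unfolding R_def using s that by (intro diff_left_mono divide_left_mono) auto
        then show "decseq (\<lambda>k. {y. R k < \<bar>y\<bar>})" unfolding decseq_def by force
      qed (auto simp: sets_mu)
      also have "measure \<mu> (\<Inter>k. {y. R k < \<bar>y\<bar>}) = 0"
      proof -
        have "(\<Inter>k. {y. R k < \<bar>y\<bar>}) \<subseteq> {y. s \<le> \<bar>y\<bar>}"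
        proof
          fix y assume y: "y \<in> (\<Inter>k. {y. R k < \<bar>y\<bar>})"
          have lim: "(\<lambda>k. s - s / real k) \<longlonglongrightarrow> s - 0" by (intro tendsto_diff tendsto_const tendsto_const_over_nat)
          have "R \<longlonglongrightarrow> s" using LIMSEQ_ignore_initial_segment[OF lim, of 1] by (simp add: R_def[abs_def] add.commute)
          moreover have "R k \<le> \<bar>y\<bar>" for k using y by (auto intro: less_imp_le)
          ultimately have "s \<le> \<bar>y\<bar>" by (meson LIMSEQ_le_const2)
          then show "y \<in> {y. s \<le> \<bar>y\<bar>}" by simp
        qed
        then have "measure \<mu> (\<Inter>k. {y. R k < \<bar>y\<bar>}) \<le> measure \<mu> {y. s \<le> \<bar>y\<bar>}"
          by (intro finite_measure_mono) (auto simp: sets_mu)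
        then show ?thesis using bounded[OF s(1)] by (simp add: measure_le_0_iff)
      qed
      finally have "\<forall>\<^sub>F k in sequentially. measure \<mu> {y. R k < \<bar>y\<bar>} < e"
        using e by (intro order_tendstoD) auto
      then obtain k :: nat where "measure \<mu> {y. R k < \<bar>y\<bar>} < e"
        by (auto simp: eventually_sequentially)
      then show ?thesis using R[of k] s by (intro exI[of _ "R k"]) auto
    qed
    then show ?thesis using between by (force simp: tail_def)
  qed
  have steep: "\<exists>T>0. \<exists>T'>T. integrable \<mu> (\<lambda>y. exp (T' * y)) \<and> 1 \<le> (\<integral>y. exp (T * (y - R)) \<partial>\<mu>)"
    if R: "0 \<le> R" "R < R'" "0 < measure \<mu> {R'..}" for R R'
  proof -
    consider "x_star \<mu> < \<infinity>" | "\<forall>t. mgf \<mu> t < \<infinity>"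
      | "x_star \<mu> = \<infinity>" "bounded {t. mgf \<mu> t < \<infinity>}" "log_concave_measure \<mu>"
      using adm unfolding admissible_def by blast
    then show ?thesis
    proof cases
      case 1
      then obtain s where s: "x_star \<mu> = ereal s" using star_pos by (cases "x_star \<mu>") auto
      have "emeasure \<mu> {y. s \<le> \<bar>y\<bar>} = 0" using bounded[OF s] by (simp add: emeasure_eq_measure)
      then have ae: "AE y in \<mu>. \<not> s \<le> \<bar>y\<bar>"
        by (intro AE_I[where N="{y. s \<le> \<bar>y\<bar>}"]) (auto simp: sets_mu)
      have "t \<in> mg_dom" for t
        unfolding mg_dom_def mem_Collect_eq
      proof (rule integrable_const_bound[where B="exp (\<bar>t\<bar> * s)"])
        show "AE y in \<mu>. norm (exp (t * y)) \<le> exp (\<bar>t\<bar> * s)"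
          using ae
        proof eventually_elim
          case (elim y)
          have "t * y \<le> \<bar>t\<bar> * \<bar>y\<bar>" by (metis abs_ge_self abs_mult)
          also have "\<dots> \<le> \<bar>t\<bar> * s" using elim by (intro mult_left_mono) auto
          finally show ?case by simp
        qed
      qed measurable
      then show ?thesis using R by (intro steep_of_full_domain) (auto simp: tail_def)
    next
      case 2
      then show ?thesis using R mgf_finite_iff by (intro steep_of_full_domain) (auto simp: tail_def)
    next
      case 3
      have "mg_dom = {t. mgf \<mu> t < \<infinity>}" using mgf_finite_iff by auto
      then have bdd: "bdd_above mg_dom" using 3 bounded_imp_bdd_above by simp
      have pos: "0 < tail x" for x
        using between[of x] 3 tail_antimono[of x] by (fastforce intro: less_le_trans)
      show ?thesis
        using log_concave_boundary[OF 3(3) bdd r(2,1) pos] bdd r by (intro steep_of_open_domain) auto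
    qed
  qed
  show ?thesis
    using exhaust steep nondeg r by unfold_locales (auto simp: mg_dom_def)
qed

theorem theorem1p1:
  fixes \<mu> :: "real measure" and \<delta> :: real
  assumes "borel_prob \<mu>" and "even_measure \<mu>" and "admissible \<mu>"
    and "Lambda_star_condition \<mu>"
    and "0 < \<delta>" and "\<delta> < 1/2"
  shows "(\<lambda>n. varrho2 \<mu> n \<delta> - varrho1 \<mu> n \<delta>) \<longlonglongrightarrow> 0"
proof -
  interpret steep_symmetric_law \<mu>
    using assms(1-3) by (rule admissible_steep_symmetric_law)
  have "(\<lambda>n. varrho2 \<mu> n \<delta> - varrho1 \<mu> n \<delta>) \<longlonglongrightarrow> ereal mean_rate - ereal mean_rate"
    by (intro tendsto_diff_ereal varrho1_tendsto varrho2_tendsto assms) auto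
  then show ?thesis by (simp add: zero_ereal_def)
qed

end
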